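(* Let $H\in\mathbb S_{++}^d$, $c_H=(\det H)^{1/d}$ (a known scalar), and $P_\star=c_HH^{-1}$. Let $S^{(1)},\ldots,S^{(K)}$ be matrices with $d$ rows and linearly independent columns whose column spaces are strictly nested (increasing), and write $r_k=\operatorname{rank}S^{(k)}$. Define $$A_k=HS^{(k)},\qquad B_k=c_HS^{(k)},\qquad \mathscr C_k=\{P\in\mathscr P_d:PA_k=B_k\},$$ and, starting from any $P_0\in\mathscr P_d$, the exact projections $$P_k=\operatorname*{arg\,min}_{P\in\mathscr C_k}d_{\mathrm{AI}}(P_{k-1},P),\qquad 1\le k\le K.$$ Then every update exists, is unique, and preserves all earlier cumulative secants ($P_kA_j=B_j$ for $j\le k$). For every $k$, $$d_{\mathrm{AI}}(P_k,P_\star)^2+d_{\mathrm{AI}}(P_{k-1},P_k)^2\le d_{\mathrm{AI}}(P_{k-1},P_\star)^2 .$$ Consequently $$\sum_{j=1}^kd_{\mathrm{AI}}(P_{j-1},P_j)^2\le d_{\mathrm{AI}}(P_0,P_\star)^2-d_{\mathrm{AI}}(P_k,P_\star)^2,\qquad \sum_{j=1}^kd_{\mathrm{AI}}(P_{j-1},P_j)\le\sqrt k\,d_{\mathrm{AI}}(P_0,P_\star).$$ The determinant-one identification threshold is sharp: if $r_K=d-1$ then $P_K=P_\star$, whereas for any cumulative rank $r\le d-2$ the corresponding constraint set $\mathscr C_k$ (with $r_k=r$) contains infinitely many determinant-one positive definite matrices. If each pre-final round contributes exactly $b\ge1$ new independent probe directions and the final round contributes the remainder (to reach cumulative rank $d-1$),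 exact recovery occurs after $K=\lceil (d-1)/b\rceil$ rounds. Finally, each exact outer projection (with $r_k\le d-1$) reduces by congruence to an identity-reference problem: with $\widetilde A_k=P_{k-1}^{1/2}A_k$, $\widetilde B_k=P_{k-1}^{-1/2}B_k$, one has $P_k=P_{k-1}^{1/2}\,s_{\widetilde A_k}(\widetilde B_k)\,P_{k-1}^{1/2}$, and the residual iteration described in the context for $(A,B)=(\widetilde A_k,\widetilde B_k)$, from any $\Sigma_0$ in the determinant-one hidden space, produces feasible controllers $\Phi_{\widetilde A_k}(\widetilde B_k,\Sigma_j)$ that converge to $s_{\widetilde A_k}(\widetilde B_k)$ as $j\to\infty$ and satisfy the residual certificate $d_{\mathrm{AI}}(\Phi_{\widetilde A_k}(\widetilde B_k,\Sigma_j),s_{\widetilde A_k}(\widetilde B_k))\le\|W_{\widetilde B_k}(\Sigma_j)\|_F$ for every $j$.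
   Context: $\mathbb S_{++}^d$ denotes real symmetric positive definite $d\times d$ matrices with affine-invariant distance $d_{\mathrm{AI}}(P,P')=\|\log(P^{-1/2}P'P^{-1/2})\|_F$; $\mathscr P_d=\{P\in\mathbb S_{++}^d:\det P=1\}$. Residual iteration. Let $A\in\mathbb R^{d\times m}$ have full column rank, $1\le m<d$, $n=d-m$, and let $B\in\mathbb R^{d\times m}$ satisfy $A^\top B\in\mathbb S_{++}^m$. Then $s_A(B)$ is the unique minimizer of $d_{\mathrm{AI}}(I,P)$ over $\{P\in\mathscr P_d:PA=B\}$. Write $A=UC$ with $U^\top U=I_m$, $C$ invertible, and $Q=[U,V]\in O(d)$; put $M=C^{-\top}A^\top BC^{-1}$, $N=V^\top BC^{-1}$, $T=NM^{-1}$, $L=\begin{pmatrix}I_m&0\\ T&I_n\end{pmatrix}$, $\rho=(\det M)^{-1/n}$, $\mathcal Q_\Sigma=\operatorname{diag}(M,\rho\Sigma)$ and $\Phi_A(B,\Sigma)=QL\mathcal Q_\Sigma L^\top Q^\top$ for $\Sigma\in\mathscr P_n$. Let $R_0=L^{-1}L^{-\top}$, $\mathcal R(\Sigma)=\log(\mathcal Q_\Sigma^{-1/2}R_0\mathcal Q_\Sigma^{-1/2})$, and $W_B(\Sigma)=\mathcal R_{22}(\Sigma)-\frac{\operatorname{tr}\mathcal R_{22}(\Sigma)}nI_n$, where $\mathcal R_{22}$ is the lower-right $n\times n$ block. For $\Sigma_0\in\mathscr P_n$ put $D_0=d_{\mathrm{AI}}(R_0,\mathcal Q_{\Sigma_0})$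 and $L_0=\psi(D_0/\sqrt2)$, with $\psi(s)=s\coth s$, $\psi(0)=1$; the iteration is $\Sigma_{j+1}=\Sigma_j^{1/2}\exp(L_0^{-1}W_B(\Sigma_j))\Sigma_j^{1/2}$. *)

theory Defs
  imports Complex_Main "Jordan_Normal_Form.DL_Rank"
begin

definition lin_indpt_cols :: "real mat \<Rightarrow> bool" where
  "lin_indpt_cols A \<longleftrightarrow> distinct (cols A) \<and>
     \<not> module.lin_dep class_ring (module_vec TYPE(real) (dim_row A)) (set (cols A))"

abbreviation col_span :: "real mat \<Rightarrow> real vec set" where
  "col_span A \<equiv> vec_space.col_space (dim_row A) A"

abbreviation mat_rank :: "real mat \<Rightarrow> nat" where
  "mat_rank A \<equiv> vec_space.rank (dim_row A) A"

(* Only used on invertible matrices; unspecified on singular ones. *)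
abbreviation minv :: "real mat \<Rightarrow> real mat" where
  "minv A \<equiv> the (mat_inverse A)"

definition hcat :: "real mat \<Rightarrow> real mat \<Rightarrow> real mat" where
  "hcat U V = four_block_mat U V (0\<^sub>m 0 (dim_col U)) (0\<^sub>m 0 (dim_col V))"

definition mat_tr :: "real mat \<Rightarrow> real" where
  "mat_tr A = (\<Sum>i<dim_row A. A $$ (i, i))"

definition frob_norm :: "real mat \<Rightarrow> real" where
  "frob_norm A = sqrt (\<Sum>i<dim_row A. \<Sum>j<dim_col A. (A $$ (i, j))\<^sup>2)"

definition SPD :: "nat \<Rightarrow> real mat set" where
  "SPD d = {P \<in> carrier_mat d d. P\<^sup>T = P \<and>
     (\<forall>v \<in> carrier_vec d. v \<noteq> 0\<^sub>v d \<longrightarrow> 0 < v \<bullet> (P *\<^sub>v v))}"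

definition SPD1 :: "nat \<Rightarrow> real mat set" where
  "SPD1 d = {P \<in> SPD d. det P = 1}"

(* The matrix type carries no topology, so the exponential series is summed entrywise. *)
definition mat_exp :: "real mat \<Rightarrow> real mat" where
  "mat_exp X = mat (dim_row X) (dim_row X) (\<lambda>(i, j). \<Sum>k. (X ^\<^sub>m k) $$ (i, j) / fact k)"

(* Meant for positive definite P only, where the symmetric logarithm and the
   positive definite square root exist and are unique. *)
definition mat_log :: "real mat \<Rightarrow> real mat" where
  "mat_log P = (THE X. X \<in> carrier_mat (dim_row P) (dim_row P) \<and> X\<^sup>T = X \<and> mat_exp X = P)"

definition mat_sqrt :: "real mat \<Rightarrow> real mat" where
  "mat_sqrt P = (THE R. R \<in> SPD (dim_row P) \<and> R * R = P)"

definition d_AI :: "real mat \<Rightarrow> real mat \<Rightarrow> real" where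
  "d_AI P P' = frob_norm (mat_log (minv (mat_sqrt P) * P' * minv (mat_sqrt P)))"

definition feasible :: "nat \<Rightarrow> real mat \<Rightarrow> real mat \<Rightarrow> real mat set" where
  "feasible d A B = {P \<in> SPD1 d. P * A = B}"

definition id_proj :: "real mat \<Rightarrow> real mat \<Rightarrow> real mat" where
  "id_proj A B = arg_min (d_AI (1\<^sub>m (dim_row A))) (\<lambda>P. P \<in> feasible (dim_row A) A B)"

(* A = U C with U having orthonormal columns, completed by V to an orthogonal matrix [U, V]. *)
definition orth_factorization :: "real mat \<Rightarrow> real mat \<Rightarrow> real mat \<Rightarrow> real mat \<Rightarrow> bool" where
  "orth_factorization A U V C \<longleftrightarrow>
     (let d = dim_row A; m = dim_col A in
        U \<in> carrier_mat d m \<and> V \<in> carrier_mat d (d - m) \<and> C \<in> carrier_mat m m \<and>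
        invertible_mat C \<and> A = U * C \<and> U\<^sup>T * U = 1\<^sub>m m \<and>
        (hcat U V)\<^sup>T * hcat U V = 1\<^sub>m d)"

definition res_M :: "real mat \<Rightarrow> real mat \<Rightarrow> real mat \<Rightarrow> real mat" where
  "res_M A B C = (minv C)\<^sup>T * A\<^sup>T * B * minv C"

definition res_T :: "real mat \<Rightarrow> real mat \<Rightarrow> real mat \<Rightarrow> real mat \<Rightarrow> real mat" where
  "res_T A B V C = (V\<^sup>T * B * minv C) * minv (res_M A B C)"

definition res_L :: "real mat \<Rightarrow> real mat \<Rightarrow> real mat \<Rightarrow> real mat \<Rightarrow> real mat" where
  "res_L A B V C =
     four_block_mat (1\<^sub>m (dim_col A)) (0\<^sub>m (dim_col A) (dim_col V))
                    (res_T A B V C)   (1\<^sub>m (dim_col V))"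

definition res_Q :: "real mat \<Rightarrow> real mat \<Rightarrow> real mat \<Rightarrow> real mat \<Rightarrow> real mat \<Rightarrow> real mat" where
  "res_Q A B V C \<Sigma> =
     (let m = dim_col A; n = dim_col V; M = res_M A B C; \<rho> = det M powr (- (1 / real n))
      in four_block_mat M (0\<^sub>m m n) (0\<^sub>m n m) (\<rho> \<cdot>\<^sub>m \<Sigma>))"

definition controller ::
  "real mat \<Rightarrow> real mat \<Rightarrow> real mat \<Rightarrow> real mat \<Rightarrow> real mat \<Rightarrow> real mat \<Rightarrow> real mat" where
  "controller A B U V C \<Sigma> =
     hcat U V * res_L A B V C * res_Q A B V C \<Sigma> * (res_L A B V C)\<^sup>T * (hcat U V)\<^sup>T"

definition res_R0 :: "real mat \<Rightarrow> real mat \<Rightarrow> real mat \<Rightarrow> real mat \<Rightarrow> real mat" where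
  "res_R0 A B V C = minv (res_L A B V C) * (minv (res_L A B V C))\<^sup>T"

definition res_R :: "real mat \<Rightarrow> real mat \<Rightarrow> real mat \<Rightarrow> real mat \<Rightarrow> real mat \<Rightarrow> real mat" where
  "res_R A B V C \<Sigma> =
     (let H = minv (mat_sqrt (res_Q A B V C \<Sigma>)) in mat_log (H * res_R0 A B V C * H))"

definition res_W :: "real mat \<Rightarrow> real mat \<Rightarrow> real mat \<Rightarrow> real mat \<Rightarrow> real mat \<Rightarrow> real mat" where
  "res_W A B V C \<Sigma> =
     (let m = dim_col A; n = dim_col V;
          R22 = mat n n (\<lambda>(i, j). res_R A B V C \<Sigma> $$ (m + i, m + j))
      in R22 - (mat_tr R22 / real n) \<cdot>\<^sub>m 1\<^sub>m n)"

definition psi :: "real \<Rightarrow> real" where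
  "psi s = (if s = 0 then 1 else s * (cosh s / sinh s))"

definition step_const :: "real mat \<Rightarrow> real mat \<Rightarrow> real mat \<Rightarrow> real mat \<Rightarrow> real mat \<Rightarrow> real" where
  "step_const A B V C \<Sigma>0 = psi (d_AI (res_R0 A B V C) (res_Q A B V C \<Sigma>0) / sqrt 2)"

primrec res_iter ::
  "real mat \<Rightarrow> real mat \<Rightarrow> real mat \<Rightarrow> real mat \<Rightarrow> real mat \<Rightarrow> nat \<Rightarrow> real mat" where
  "res_iter A B V C \<Sigma>0 0 = \<Sigma>0"
| "res_iter A B V C \<Sigma>0 (Suc j) =
     (let \<Sigma> = res_iter A B V C \<Sigma>0 j in
        mat_sqrt \<Sigma> * mat_exp (inverse (step_const A B V C \<Sigma>0) \<cdot>\<^sub>m res_W A B V C \<Sigma>) * mat_sqrt \<Sigma>)"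

end

theory Submission
  imports Defs "Jordan_Normal_Form.Spectral_Radius"
begin

text \<open>The whole development rests on one comparison. Let \<open>Y\<^sub>t\<close> be the logarithm of \<open>exp Y\<close> seen from the
  point \<open>exp(tX)\<close> of a geodesic through the identity, that is \<open>exp Y\<^sub>t = exp(-tX/2) exp(Y) exp(-tX/2)\<close>, so
  that \<open>\<parallel>Y\<^sub>t\<parallel>\<close> is the affine-invariant distance of \<open>exp(tX)\<close> and \<open>exp Y\<close>. The function
  \<open>\<phi>(t) = \<parallel>Y\<^sub>t\<parallel>\<^sup>2/2\<close> has derivative \<open>-\<langle>Y\<^sub>t, X\<rangle>\<close> (\<open>half_square_has_derivative\<close>), and
  \<open>(t - s) \<parallel>X\<parallel>\<^sup>2 \<le> \<langle>Y\<^sub>s - Y\<^sub>t, X\<rangle> \<le> (t - s) \<psi>(D) \<parallel>X\<parallel>\<^sup>2\<close> for \<open>s < t\<close>, the upper bound as long as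
  \<open>\<parallel>Y\<^sub>u\<parallel> \<le> D\<close> on \<open>[s, t]\<close> (\<open>rel_log_inner_bounds\<close>). Thus \<open>\<phi>\<close> is strongly convex with modulus \<open>\<parallel>X\<parallel>\<^sup>2\<close>, which is non-positive
  curvature, and its second derivative is controlled from above, which is what gradient steps need.

  Both bounds come from an exact identity for finite displacements. If \<open>Z = log(exp(-V) exp(Y)
  exp(-V))\<close>, then between an eigenvector of \<open>Y\<close> with eigenvalue \<open>l\<close> and one of \<open>Z\<close> with eigenvalue \<open>m\<close> the
  entries of \<open>sinh V\<close> are \<open>tanh((l - m)/2)\<close> times those of \<open>cosh V\<close> (\<open>sinh_cosh_entries\<close>). This exact
  relation gives \<open>\<langle>Y - Z, sinh 2V\<rangle> = 4 \<Sum> \<psi>((l - m)/2) (sinh V)\<^sub>l\<^sub>m\<^sup>2\<close> with \<open>\<psi>(s) = s coth s \<ge> 1\<close>. The left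
  side telescopes over the steps of a subdivision of a geodesic, and refining the subdivision turns
  \<open>sinh\<close> into the identity.

  A minimizer of the distance over a secant constraint exists because, in coordinates consisting of
  an eigenbasis and eigenvalues, a minimizing sequence stays in a compact set. The constraint contains
  the geodesics between its points (\<open>feasible_geodesic\<close>), so at a minimizer \<open>\<phi>\<close> is stationary and strong
  convexity is the Pythagorean inequality (\<open>projection_Pythagoras\<close>). It gives uniqueness, and, applied to
  \<open>P\<^sub>\<star>\<close>, which satisfies every constraint, the inequality of each round; the sums follow by telescoping and
  by Cauchy-Schwarz. Earlier secants survive because earlier probe directions are combinations of
  the current ones.

  In block coordinates \<open>P A = B\<close> fixes the first block column of \<open>P\<close> and leaves exactly the Schur
  complement free, so the constraint is a copy of the determinant-one positive definite matrices of
  size \<open>d - r\<close> (\<open>\<Phi>_surj\<close>, \<open>\<Phi>_inj\<close>). This set is a point for \<open>d - r = 1\<close> and infinite for \<open>d - r \<ge> 2\<close>, which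
  is the identification threshold. On it, \<open>-W\<close> is the gradient of half the squared distance. Adding
  strong convexity at an iterate to the Pythagorean inequality at the projection yields the residual
  certificate. The upper bound with \<open>\<psi>(D\<^sub>0) \<le> \<surd>2 \<psi>(D\<^sub>0/\<surd>2) < 2 L\<^sub>0\<close> makes every step of size \<open>1/L\<^sub>0\<close>
  decrease \<open>\<phi>\<close> by a fixed multiple of \<open>\<parallel>W\<parallel>\<^sup>2\<close> (\<open>gradient_step_descent\<close>), so the residuals tend to zero and
  the certificate gives convergence.\<close>

section \<open>Matrix algebra with dimension side conditions\<close>

text \<open>Carrier premises mention inner dimensions that do not occur in the conclusion of an algebraic
  law. Phrased as equations between \<open>dim_row\<close> and \<open>dim_col\<close>, the side conditions can be discharged by
  rewriting, so that the laws are rewrite rules.\<close>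

lemma mm_assoc:
  "dim_col A = dim_row B \<Longrightarrow> dim_col B = dim_row C \<Longrightarrow> (A * B) * C = A * (B * (C :: real mat))"
  by (rule assoc_mult_mat) (rule carrier_matI[OF refl refl], rule carrier_matI, simp, rule refl, rule carrier_matI, simp, rule refl)

lemma mm_transpose: "dim_col A = dim_row B \<Longrightarrow> (A * B)\<^sup>T = B\<^sup>T * (A :: real mat)\<^sup>T"
  by (metis carrier_matI transpose_mult)

lemma mm_one_left: "dim_row A = n \<Longrightarrow> 1\<^sub>m n * A = (A :: real mat)"
  by (metis carrier_matI left_mult_one_mat)

lemma mm_one_right: "dim_col A = n \<Longrightarrow> A * 1\<^sub>m n = (A :: real mat)"
  by (metis carrier_matI right_mult_one_mat)

lemma mm_smult_left: "dim_col A = dim_row B \<Longrightarrow> (k \<cdot>\<^sub>m A) * B = k \<cdot>\<^sub>m (A * (B :: real mat))"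
  by (metis carrier_matI mult_smult_assoc_mat)

lemma mm_smult_right: "dim_col A = dim_row B \<Longrightarrow> A * (k \<cdot>\<^sub>m B) = k \<cdot>\<^sub>m (A * (B :: real mat))"
  by (metis carrier_matI mult_smult_distrib)

lemma mm_vec: "dim_col A = dim_row B \<Longrightarrow> dim_col B = dim_vec v \<Longrightarrow>
    (A * B) *\<^sub>v v = A *\<^sub>v (B *\<^sub>v (v :: real vec))"
  by (metis assoc_mult_mat_vec carrier_matI carrier_vecI)

lemma mat_index_mult:
  "i < dim_row A \<Longrightarrow> j < dim_col B \<Longrightarrow> dim_col A = dim_row B \<Longrightarrow>
     (A * B) $$ (i, j) = (\<Sum>k<dim_row B. A $$ (i, k) * (B $$ (k, j) :: real))"
  by (auto simp: scalar_prod_def atLeast0LessThan intro!: sum.cong)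

lemma smult_smult_mat: "a \<cdot>\<^sub>m (b \<cdot>\<^sub>m A) = (a * b) \<cdot>\<^sub>m (A :: real mat)"
  by (rule eq_matI) auto

lemma mm_cancel:
  "G * F = 1\<^sub>m k \<Longrightarrow> dim_col G = dim_row F \<Longrightarrow> dim_row Y = k \<Longrightarrow> dim_col F = k \<Longrightarrow>
     G * (F * Y) = (Y :: real mat)"
  by (metis mm_assoc mm_one_left)

lemmas mm_dims = index_mult_mat(2,3) index_transpose_mat(2,3)

\<comment> \<open>Associativity is applied explicitly below, in both directions.\<close>
declare assoc_mult_mat [simp del] assoc_mult_mat_vec [simp del]

text \<open>A one-sided inverse of a square matrix is two-sided, so that \<open>minv\<close> is determined by one
  equation.\<close>

lemma minv_unique:
  assumes "A \<in> carrier_mat n n" "B \<in> carrier_mat n n" "B * A = 1\<^sub>m n"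
  shows "minv A = B"
proof -
  have AB: "A * B = 1\<^sub>m n" using mat_mult_left_right_inverse[OF assms(2,1,3)] .
  have "A \<in> Units (ring_mat TYPE(real) n ())"
    using assms AB unfolding Units_def ring_mat_def by auto
  then obtain C where C: "mat_inverse A = Some C"
    using mat_inverse(1)[OF assms(1), where b = "()"] by (cases "mat_inverse A") auto
  note C' = mat_inverse(2)[OF assms(1) C]
  have "B * A * C = B * (A * C)" using C' assms(1,2) by (intro assoc_mult_mat) auto
  then have "C = B" using C' assms(2) unfolding assms(3) by (simp add: left_mult_one_mat[of C n n])
  then show ?thesis using C by simp
qed

lemma minv_det:
  assumes "A \<in> carrier_mat n n" "det A \<noteq> 0"
  shows "minv A \<in> carrier_mat n n" "minv A * A = 1\<^sub>m n" "A * minv A = 1\<^sub>m n"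
proof -
  have "A \<in> Units (ring_mat TYPE(real) n ())" using det_non_zero_imp_unit[OF assms] .
  then obtain C where C: "mat_inverse A = Some C"
    using mat_inverse(1)[OF assms(1), where b = "()"] by (cases "mat_inverse A") auto
  with mat_inverse(2)[OF assms(1) C]
  show "minv A \<in> carrier_mat n n" "minv A * A = 1\<^sub>m n" "A * minv A = 1\<^sub>m n" by auto
qed

section \<open>Trace inner product\<close>

definition ip :: "real mat \<Rightarrow> real mat \<Rightarrow> real" where
  "ip A B = (\<Sum>i<dim_row A. \<Sum>j<dim_col A. A $$ (i, j) * B $$ (i, j))"

lemma frob_norm_ip: "(frob_norm A)\<^sup>2 = ip A A"
  by (simp add: frob_norm_def ip_def power2_eq_square sum_nonneg)

lemma frob_norm_nonneg: "0 \<le> frob_norm A"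
  by (simp add: frob_norm_def sum_nonneg)

lemma frob_norm_eq_sqrt: "frob_norm A = sqrt (ip A A)"
  by (simp add: frob_norm_def ip_def power2_eq_square)

lemma ip_comm: "dim_row A = dim_row B \<Longrightarrow> dim_col A = dim_col B \<Longrightarrow> ip A B = ip B A"
  by (simp add: ip_def mult.commute)

lemma ip_nonneg: "0 \<le> ip A A"
  by (simp add: ip_def sum_nonneg)

lemma ip_minus_right:
  "dim_row A = dim_row C \<Longrightarrow> dim_col A = dim_col C \<Longrightarrow> ip A (B - C) = ip A B - ip A C"
  by (simp add: ip_def algebra_simps sum_subtractf)

lemma ip_minus_left:
  "dim_row A = dim_row B \<Longrightarrow> dim_col A = dim_col B \<Longrightarrow> ip (A - B) C = ip A C - ip B C"
  by (simp add: ip_def algebra_simps sum_subtractf)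

lemma ip_smult_right: "dim_row A = dim_row B \<Longrightarrow> dim_col A = dim_col B \<Longrightarrow>
    ip A (k \<cdot>\<^sub>m B) = k * ip A B"
  by (simp add: ip_def sum_distrib_left algebra_simps)

lemma ip_smult_left: "ip (k \<cdot>\<^sub>m A) B = k * ip A B"
  by (simp add: ip_def sum_distrib_left algebra_simps)

lemma mat_tr_mult:
  "dim_row B = dim_row A \<Longrightarrow> dim_col B = dim_col A \<Longrightarrow> mat_tr (A * B\<^sup>T) = ip A B"
  by (simp add: mat_tr_def ip_def scalar_prod_def atLeast0LessThan)

lemma mat_tr_comm:
  assumes "dim_row B = dim_col A" "dim_col B = dim_row A"
  shows "mat_tr (A * B) = mat_tr (B * A)"
proof -
  have "mat_tr (A * B) = (\<Sum>i<dim_row A. \<Sum>k<dim_col A. A $$ (i, k) * B $$ (k, i))"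
    using assms by (simp add: mat_tr_def scalar_prod_def atLeast0LessThan)
  also have "\<dots> = (\<Sum>k<dim_col A. \<Sum>i<dim_row A. A $$ (i, k) * B $$ (k, i))"
    by (rule sum.swap)
  also have "\<dots> = mat_tr (B * A)"
    using assms by (simp add: mat_tr_def scalar_prod_def atLeast0LessThan mult.commute)
  finally show ?thesis .
qed

lemma frob_norm_eq_0:
  assumes "frob_norm A = 0" "i < dim_row A" "j < dim_col A"
  shows "A $$ (i, j) = 0"
proof -
  have "(\<Sum>i<dim_row A. \<Sum>j<dim_col A. (A $$ (i, j))\<^sup>2) = 0"
    using assms(1) by (simp add: frob_norm_def sum_nonneg)
  then have "(\<Sum>j<dim_col A. (A $$ (i, j))\<^sup>2) = 0"
    using assms(2) by (simp add: sum_nonneg_eq_0_iff sum_nonneg)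
  then show ?thesis
    using assms(3) by (simp add: sum_nonneg_eq_0_iff)
qed

lemma ip_Cauchy_Schwarz:
  assumes "dim_row A = dim_row B" "dim_col A = dim_col B"
  shows "ip A B \<le> frob_norm A * frob_norm B"
proof (cases "frob_norm B = 0")
  case True
  have "ip A B = 0"
    unfolding ip_def using frob_norm_eq_0[OF True] assms by (intro sum.neutral ballI) simp
  with True show ?thesis by simp
next
  case False
  then have b: "ip B B > 0" using ip_nonneg[of B] by (simp add: frob_norm_eq_sqrt)
  define t where "t = ip A B / ip B B"
  have "0 \<le> ip (A - t \<cdot>\<^sub>m B) (A - t \<cdot>\<^sub>m B)" by (rule ip_nonneg)
  also have "\<dots> = ip A A - 2 * t * ip A B + t * t * ip B B"
    using assms ip_comm[of A B]
    by (simp add: ip_minus_left ip_minus_right ip_smult_left ip_smult_right algebra_simps)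
  also have "\<dots> = ip A A - (ip A B)\<^sup>2 / ip B B"
    using b by (simp add: t_def power2_eq_square field_simps)
  finally have "(ip A B)\<^sup>2 \<le> ip A A * ip B B" using b by (simp add: field_simps)
  then have "sqrt ((ip A B)\<^sup>2) \<le> sqrt (ip A A * ip B B)" by (rule real_sqrt_le_mono)
  then show ?thesis by (simp add: real_sqrt_mult frob_norm_eq_sqrt)
qed

section \<open>Orthogonal matrices\<close>

definition orth :: "nat \<Rightarrow> real mat \<Rightarrow> bool" where
  "orth d U \<longleftrightarrow> U \<in> carrier_mat d d \<and> U\<^sup>T * U = 1\<^sub>m d"

lemma orthD:
  assumes "orth d U"
  shows "U \<in> carrier_mat d d" "dim_row U = d" "dim_col U = d" "U\<^sup>T * U = 1\<^sub>m d" "U * U\<^sup>T = 1\<^sub>m d"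
  using assms mat_mult_left_right_inverse[of "U\<^sup>T" d U] by (auto simp: orth_def)

lemma orth_cancel:
  assumes "orth d U" "dim_row B = d"
  shows "U\<^sup>T * (U * B) = B" "U * (U\<^sup>T * B) = B"
  using orthD[OF assms(1)] assms(2)
  by (simp_all add: mm_assoc[symmetric] mm_one_left)

lemma orth_one: "orth d (1\<^sub>m d)"
  by (simp add: orth_def)

lemma orth_transpose: "orth d U \<Longrightarrow> orth d U\<^sup>T"
  by (frule orthD(5)) (simp add: orth_def)

lemma orth_mult: assumes "orth d U" "orth d W" shows "orth d (U * W)"
  using orthD[OF assms(1)] orthD[OF assms(2)] orth_cancel[OF assms(1), of W]
  by (simp add: orth_def mm_transpose mm_assoc)

lemma orth_det:
  assumes "orth d U"
  shows "det U * det U = 1"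
  using orthD[OF assms] det_mult[of "U\<^sup>T" d U] det_transpose[of U d] by simp

lemma ip_orth:
  assumes "orth d U" "orth d W" "A \<in> carrier_mat d d" "B \<in> carrier_mat d d"
  shows "ip (U\<^sup>T * A * W) (U\<^sup>T * B * W) = ip A B"
proof -
  note [simp] = orthD[OF assms(1)] orthD[OF assms(2)] carrier_matD[OF assms(3)]
    carrier_matD[OF assms(4)] orth_cancel[OF assms(1)] orth_cancel[OF assms(2)]
  have "ip (U\<^sup>T * A * W) (U\<^sup>T * B * W) = mat_tr ((U\<^sup>T * A * W) * (U\<^sup>T * B * W)\<^sup>T)"
    by (subst mat_tr_mult) auto
  also have "(U\<^sup>T * A * W) * (U\<^sup>T * B * W)\<^sup>T = U\<^sup>T * (A * B\<^sup>T * U)"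
    by (simp add: mm_transpose mm_assoc)
  also have "mat_tr \<dots> = mat_tr (A * B\<^sup>T * U * U\<^sup>T)"
    by (subst mat_tr_comm) auto
  also have "A * B\<^sup>T * U * U\<^sup>T = A * B\<^sup>T"
    by (simp add: mm_assoc mm_one_right)
  also have "mat_tr \<dots> = ip A B" by (subst mat_tr_mult) auto
  finally show ?thesis .
qed

lemma sum_squares_pos:
  fixes v :: "real vec"
  assumes "v \<in> carrier_vec d" "v \<noteq> 0\<^sub>v d"
  shows "0 < (\<Sum>i<d. (v $ i)\<^sup>2)"
proof -
  obtain i where "i < d" "v $ i \<noteq> 0" using assms by (metis carrier_vecD eq_vecI index_zero_vec(1,2))
  then show ?thesis by (intro sum_pos2[of _ i]) auto
qed

text \<open>Fewer than \<open>d\<close> orthonormal columns leave a direction orthogonal to all of them, because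
  padding them with zero columns gives a singular square matrix. Adding one unit vector at a time
  completes an orthonormal family to an orthogonal matrix.\<close>

lemma orthonormal_completion:
  assumes "W \<in> carrier_mat d m" "W\<^sup>T * W = 1\<^sub>m m" "m \<le> d"
  shows "\<exists>Q. orth d Q \<and> (\<forall>i<d. \<forall>j<m. Q $$ (i, j) = W $$ (i, j))"
  using assms
proof (induction "d - m" arbitrary: m W)
  case 0
  then show ?case by (auto simp: orth_def)
next
  case (Suc k)
  then have md: "m < d" by auto
  define P where "P = mat d d (\<lambda>(i, j). if j < m then W $$ (i, j) else 0)"
  have Pc: "P \<in> carrier_mat d d" by (simp add: P_def)
  have "P *\<^sub>v unit_vec d m = 0\<^sub>v d" "unit_vec d m \<noteq> (0\<^sub>v d :: real vec)"
    using md by (auto simp: P_def)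
  then have "det P = 0" using det_0_iff_vec_prod_zero_field[OF Pc] by (metis unit_vec_carrier)
  then have "det P\<^sup>T = 0" using det_transpose[OF Pc] by simp
  then obtain v where v: "v \<in> carrier_vec d" "v \<noteq> 0\<^sub>v d" "P\<^sup>T *\<^sub>v v = 0\<^sub>v d"
    using det_0_iff_vec_prod_zero_field[of "P\<^sup>T" d] Pc by auto
  define n where "n = (\<Sum>i<d. (v $ i)\<^sup>2)"
  have n: "n > 0" unfolding n_def by (rule sum_squares_pos[OF v(1,2)])
  have ov: "(\<Sum>i<d. W $$ (i, j) * v $ i) = 0" if "j < m" for j
  proof -
    have "(P\<^sup>T *\<^sub>v v) $ j = 0" using v(3) that md by simp
    then show ?thesis using that md v(1)
      by (simp add: P_def scalar_prod_def atLeast0LessThan)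
  qed
  define W' where "W' = mat d (Suc m) (\<lambda>(i, j). if j < m then W $$ (i, j) else v $ i / sqrt n)"
  have W'c: "W' \<in> carrier_mat d (Suc m)" by (simp add: W'_def)
  have "W'\<^sup>T * W' = 1\<^sub>m (Suc m)"
  proof (rule eq_matI)
    fix i j assume "i < dim_row (1\<^sub>m (Suc m) :: real mat)" "j < dim_col (1\<^sub>m (Suc m) :: real mat)"
    then have ij: "i < Suc m" "j < Suc m" by auto
    have e: "(W'\<^sup>T * W') $$ (i, j) = (\<Sum>k<d. W' $$ (k, i) * W' $$ (k, j))"
      using ij W'c by (subst mat_index_mult) auto
    have 1: "(\<Sum>k<d. W $$ (k, i) * W $$ (k, j)) = (if i = j then 1 else 0)" if "i < m" "j < m"
    proof -
      have "(W\<^sup>T * W) $$ (i, j) = (\<Sum>k<d. W $$ (k, i) * W $$ (k, j))"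
        using that Suc.prems(1) by (subst mat_index_mult) auto
      then show ?thesis using Suc.prems(2) that by simp
    qed
    have 2: "(\<Sum>k<d. W $$ (k, i) * (v $ k / sqrt n)) = 0" if "i < m" for i
      by (simp add: ov[OF that] flip: sum_divide_distrib)
    have 3: "(\<Sum>k<d. (v $ k / sqrt n) * (v $ k / sqrt n)) = 1"
      using n by (simp add: n_def power2_eq_square flip: sum_divide_distrib)
    show "(W'\<^sup>T * W') $$ (i, j) = 1\<^sub>m (Suc m) $$ (i, j)"
      unfolding e using ij 1 2[of i] 2[of j] 3
      by (auto simp: W'_def less_Suc_eq mult.commute)
  qed (simp_all add: W'_def)
  moreover have "k = d - Suc m" "Suc m \<le> d" using Suc.hyps(2) md by auto
  ultimately obtain Q where Q: "orth d Q" "\<forall>i<d. \<forall>j<Suc m. Q $$ (i, j) = W' $$ (i, j)"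
    using Suc.hyps(1)[OF _ W'c] by blast
  have "\<forall>i<d. \<forall>j<m. Q $$ (i, j) = W $$ (i, j)"
    using Q(2) by (auto simp: W'_def)
  with Q(1) show ?case by blast
qed

section \<open>Functional calculus in an orthonormal eigenbasis\<close>

text \<open>The symmetric matrix with eigenvector columns \<open>U\<close> and eigenvalues \<open>f\<close>. Keeping the eigenvalue
  function separate makes the exponential, the logarithm and the square root act on \<open>f\<close> alone.\<close>

definition spec :: "real mat \<Rightarrow> (nat \<Rightarrow> real) \<Rightarrow> real mat" where
  "spec U f = U * mat_diag (dim_col U) f * U\<^sup>T"

definition bdiag :: "real mat \<Rightarrow> real mat \<Rightarrow> real mat" where
  "bdiag A B = four_block_mat A (0\<^sub>m (dim_row A) (dim_col B)) (0\<^sub>m (dim_row B) (dim_col A)) B"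

lemma mat_diag_dims [simp]: "dim_row (mat_diag n f) = n" "dim_col (mat_diag n f) = n"
  by (auto simp: mat_diag_def)

lemma mat_diag_index: "i < n \<Longrightarrow> j < n \<Longrightarrow> mat_diag n f $$ (i, j) = (if i = j then f j else 0)"
  by (auto simp: mat_diag_def)

lemma mat_diag_transpose [simp]: "(mat_diag n f)\<^sup>T = (mat_diag n f :: real mat)"
  by (rule eq_matI) (auto simp: mat_diag_def)

lemma spec_dims [simp]: "dim_row (spec U f) = dim_row U" "dim_col (spec U f) = dim_row U"
  by (auto simp: spec_def)

lemma spec_carrier: "orth d U \<Longrightarrow> spec U f \<in> carrier_mat d d"
  by (frule orthD(2)) (rule carrier_matI; simp)

lemma spec_transpose [simp]: "(spec U f)\<^sup>T = spec U f"
  by (simp add: spec_def mm_transpose mm_assoc)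

lemma spec_index:
  assumes "i < dim_row U" "j < dim_row U"
  shows "spec U f $$ (i, j) = (\<Sum>l<dim_col U. U $$ (i, l) * f l * U $$ (j, l))"
proof -
  have "U * mat_diag (dim_col U) f = mat (dim_row U) (dim_col U) (\<lambda>(i, j). U $$ (i, j) * f j)"
    by (rule mat_diag_mult_right) (rule carrier_matI, auto)
  then show ?thesis using assms by (simp add: spec_def mat_index_mult del: index_mult_mat(1))
qed

lemma spec_cong: "(\<And>i. i < dim_col U \<Longrightarrow> f i = g i) \<Longrightarrow> spec U f = spec U g"
  by (rule eq_matI) (auto simp: spec_index)

lemma spec_add: "spec U f + spec U g = spec U (\<lambda>i. f i + g i)"
  by (rule eq_matI) (auto simp: spec_index algebra_simps sum.distrib)

lemma spec_minus: "spec U f - spec U g = spec U (\<lambda>i. f i - g i)"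
  by (rule eq_matI) (auto simp: spec_index algebra_simps sum_subtractf)

lemma spec_smult: "k \<cdot>\<^sub>m spec U f = spec U (\<lambda>i. k * f i)"
  by (rule eq_matI) (auto simp: spec_index algebra_simps sum_distrib_left)

lemma spec_mult: assumes "orth d U" shows "spec U f * spec U g = spec U (\<lambda>i. f i * g i)"
proof -
  note [simp] = orthD(2,3)[OF assms]
  have "spec U f * spec U g = U * (mat_diag d f * (U\<^sup>T * (U * (mat_diag d g * U\<^sup>T))))"
    by (simp add: spec_def mm_assoc)
  also have "\<dots> = U * ((mat_diag d f * mat_diag d g) * U\<^sup>T)"
    by (simp add: orth_cancel[OF assms] mm_assoc del: mat_diag_diag)
  finally show ?thesis by (simp add: spec_def mm_assoc)
qed

lemma spec_const: assumes "orth d U" shows "spec U (\<lambda>_. 1) = 1\<^sub>m d"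
  using orthD[OF assms] by (simp add: spec_def mm_one_right)

lemma spec_orth_conj:
  assumes "dim_col O' = dim_row U"
  shows "O' * spec U f * O'\<^sup>T = spec (O' * U) f"
  using assms by (simp add: spec_def mm_transpose mm_assoc)

lemma spec_det: assumes "orth d U" shows "det (spec U f) = (\<Prod>i<d. f i)"
proof -
  note [simp] = orthD(2,3)[OF assms]
  have "det (spec U f) = det U * det (mat_diag d f) * det U"
    using orthD(1)[OF assms] det_transpose[of U d]
    by (simp add: spec_def det_mult[of _ d])
  also have "det (mat_diag d f) = (\<Prod>i<d. f i)"
    by (subst det_upper_triangular[of _ d])
      (auto simp: prod_list_diag_prod mat_diag_index atLeast0LessThan)
  finally show ?thesis using orth_det[OF assms] by (simp add: mult.commute mult.left_commute)
qed

lemma spec_tr: assumes "orth d U" shows "mat_tr (spec U f) = (\<Sum>i<d. f i)"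
proof -
  note [simp] = orthD(2,3)[OF assms]
  have "mat_tr (spec U f) = mat_tr (U\<^sup>T * (U * mat_diag d f))"
    unfolding spec_def by (subst mat_tr_comm) auto
  also have "\<dots> = (\<Sum>i<d. f i)" by (simp add: orth_cancel[OF assms] mat_tr_def mat_diag_index)
  finally show ?thesis .
qed

lemma spec_ip: assumes "orth d U" shows "ip (spec U f) (spec U g) = (\<Sum>i<d. f i * g i)"
proof -
  have "ip (spec U f) (spec U g) = mat_tr (spec U f * (spec U g)\<^sup>T)"
    by (subst mat_tr_mult) auto
  then show ?thesis by (simp add: spec_mult[OF assms] spec_tr[OF assms])
qed

lemma spec_frob_norm: assumes "orth d U" shows "(frob_norm (spec U f))\<^sup>2 = (\<Sum>i<d. (f i)\<^sup>2)"
  unfolding frob_norm_ip spec_ip[OF assms] by (simp add: power2_eq_square)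

lemma spec_power: assumes "orth d U" shows "spec U f ^\<^sub>m k = spec U (\<lambda>i. f i ^ k)"
proof (induction k)
  case 0
  then show ?case using spec_const[OF assms] orthD(2)[OF assms] by simp
next
  case (Suc k)
  then show ?case by (simp add: spec_mult[OF assms] mult.commute)
qed

lemma mat_exp_spec: assumes "orth d U" shows "mat_exp (spec U f) = spec U (\<lambda>i. exp (f i))"
proof (rule eq_matI)
  note [simp] = orthD(2,3)[OF assms]
  fix i j assume "i < dim_row (spec U (\<lambda>i. exp (f i)))" "j < dim_col (spec U (\<lambda>i. exp (f i)))"
  then have ij: "i < d" "j < d" by auto
  have "(\<lambda>k. f l ^ k / fact k) sums exp (f l)" for l
    using exp_converges[of "f l"] by (simp add: divide_inverse mult.commute)
  then have "(\<lambda>k. \<Sum>l<d. U $$ (i, l) * (f l ^ k / fact k) * U $$ (j, l)) sums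
      (\<Sum>l<d. U $$ (i, l) * exp (f l) * U $$ (j, l))"
    by (intro sums_sum sums_mult sums_mult2)
  then have "(\<lambda>k. (spec U f ^\<^sub>m k) $$ (i, j) / fact k) sums spec U (\<lambda>i. exp (f i)) $$ (i, j)"
    using ij by (simp add: spec_power[OF assms] spec_index sum_divide_distrib)
  then show "mat_exp (spec U f) $$ (i, j) = spec U (\<lambda>i. exp (f i)) $$ (i, j)"
    using ij by (simp add: mat_exp_def sums_iff)
qed (simp_all add: mat_exp_def)

text \<open>In the mixed basis given by two orthogonal matrices, equality of two such matrices is an
  entrywise condition. Hence any function of the eigenvalues depends on the matrix only.\<close>

lemma spec_eq_iff:
  assumes U: "orth d U" and W: "orth d W"
  shows "spec U f = spec W g \<longleftrightarrow>
    (\<forall>i<d. \<forall>a<d. f i * (U\<^sup>T * W) $$ (i, a) = (U\<^sup>T * W) $$ (i, a) * g a)"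
proof -
  note [simp] = orthD(2,3)[OF U] orthD(2,3)[OF W]
  let ?G = "U\<^sup>T * W"
  have G: "?G \<in> carrier_mat d d" by (intro carrier_matI) auto
  have "spec U f = spec W g \<longleftrightarrow> mat_diag d f * ?G = ?G * mat_diag d g"
  proof
    assume "spec U f = spec W g"
    then have "U\<^sup>T * spec U f * W = U\<^sup>T * spec W g * W" by simp
    then show "mat_diag d f * ?G = ?G * mat_diag d g"
      by (simp add: spec_def mm_assoc orth_cancel[OF U] orth_cancel[OF W] orthD(4)[OF W] mm_one_right)
  next
    assume "mat_diag d f * ?G = ?G * mat_diag d g"
    then have "U * (mat_diag d f * ?G) * W\<^sup>T = U * (?G * mat_diag d g) * W\<^sup>T" by simp
    then show "spec U f = spec W g"
      by (simp add: spec_def mm_assoc orth_cancel[OF U] orth_cancel[OF W] orthD(5)[OF W] mm_one_right)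
  qed
  also have "\<dots> \<longleftrightarrow> (\<forall>i<d. \<forall>a<d. f i * ?G $$ (i, a) = ?G $$ (i, a) * g a)"
    unfolding mat_diag_mult_left[OF G] mat_diag_mult_right[OF G] by (auto simp: mat_eq_iff)
  finally show ?thesis .
qed

lemma spec_map:
  assumes "orth d U" "orth d W" "spec U f = spec W g"
  shows "spec U (\<lambda>i. \<phi> (f i)) = spec W (\<lambda>i. \<phi> (g i))"
  using assms(3) unfolding spec_eq_iff[OF assms(1,2)]
  by (metis mult.commute mult_cancel_right)

lemma spec_map_inj:
  assumes "orth d U" "orth d W" "spec U (\<lambda>i. \<phi> (f i)) = spec W (\<lambda>i. \<phi> (g i))"
    and "\<And>i a. i < d \<Longrightarrow> a < d \<Longrightarrow> \<phi> (f i) = \<phi> (g a) \<Longrightarrow> f i = g a"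
  shows "spec U f = spec W g"
  using assms(3,4) unfolding spec_eq_iff[OF assms(1,2)]
  by (metis mult.commute mult_cancel_right)

section \<open>Block diagonal matrices\<close>

lemma bdiag_dims [simp]:
  "dim_row (bdiag A B) = dim_row A + dim_row B" "dim_col (bdiag A B) = dim_col A + dim_col B"
  by (auto simp: bdiag_def)

lemma bdiag_carrier:
  "A \<in> carrier_mat a b \<Longrightarrow> B \<in> carrier_mat c e \<Longrightarrow> bdiag A B \<in> carrier_mat (a + c) (b + e)"
  by (simp add: bdiag_def)

lemma bdiag_mult:
  assumes "dim_col A = dim_row C" "dim_col B = dim_row D"
  shows "bdiag A B * bdiag C D = bdiag (A * C) (B * D)"
proof -
  have "bdiag A B * bdiag C D = four_block_mat
      (A * C + 0\<^sub>m (dim_row A) (dim_col B) * 0\<^sub>m (dim_row D) (dim_col C))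
      (A * 0\<^sub>m (dim_row C) (dim_col D) + 0\<^sub>m (dim_row A) (dim_col B) * D)
      (0\<^sub>m (dim_row B) (dim_col A) * C + B * 0\<^sub>m (dim_row D) (dim_col C))
      (0\<^sub>m (dim_row B) (dim_col A) * 0\<^sub>m (dim_row C) (dim_col D) + B * D)"
    unfolding bdiag_def
    by (rule mult_four_block_mat[of _ "dim_row A" "dim_col A" _ "dim_col B" _ "dim_row B"])
      (use assms in \<open>auto intro: carrier_matI\<close>)
  also have "\<dots> = bdiag (A * C) (B * D)"
    unfolding bdiag_def by (rule cong_four_block_mat) (use assms in \<open>auto intro!: eq_matI\<close>)
  finally show ?thesis .
qed

lemma bdiag_transpose: "(bdiag A B)\<^sup>T = bdiag A\<^sup>T B\<^sup>T"
  by (rule eq_matI) (auto simp: bdiag_def)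

lemma bdiag_one: "bdiag (1\<^sub>m m) (1\<^sub>m n) = 1\<^sub>m (m + n)"
  by (simp add: bdiag_def)

lemma bdiag_ip:
  assumes "dim_row X = dim_row A + dim_row B" "dim_col X = dim_col A + dim_col B"
  shows "ip X (bdiag A B) = ip (mat (dim_row A) (dim_col A) (\<lambda>(i, j). X $$ (i, j))) A +
    ip (mat (dim_row B) (dim_col B) (\<lambda>(i, j). X $$ (dim_row A + i, dim_col A + j))) B"
proof -
  have split: "(\<Sum>i<a + b. h i) = (\<Sum>i<a. h i) + (\<Sum>i<b. h (a + i))" for a b and h :: "nat \<Rightarrow> real"
    by (induction b) auto
  show ?thesis using assms by (simp add: ip_def split bdiag_def)
qed

lemma orth_bdiag: "orth m U \<Longrightarrow> orth n W \<Longrightarrow> orth (m + n) (bdiag U W)"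
  by (auto simp: orth_def bdiag_transpose bdiag_mult bdiag_one bdiag_carrier)

lemma spec_bdiag:
  assumes "orth m U" "orth n W"
  shows "bdiag (spec U f) (spec W g) = spec (bdiag U W) (\<lambda>i. if i < m then f i else g (i - m))"
proof -
  note [simp] = orthD(2,3)[OF assms(1)] orthD(2,3)[OF assms(2)]
  have "mat_diag (m + n) (\<lambda>i. if i < m then f i else g (i - m)) = bdiag (mat_diag m f) (mat_diag n g)"
    by (rule eq_matI) (auto simp: mat_diag_def bdiag_def)
  then show ?thesis by (simp add: spec_def bdiag_transpose bdiag_mult)
qed

section \<open>The spectral theorem\<close>

text \<open>A real symmetric matrix has a complex eigenvalue; it is real because the Hermitian form
  \<open>\<Sum> conj w\<^sub>i X\<^sub>i\<^sub>j w\<^sub>j\<close> is, and the real or the imaginary part of a complex eigenvector is a real one.\<close>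

lemma symmetric_real_eigenvector:
  fixes X :: "real mat"
  assumes X: "X \<in> carrier_mat d d" "X\<^sup>T = X" and d: "d > 0"
  shows "\<exists>v \<mu>. v \<in> carrier_vec d \<and> v \<noteq> 0\<^sub>v d \<and> X *\<^sub>v v = \<mu> \<cdot>\<^sub>v v"
proof -
  define XC where "XC = map_mat complex_of_real X"
  have XC: "XC \<in> carrier_mat d d" using X by (simp add: XC_def)
  obtain z w where "eigenvector XC w z"
    using spectrum_non_empty[OF XC d] by (auto simp: spectrum_def eigenvalue_def)
  then have w: "w \<in> carrier_vec d" "w \<noteq> 0\<^sub>v d" "XC *\<^sub>v w = z \<cdot>\<^sub>v w"
    using XC by (auto simp: eigenvector_def)
  have sym: "X $$ (i, j) = X $$ (j, i)" if "i < d" "j < d" for i j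
    using X that by (metis carrier_matD index_transpose_mat(1))
  have ev: "(\<Sum>j<d. complex_of_real (X $$ (i, j)) * w $ j) = z * w $ i" if "i < d" for i
  proof -
    have "(XC *\<^sub>v w) $ i = (z \<cdot>\<^sub>v w) $ i" using w by simp
    then show ?thesis using that X w(1)
      by (simp add: XC_def scalar_prod_def atLeast0LessThan)
  qed
  define n where "n = (\<Sum>i<d. (cmod (w $ i))\<^sup>2)"
  have n: "n > 0"
  proof -
    obtain i where "i < d" "w $ i \<noteq> 0" using w(1,2) by (metis carrier_vecD eq_vecI index_zero_vec(1,2))
    then show ?thesis unfolding n_def by (intro sum_pos2[of _ i]) auto
  qed
  define q where "q = (\<Sum>i<d. \<Sum>j<d. cnj (w $ i) * (complex_of_real (X $$ (i, j)) * w $ j))"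
  have "q = (\<Sum>i<d. cnj (w $ i) * (z * w $ i))"
    unfolding q_def by (simp add: ev flip: sum_distrib_left)
  also have "\<dots> = z * complex_of_real n"
    unfolding n_def of_real_sum sum_distrib_left
    by (intro sum.cong refl) (simp add: complex_norm_square mult_ac del: of_real_power)
  finally have qz: "q = z * complex_of_real n" .
  have "cnj q = (\<Sum>i<d. \<Sum>j<d. w $ i * (complex_of_real (X $$ (i, j)) * cnj (w $ j)))"
    by (simp add: q_def)
  also have "\<dots> = (\<Sum>j<d. \<Sum>i<d. w $ i * (complex_of_real (X $$ (i, j)) * cnj (w $ j)))"
    by (rule sum.swap)
  also have "\<dots> = q"
    unfolding q_def by (intro sum.cong refl) (auto simp: sym mult_ac)
  finally have "cnj z = z" using qz n by simp
  then have z: "z = complex_of_real (Re z)" by (simp add: complex_eq_iff)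
  have re: "(\<Sum>j<d. X $$ (i, j) * Re (w $ j)) = Re z * Re (w $ i)" if "i < d" for i
    using arg_cong[OF ev[OF that], of Re] z by simp (metis Im_complex_of_real diff_zero mult_zero_left)
  have im: "(\<Sum>j<d. X $$ (i, j) * Im (w $ j)) = Re z * Im (w $ i)" if "i < d" for i
    using arg_cong[OF ev[OF that], of Im] z by simp (metis Im_complex_of_real add_0_right mult_zero_left)
  define a b where "a = vec d (\<lambda>i. Re (w $ i))" and "b = vec d (\<lambda>i. Im (w $ i))"
  have "X *\<^sub>v a = Re z \<cdot>\<^sub>v a" "X *\<^sub>v b = Re z \<cdot>\<^sub>v b"
    using X re im by (auto simp: a_def b_def scalar_prod_def atLeast0LessThan)
  moreover have "a \<noteq> 0\<^sub>v d \<or> b \<noteq> 0\<^sub>v d"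
  proof (rule ccontr)
    assume "\<not> ?thesis"
    then have "a $ i = 0" "b $ i = 0" if "i < d" for i using that by auto
    then have "w = 0\<^sub>v d" using w(1) by (intro eq_vecI) (auto simp: a_def b_def complex_eq_iff)
    with w(2) show False by simp
  qed
  moreover have "a \<in> carrier_vec d" "b \<in> carrier_vec d" by (auto simp: a_def b_def)
  ultimately show ?thesis by blast
qed

text \<open>In an orthonormal basis that starts with an eigenvector, symmetry clears the first row together
  with the first column, and the remaining block is diagonalized by induction on the size.\<close>

theorem spectral_theorem:
  fixes X :: "real mat"
  assumes "X \<in> carrier_mat d d" "X\<^sup>T = X"
  shows "\<exists>U f. orth d U \<and> X = spec U f"
  using assms
proof (induction d arbitrary: X)
  case 0
  then have "X = spec (1\<^sub>m 0) (\<lambda>_. 0)" by (intro eq_matI) auto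
  then show ?case using orth_one by blast
next
  case (Suc d)
  obtain v \<mu> where v: "v \<in> carrier_vec (Suc d)" "v \<noteq> 0\<^sub>v (Suc d)" "X *\<^sub>v v = \<mu> \<cdot>\<^sub>v v"
    using symmetric_real_eigenvector[OF Suc.prems] by auto
  define n where "n = (\<Sum>i<Suc d. (v $ i)\<^sup>2)"
  have n: "n > 0" unfolding n_def by (rule sum_squares_pos[OF v(1,2)])
  define v1 where "v1 = mat (Suc d) 1 (\<lambda>(i, j). v $ i / sqrt n)"
  have "v1\<^sup>T * v1 = 1\<^sub>m 1"
    using n by (intro eq_matI)
      (auto simp: v1_def scalar_prod_def atLeast0LessThan n_def power2_eq_square simp flip: sum_divide_distrib)
  moreover have "v1 \<in> carrier_mat (Suc d) 1" by (simp add: v1_def)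
  ultimately obtain W where W: "orth (Suc d) W"
      and W0: "\<forall>i<Suc d. \<forall>j<1. W $$ (i, j) = v1 $$ (i, j)"
    using orthonormal_completion[of v1 "Suc d" 1] by auto
  note [simp] = orthD(2,3)[OF W] carrier_matD[OF Suc.prems(1)]
  define Y where "Y = W\<^sup>T * X * W"
  have Y: "Y \<in> carrier_mat (Suc d) (Suc d)" unfolding Y_def by (intro carrier_matI) auto
  have YT: "Y\<^sup>T = Y" by (simp add: Y_def mm_transpose mm_assoc Suc.prems(2))
  have Y0: "Y $$ (i, 0) = (if i = 0 then \<mu> else 0)" if i: "i < Suc d" for i
  proof -
    have c: "(X * W) $$ (k, 0) = \<mu> * W $$ (k, 0)" if k: "k < Suc d" for k
    proof -
      have "(X *\<^sub>v v) $ k = (\<mu> \<cdot>\<^sub>v v) $ k" using v by simp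
      then have "(\<Sum>l<Suc d. X $$ (k, l) * v $ l) = \<mu> * v $ k"
        using k v(1) by (simp add: scalar_prod_def atLeast0LessThan del: sum.lessThan_Suc)
      then have "(\<Sum>l<Suc d. X $$ (k, l) * v $ l) / sqrt n = \<mu> * v $ k / sqrt n" by simp
      then show ?thesis using k W0
        by (subst mat_index_mult) (auto simp: v1_def sum_divide_distrib simp del: sum.lessThan_Suc)
    qed
    have "Y $$ (i, 0) = (\<Sum>k<Suc d. W\<^sup>T $$ (i, k) * (X * W) $$ (k, 0))"
      unfolding Y_def using i by (subst mm_assoc, simp, simp, subst mat_index_mult) auto
    also have "\<dots> = \<mu> * (\<Sum>k<Suc d. W\<^sup>T $$ (i, k) * W $$ (k, 0))"
      unfolding sum_distrib_left by (intro sum.cong) (auto simp: c simp del: index_mult_mat(1))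
    also have "(\<Sum>k<Suc d. W\<^sup>T $$ (i, k) * W $$ (k, 0)) = (W\<^sup>T * W) $$ (i, 0)"
      using i by (subst mat_index_mult) auto
    also have "\<dots> = (if i = 0 then 1 else 0)" using i by (simp add: orthD(4)[OF W])
    finally show ?thesis by simp
  qed
  have Ysym: "Y $$ (i, j) = Y $$ (j, i)" if "i < Suc d" "j < Suc d" for i j
    using YT Y that by (metis carrier_matD index_transpose_mat(1))
  define X' where "X' = mat d d (\<lambda>(i, j). Y $$ (Suc i, Suc j))"
  have "X' \<in> carrier_mat d d" "X'\<^sup>T = X'"
    using Ysym by (auto simp: X'_def intro!: eq_matI)
  with Suc.IH obtain U f where U: "orth d U" "X' = spec U f" by blast
  have "Y = bdiag (\<mu> \<cdot>\<^sub>m 1\<^sub>m 1) X'"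
    using Y Y0 Ysym by (intro eq_matI) (auto simp: bdiag_def X'_def)
  also have "\<mu> \<cdot>\<^sub>m 1\<^sub>m 1 = spec (1\<^sub>m 1) (\<lambda>_. \<mu>)"
    using spec_smult[of \<mu> "1\<^sub>m 1" "\<lambda>_. 1"] spec_const[OF orth_one[of 1]] by simp
  also have "bdiag (spec (1\<^sub>m 1) (\<lambda>_. \<mu>)) X' =
      spec (bdiag (1\<^sub>m 1) U) (\<lambda>i. if i < 1 then \<mu> else f (i - 1))"
    unfolding U(2) by (rule spec_bdiag[OF orth_one U(1)])
  finally obtain Z g where Z: "orth (Suc d) Z" "Y = spec Z g"
    using orth_bdiag[OF orth_one[of 1] U(1)] by auto
  have "X = W * Y * W\<^sup>T"
    by (simp add: Y_def mm_assoc orth_cancel[OF W] orthD(5)[OF W] mm_one_right)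
  also have "\<dots> = spec (W * Z) g"
    unfolding Z(2) using orthD(2)[OF Z(1)] by (intro spec_orth_conj) simp
  finally show ?case using orth_mult[OF W Z(1)] by blast
qed

section \<open>Positive definite matrices, exponential, logarithm and square root\<close>

definition Sym :: "nat \<Rightarrow> real mat set" where
  "Sym d = {X \<in> carrier_mat d d. X\<^sup>T = X}"

lemma SymD: "X \<in> Sym d \<Longrightarrow> X \<in> carrier_mat d d" "X \<in> Sym d \<Longrightarrow> X\<^sup>T = X"
  "X \<in> Sym d \<Longrightarrow> dim_row X = d" "X \<in> Sym d \<Longrightarrow> dim_col X = d"
  by (auto simp: Sym_def)

lemma Sym_spec: "orth d U \<Longrightarrow> spec U f \<in> Sym d"
  by (simp add: Sym_def spec_carrier)

lemma Sym_spec_obtain: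
  assumes "X \<in> Sym d" obtains U f where "orth d U" "X = spec U f"
  using spectral_theorem[of X d] assms by (auto simp: Sym_def)

lemma Sym_smult: "X \<in> Sym d \<Longrightarrow> k \<cdot>\<^sub>m X \<in> Sym d"
proof -
  assume X: "X \<in> Sym d"
  have "(k \<cdot>\<^sub>m X)\<^sup>T = k \<cdot>\<^sub>m X\<^sup>T" by (rule eq_matI) auto
  then show ?thesis using X by (simp add: Sym_def)
qed

lemma Sym_index: "X \<in> Sym d \<Longrightarrow> i < d \<Longrightarrow> j < d \<Longrightarrow> X $$ (i, j) = X $$ (j, i)"
  by (metis SymD index_transpose_mat(1))

lemma SPD_Sym: "P \<in> SPD d \<Longrightarrow> P \<in> Sym d"
  by (auto simp: SPD_def Sym_def)

lemma SPD_carrier: "P \<in> SPD d \<Longrightarrow> P \<in> carrier_mat d d"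
  by (auto simp: SPD_def)

lemma SPDD: "P \<in> SPD d \<Longrightarrow> dim_row P = d" "P \<in> SPD d \<Longrightarrow> dim_col P = d" "P \<in> SPD d \<Longrightarrow> P\<^sup>T = P"
  by (auto simp: SPD_def)

lemma quadratic_form_congruence:
  fixes P :: "real mat"
  assumes "P \<in> carrier_mat d d" "A \<in> carrier_mat d m" "v \<in> carrier_vec m"
  shows "v \<bullet> ((A\<^sup>T * P * A) *\<^sub>v v) = (A *\<^sub>v v) \<bullet> (P *\<^sub>v (A *\<^sub>v v))"
proof -
  have "(A\<^sup>T * P * A) *\<^sub>v v = A\<^sup>T *\<^sub>v (P *\<^sub>v (A *\<^sub>v v))"
    using assms by (simp add: mm_vec)
  then show ?thesis using assms transpose_vec_mult_scalar[of A d m v "P *\<^sub>v (A *\<^sub>v v)"]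
    comm_scalar_prod[of v m "A\<^sup>T *\<^sub>v (P *\<^sub>v (A *\<^sub>v v))"]
    comm_scalar_prod[of "P *\<^sub>v (A *\<^sub>v v)" d "A *\<^sub>v v"]
    by simp
qed

lemma SPD_congruence:
  assumes P: "P \<in> SPD d" and A: "A \<in> carrier_mat d m"
    and inj: "\<And>v. v \<in> carrier_vec m \<Longrightarrow> A *\<^sub>v v = 0\<^sub>v d \<Longrightarrow> v = 0\<^sub>v m"
  shows "A\<^sup>T * P * A \<in> SPD m"
proof -
  have "(A\<^sup>T * P * A)\<^sup>T = A\<^sup>T * P * A"
    using SPDD[OF P] carrier_matD[OF A] by (simp add: mm_transpose mm_assoc)
  moreover have "0 < v \<bullet> ((A\<^sup>T * P * A) *\<^sub>v v)" if v: "v \<in> carrier_vec m" "v \<noteq> 0\<^sub>v m" for v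
  proof -
    have "A *\<^sub>v v \<in> carrier_vec d" "A *\<^sub>v v \<noteq> 0\<^sub>v d" using A v inj by auto
    then show ?thesis using P unfolding quadratic_form_congruence[OF SPD_carrier[OF P] A v(1)]
      by (auto simp: SPD_def)
  qed
  moreover have "A\<^sup>T * P * A \<in> carrier_mat m m" using A by (intro carrier_matI) auto
  ultimately show ?thesis by (simp add: SPD_def)
qed

lemma invertible_injective:
  fixes G :: "real mat"
  assumes "G \<in> carrier_mat d d" "det G \<noteq> 0" "v \<in> carrier_vec d" "G *\<^sub>v v = 0\<^sub>v d"
  shows "v = 0\<^sub>v d"
  using det_0_iff_vec_prod_zero_field[OF assms(1)] assms by blast

lemma SPD_congruence_square:
  assumes "P \<in> SPD d" "G \<in> carrier_mat d d" "det G \<noteq> 0"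
  shows "G * P * G\<^sup>T \<in> SPD d" "G\<^sup>T * P * G \<in> SPD d"
proof -
  have T: "G\<^sup>T \<in> carrier_mat d d" "det G\<^sup>T \<noteq> 0"
    using assms(2,3) det_transpose[OF assms(2)] by auto
  show "G\<^sup>T * P * G \<in> SPD d"
    by (rule SPD_congruence[OF assms(1,2) invertible_injective[OF assms(2,3)]])
  show "G * P * G\<^sup>T \<in> SPD d"
    using SPD_congruence[OF assms(1) T(1) invertible_injective[OF T]] by simp
qed

lemma SPD_one: "1\<^sub>m d \<in> SPD d"
proof -
  have "0 < v \<bullet> v" if "v \<in> carrier_vec d" "v \<noteq> 0\<^sub>v d" for v :: "real vec"
    using sum_squares_pos[OF that] that(1) by (simp add: scalar_prod_def atLeast0LessThan power2_eq_square)
  then show ?thesis by (simp add: SPD_def)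
qed

lemma SPD_spec:
  assumes U: "orth d U"
  shows "spec U f \<in> SPD d \<longleftrightarrow> (\<forall>i<d. f i > 0)"
proof
  note [simp] = orthD(2,3)[OF U]
  assume P: "spec U f \<in> SPD d"
  have dU: "det U \<noteq> 0" using orth_det[OF U] by auto
  have "U\<^sup>T * spec U f * U = mat_diag d f"
    by (simp add: spec_def mm_assoc orth_cancel[OF U] orthD(4)[OF U] mm_one_right)
  then have D: "mat_diag d f \<in> SPD d"
    using SPD_congruence_square(2)[OF P orthD(1)[OF U] dU] by simp
  show "\<forall>i<d. f i > 0"
  proof (intro allI impI)
    fix i assume i: "i < d"
    have "0 < unit_vec d i \<bullet> (mat_diag d f *\<^sub>v unit_vec d i)"
      using D i by (auto simp: SPD_def)
    also have "\<dots> = (mat_diag d f *\<^sub>v unit_vec d i) $ i"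
      using i by (intro scalar_prod_left_unit mult_mat_vec_carrier[OF mat_diag_dim]) auto
    also have "\<dots> = f i" using i by (simp add: mat_diag_index)
    finally show "f i > 0" .
  qed
next
  note [simp] = orthD(2,3)[OF U]
  assume f: "\<forall>i<d. f i > 0"
  define G where "G = spec U (\<lambda>i. sqrt (f i))"
  have "G * 1\<^sub>m d * G\<^sup>T = spec U (\<lambda>i. sqrt (f i) * sqrt (f i))"
    by (simp add: G_def mm_one_right spec_mult[OF U])
  also have "\<dots> = spec U f" using f by (intro spec_cong) (simp add: less_imp_le)
  finally have "G * 1\<^sub>m d * G\<^sup>T = spec U f" .
  moreover have "det G \<noteq> 0" using f by (auto simp: G_def spec_det[OF U])
  ultimately show "spec U f \<in> SPD d"
    using SPD_congruence_square(1)[OF SPD_one, of G d] spec_carrier[OF U] by (simp add: G_def)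
qed

lemma SPD_spec_obtain:
  assumes "P \<in> SPD d" obtains U f where "orth d U" "P = spec U (\<lambda>i. exp (f i))"
proof -
  obtain U f where U: "orth d U" "P = spec U f" using Sym_spec_obtain[OF SPD_Sym[OF assms]] .
  with SPD_spec assms have "\<forall>i<d. f i > 0" by blast
  then have "P = spec U (\<lambda>i. exp (ln (f i)))"
    unfolding U(2) using orthD(3)[OF U(1)] by (intro spec_cong) simp
  with that[of U "\<lambda>i. ln (f i)"] U(1) show ?thesis by simp
qed

lemma SPD_spec_exp: "orth d U \<Longrightarrow> spec U (\<lambda>i. exp (f i)) \<in> SPD d"
  by (simp add: SPD_spec)

lemma mat_log_spec:
  assumes U: "orth d U"
  shows "mat_log (spec U (\<lambda>i. exp (f i))) = spec U f"
  unfolding mat_log_def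
proof (rule the_equality)
  note [simp] = orthD(2,3)[OF U]
  show "spec U f \<in> carrier_mat (dim_row (spec U (\<lambda>i. exp (f i)))) (dim_row (spec U (\<lambda>i. exp (f i)))) \<and>
      (spec U f)\<^sup>T = spec U f \<and> mat_exp (spec U f) = spec U (\<lambda>i. exp (f i))"
    by (simp add: mat_exp_spec[OF U] spec_carrier[OF U])
  fix X
  assume X: "X \<in> carrier_mat (dim_row (spec U (\<lambda>i. exp (f i)))) (dim_row (spec U (\<lambda>i. exp (f i)))) \<and>
      X\<^sup>T = X \<and> mat_exp X = spec U (\<lambda>i. exp (f i))"
  then obtain W g where W: "orth d W" "X = spec W g" using spectral_theorem[of X d] by auto
  with X have "spec W (\<lambda>i. exp (g i)) = spec U (\<lambda>i. exp (f i))" by (simp add: mat_exp_spec[OF W(1)])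
  then show "X = spec U f" unfolding W(2) by (rule spec_map_inj[OF W(1) U]) simp
qed

lemma mat_sqrt_spec:
  assumes U: "orth d U"
  shows "mat_sqrt (spec U (\<lambda>i. exp (f i))) = spec U (\<lambda>i. exp (f i / 2))"
  unfolding mat_sqrt_def
proof (rule the_equality)
  note [simp] = orthD(2,3)[OF U]
  have *: "spec U (\<lambda>i. exp (f i / 2)) * spec U (\<lambda>i. exp (f i / 2)) = spec U (\<lambda>i. exp (f i))"
    by (simp add: spec_mult[OF U] flip: exp_add)
  then show "spec U (\<lambda>i. exp (f i / 2)) \<in> SPD (dim_row (spec U (\<lambda>i. exp (f i)))) \<and>
      spec U (\<lambda>i. exp (f i / 2)) * spec U (\<lambda>i. exp (f i / 2)) = spec U (\<lambda>i. exp (f i))"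
    by (simp add: SPD_spec_exp[OF U])
  fix R
  assume R: "R \<in> SPD (dim_row (spec U (\<lambda>i. exp (f i)))) \<and> R * R = spec U (\<lambda>i. exp (f i))"
  then have "R \<in> SPD d" by simp
  then obtain W g where W: "orth d W" "R = spec W (\<lambda>i. exp (g i))" using SPD_spec_obtain by blast
  with R have "spec W (\<lambda>i. exp (2 * g i)) = spec U (\<lambda>i. exp (2 * (f i / 2)))"
    by (simp add: spec_mult[OF W(1)] flip: exp_add)
  then have "spec W g = spec U (\<lambda>i. f i / 2)" by (rule spec_map_inj[OF W(1) U]) simp
  then show "R = spec U (\<lambda>i. exp (f i / 2))" unfolding W(2) by (rule spec_map[OF W(1) U])
qed

lemma minv_spec:
  assumes U: "orth d U"
  shows "minv (spec U (\<lambda>i. exp (f i))) = spec U (\<lambda>i. exp (- f i))"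
  by (rule minv_unique[OF spec_carrier[OF U] spec_carrier[OF U]])
    (simp add: spec_mult[OF U] spec_const[OF U] flip: exp_add)

lemma mat_exp_SPD: "X \<in> Sym d \<Longrightarrow> mat_exp X \<in> SPD d"
  by (elim Sym_spec_obtain) (simp add: mat_exp_spec SPD_spec_exp)

lemma mat_log_exp: "X \<in> Sym d \<Longrightarrow> mat_log (mat_exp X) = X"
  by (elim Sym_spec_obtain) (simp add: mat_exp_spec mat_log_spec)

lemma mat_exp_log: "P \<in> SPD d \<Longrightarrow> mat_exp (mat_log P) = P"
  by (elim SPD_spec_obtain) (simp add: mat_exp_spec mat_log_spec)

lemma mat_log_Sym: "P \<in> SPD d \<Longrightarrow> mat_log P \<in> Sym d"
  by (elim SPD_spec_obtain) (simp add: mat_log_spec Sym_spec)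

lemma mat_sqrt_SPD: "P \<in> SPD d \<Longrightarrow> mat_sqrt P \<in> SPD d"
  by (elim SPD_spec_obtain) (simp add: mat_sqrt_spec SPD_spec_exp)

lemma mat_sqrt_mult: "P \<in> SPD d \<Longrightarrow> mat_sqrt P * mat_sqrt P = P"
  by (elim SPD_spec_obtain) (simp add: mat_sqrt_spec spec_mult flip: exp_add)

lemma minv_SPD: "P \<in> SPD d \<Longrightarrow> minv P \<in> SPD d"
  by (elim SPD_spec_obtain) (simp add: minv_spec SPD_spec_exp)

lemma minv_SPD_mult: "P \<in> SPD d \<Longrightarrow> minv P * P = 1\<^sub>m d" "P \<in> SPD d \<Longrightarrow> P * minv P = 1\<^sub>m d"
  by (elim SPD_spec_obtain, simp add: minv_spec spec_mult spec_const flip: exp_add)+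

lemma SPD_det_pos: "P \<in> SPD d \<Longrightarrow> det P > 0"
  by (elim SPD_spec_obtain) (simp add: spec_det prod_pos)

lemma half_power:
  assumes P: "P \<in> SPD d"
  defines "S \<equiv> mat_sqrt P" and "H \<equiv> minv (mat_sqrt P)"
  shows "S \<in> SPD d" "S * S = P" "H \<in> SPD d" "H * S = 1\<^sub>m d" "S * H = 1\<^sub>m d"
    and "det S \<noteq> 0" "det S * det S = det P" "det H \<noteq> 0"
proof -
  show S: "S \<in> SPD d" "S * S = P" unfolding S_def using P by (auto simp: mat_sqrt_SPD mat_sqrt_mult)
  show H: "H \<in> SPD d" "H * S = 1\<^sub>m d" "S * H = 1\<^sub>m d"
    unfolding H_def S_def[symmetric] using S by (auto simp: minv_SPD minv_SPD_mult)
  show "det S \<noteq> 0" "det H \<noteq> 0" using SPD_det_pos S(1) H(1) by (metis less_irrefl)+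
  show "det S * det S = det P" using det_mult[OF SPD_carrier[OF S(1)] SPD_carrier[OF S(1)]] S(2) by simp
qed

lemma det_sandwich:
  fixes S X :: "real mat"
  assumes "S \<in> carrier_mat d d" "X \<in> carrier_mat d d"
  shows "det (S * X * S) = det S * det S * det X" "det (S * X * S\<^sup>T) = det S * det S * det X"
  using assms by (simp_all add: det_mult[of _ d] det_transpose[of _ d])

lemma mat_exp_det: "X \<in> Sym d \<Longrightarrow> det (mat_exp X) = exp (mat_tr X)"
  by (elim Sym_spec_obtain) (simp add: mat_exp_spec spec_det spec_tr exp_sum)

lemma mat_exp_half: "X \<in> Sym d \<Longrightarrow> mat_sqrt (mat_exp X) = mat_exp ((1/2) \<cdot>\<^sub>m X)"
  by (elim Sym_spec_obtain) (simp add: mat_exp_spec mat_sqrt_spec spec_smult)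

lemma mat_exp_minus: "X \<in> Sym d \<Longrightarrow> minv (mat_exp X) = mat_exp ((-1) \<cdot>\<^sub>m X)"
  by (elim Sym_spec_obtain) (simp add: mat_exp_spec minv_spec spec_smult)

lemma mat_exp_add: "X \<in> Sym d \<Longrightarrow> mat_exp (a \<cdot>\<^sub>m X) * mat_exp (b \<cdot>\<^sub>m X) = mat_exp ((a + b) \<cdot>\<^sub>m X)"
  by (elim Sym_spec_obtain) (simp add: mat_exp_spec spec_smult spec_mult algebra_simps flip: exp_add)

lemma mat_exp_zero: "X \<in> Sym d \<Longrightarrow> mat_exp (0 \<cdot>\<^sub>m X) = 1\<^sub>m d"
  by (elim Sym_spec_obtain) (simp add: mat_exp_spec spec_smult spec_const)

lemma mat_log_orth_conj:
  assumes "P \<in> SPD d" "orth d O'"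
  shows "mat_log (O' * P * O'\<^sup>T) = O' * mat_log P * O'\<^sup>T"
proof -
  obtain U f where U: "orth d U" "P = spec U (\<lambda>i. exp (f i))" using SPD_spec_obtain[OF assms(1)] .
  have "dim_col O' = dim_row U" using orthD[OF assms(2)] orthD[OF U(1)] by simp
  then show ?thesis using mat_log_spec[OF orth_mult[OF assms(2) U(1)]]
    by (simp add: U(2) mat_log_spec[OF U(1)] spec_orth_conj)
qed

lemma frob_norm_orth_conj:
  assumes "X \<in> carrier_mat d d" "orth d O'"
  shows "frob_norm (O' * X * O'\<^sup>T) = frob_norm X"
  using ip_orth[OF orth_transpose[OF assms(2)] orth_transpose[OF assms(2)] assms(1) assms(1)]
  by (simp add: frob_norm_eq_sqrt)

text \<open>The half power of \<open>P\<close> in the definition of \<open>d_AI\<close> may be replaced by any whitening matrix: two of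
  them differ by an orthogonal factor, which the Frobenius norm of the logarithm does not see.
  Congruence invariance and symmetry of the distance both follow.\<close>

lemma d_AI_whitening:
  assumes P: "P \<in> SPD d" and P': "P' \<in> SPD d"
    and G: "G \<in> carrier_mat d d" "G * P * G\<^sup>T = 1\<^sub>m d"
  shows "d_AI P P' = frob_norm (mat_log (G * P' * G\<^sup>T))"
proof -
  define S H where "S = mat_sqrt P" and "H = minv (mat_sqrt P)"
  note half = half_power[OF P, folded S_def H_def]
  note S = half(1,2) and H = half(3-5)
  note [simp] = SPDD[OF S(1)] SPDD[OF H(1)] SPDD[OF P] SPDD[OF P'] carrier_matD[OF G(1)]
  note canc = mm_cancel[OF H(2)] mm_cancel[OF H(3)]
  define O' where "O' = G * S"
  have O'T: "O' * O'\<^sup>T = 1\<^sub>m d"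
    using G(2) by (simp add: O'_def mm_transpose mm_assoc flip: S(2))
  have O': "orth d O'"
  proof -
    have c: "O' \<in> carrier_mat d d" unfolding O'_def by (intro carrier_matI) auto
    then show ?thesis using O'T mat_mult_left_right_inverse[of O' d "O'\<^sup>T"] by (simp add: orth_def)
  qed
  have HP: "H * P' * H \<in> SPD d"
    using SPD_congruence_square(1)[OF P' SPD_carrier[OF H(1)] half(8)] by simp
  have "G * P' * G\<^sup>T = O' * (H * P' * H) * O'\<^sup>T"
    by (simp add: O'_def mm_transpose mm_assoc canc)
  then have "frob_norm (mat_log (G * P' * G\<^sup>T)) = frob_norm (mat_log (H * P' * H))"
    using frob_norm_orth_conj[OF SymD(1)[OF mat_log_Sym[OF HP]] O']
    by (simp add: mat_log_orth_conj[OF HP O'])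
  then show ?thesis by (simp add: d_AI_def H_def S_def)
qed

lemma d_AI_congruence:
  assumes P: "P \<in> SPD d" and P': "P' \<in> SPD d" and F: "F \<in> carrier_mat d d" "det F \<noteq> 0"
  shows "d_AI (F * P * F\<^sup>T) (F * P' * F\<^sup>T) = d_AI P P'"
proof -
  define S H where "S = mat_sqrt P" and "H = minv (mat_sqrt P)"
  note half = half_power[OF P, folded S_def H_def]
  note S = half(1,2) and H = half(3-5)
  define E where "E = minv F"
  have E: "E \<in> carrier_mat d d" "E * F = 1\<^sub>m d" unfolding E_def using minv_det[OF F] by auto
  note [simp] = SPDD[OF S(1)] SPDD[OF H(1)] SPDD[OF P] SPDD[OF P'] carrier_matD[OF F(1)] carrier_matD[OF E(1)]
  have "F\<^sup>T * E\<^sup>T = 1\<^sub>m d" using arg_cong[OF E(2), of transpose_mat] by (simp add: mm_transpose)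
  note canc = mm_cancel[OF H(2)] mm_cancel[OF H(3)] mm_cancel[OF E(2)] mm_cancel[OF this]
  define G where "G = H * E"
  have Gc: "G \<in> carrier_mat d d" unfolding G_def by (intro carrier_matI) auto
  have G: "G * (F * Q * F\<^sup>T) * G\<^sup>T = H * Q * H" if "dim_row Q = d" "dim_col Q = d" for Q
    using that by (simp add: G_def mm_transpose mm_assoc canc)
  have "H * P * H = 1\<^sub>m d" by (simp add: mm_assoc canc H(3) flip: S(2))
  then have "d_AI (F * P * F\<^sup>T) (F * P' * F\<^sup>T) = frob_norm (mat_log (G * (F * P' * F\<^sup>T) * G\<^sup>T))"
    by (intro d_AI_whitening[OF SPD_congruence_square(1)[OF P F] SPD_congruence_square(1)[OF P' F] Gc])
      (simp add: G)
  also have "\<dots> = d_AI P P'" by (simp add: G d_AI_def S_def H_def)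
  finally show ?thesis .
qed

lemma d_AI_one: "P \<in> SPD d \<Longrightarrow> d_AI (1\<^sub>m d) P = frob_norm (mat_log P)"
  using d_AI_whitening[OF SPD_one _ one_carrier_mat] SPDD
  by (simp add: mm_one_left mm_one_right)

lemma d_AI_nonneg: "0 \<le> d_AI P P'"
  by (simp add: d_AI_def frob_norm_nonneg)

text \<open>Coordinates around \<open>P\<close>: every \<open>P'\<close> is \<open>P\<^sup>1\<^sup>/\<^sup>2 exp(Y) P\<^sup>1\<^sup>/\<^sup>2\<close> for one symmetric \<open>Y\<close>, whose norm is the
  distance.\<close>

lemma d_AI_exp_coordinates:
  assumes P: "P \<in> SPD d" and Y: "Y \<in> Sym d"
  shows "mat_sqrt P * mat_exp Y * mat_sqrt P \<in> SPD d"
    and "d_AI P (mat_sqrt P * mat_exp Y * mat_sqrt P) = frob_norm Y"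
proof -
  define S where "S = mat_sqrt P"
  note S = half_power(1,2)[OF P, folded S_def] and dS = half_power(6)[OF P, folded S_def]
  note [simp] = SPDD[OF S(1)]
  show "mat_sqrt P * mat_exp Y * mat_sqrt P \<in> SPD d"
    using SPD_congruence_square(1)[OF mat_exp_SPD[OF Y] SPD_carrier[OF S(1)] dS] by (simp add: S_def[symmetric])
  have "d_AI (S * 1\<^sub>m d * S\<^sup>T) (S * mat_exp Y * S\<^sup>T) = frob_norm Y"
    by (simp only: d_AI_congruence[OF SPD_one mat_exp_SPD[OF Y] SPD_carrier[OF S(1)] dS]
        d_AI_one[OF mat_exp_SPD[OF Y]] mat_log_exp[OF Y])
  then show "d_AI P (mat_sqrt P * mat_exp Y * mat_sqrt P) = frob_norm Y"
    by (simp add: mm_one_right S S_def[symmetric])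
qed

lemma exp_coordinates_obtain:
  assumes P: "P \<in> SPD d" and P': "P' \<in> SPD d"
  obtains Y where "Y \<in> Sym d" "P' = mat_sqrt P * mat_exp Y * mat_sqrt P"
    "mat_exp Y = minv (mat_sqrt P) * P' * minv (mat_sqrt P)"
proof -
  define S H where "S = mat_sqrt P" and "H = minv (mat_sqrt P)"
  note half = half_power[OF P, folded S_def H_def]
  note S = half(1,2) and H = half(3-5)
  note [simp] = SPDD[OF S(1)] SPDD[OF H(1)] SPDD[OF P']
  have HP: "H * P' * H \<in> SPD d"
    using SPD_congruence_square(1)[OF P' SPD_carrier[OF H(1)] half(8)] by simp
  have "S * (H * P' * H) * S = P'" by (simp add: mm_assoc mm_cancel[OF H(3)] H(2) mm_one_right)
  then show ?thesis
    using that[of "mat_log (H * P' * H)"] mat_log_Sym[OF HP] mat_exp_log[OF HP]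
    by (simp add: S_def H_def)
qed

lemma d_AI_eq_0:
  assumes "P \<in> SPD d" "P' \<in> SPD d" "d_AI P P' = 0"
  shows "P' = P"
proof -
  obtain Y where Y: "Y \<in> Sym d" "P' = mat_sqrt P * mat_exp Y * mat_sqrt P"
    using exp_coordinates_obtain[OF assms(1,2)] .
  have n: "frob_norm Y = 0" using assms(3) d_AI_exp_coordinates(2)[OF assms(1) Y(1)] Y(2) by simp
  have "Y = 0 \<cdot>\<^sub>m Y"
    using frob_norm_eq_0[OF n] by (intro eq_matI) auto
  then have "mat_exp Y = 1\<^sub>m d" using mat_exp_zero[OF Y(1)] by simp
  then show ?thesis
    using Y(2) mat_sqrt_mult[OF assms(1)] SPDD[OF mat_sqrt_SPD[OF assms(1)]] by (simp add: mm_one_right)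
qed

lemma d_AI_commute:
  assumes P: "P \<in> SPD d" and P': "P' \<in> SPD d"
  shows "d_AI P' P = d_AI P P'"
proof -
  obtain Y where Y: "Y \<in> Sym d" "P' = mat_sqrt P * mat_exp Y * mat_sqrt P"
    using exp_coordinates_obtain[OF assms] .
  define S H where "S = mat_sqrt P" and "H = minv (mat_sqrt P)"
  note half = half_power[OF P, folded S_def H_def]
  note S = half(1,2) and H = half(3-5)
  obtain U f where U: "orth d U" "Y = spec U f" using Sym_spec_obtain[OF Y(1)] .
  note [simp] = SPDD[OF S(1)] SPDD[OF H(1)] SPDD[OF P] SPDD[OF P'] orthD(2,3)[OF U(1)]
  note canc = mm_cancel[OF H(2)] mm_cancel[OF H(3)]
  define G where "G = spec U (\<lambda>i. exp (- f i / 2)) * H"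
  have Gc: "G \<in> carrier_mat d d" unfolding G_def by (intro carrier_matI) auto
  have P'': "P' = S * (spec U (\<lambda>i. exp (f i)) * S)"
    by (simp add: Y(2) U(2) mat_exp_spec[OF U(1)] S_def[symmetric] mm_assoc)
  have "G * P' * G\<^sup>T = spec U (\<lambda>i. exp (- f i / 2)) * (spec U (\<lambda>i. exp (f i)) * spec U (\<lambda>i. exp (- f i / 2)))"
    by (simp add: G_def P'' mm_transpose mm_assoc canc)
  also have "\<dots> = 1\<^sub>m d" by (simp add: spec_mult[OF U(1)] spec_const[OF U(1)] flip: exp_add)
  finally have "d_AI P' P = frob_norm (mat_log (G * P * G\<^sup>T))"
    by (rule d_AI_whitening[OF P' P Gc])
  also have "G * P * G\<^sup>T = spec U (\<lambda>i. exp (- f i / 2)) * spec U (\<lambda>i. exp (- f i / 2))"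
    by (simp add: G_def mm_transpose mm_assoc canc flip: S(2))
  also have "\<dots> = spec U (\<lambda>i. exp (- f i))" by (simp add: spec_mult[OF U(1)] flip: exp_add)
  finally have "d_AI P' P = frob_norm (spec U (\<lambda>i. - f i))" by (simp add: mat_log_spec[OF U(1)])
  then have "(d_AI P' P)\<^sup>2 = (frob_norm Y)\<^sup>2" by (simp add: U(2) spec_frob_norm[OF U(1)])
  then have "d_AI P' P = frob_norm Y"
    using d_AI_nonneg frob_norm_nonneg by (simp add: power2_eq_iff_nonneg)
  then show ?thesis using d_AI_exp_coordinates(2)[OF P Y(1)] Y(2) by simp
qed

section \<open>The function \<open>s coth s\<close>\<close>

lemma psi_even: "psi (- s) = psi s"
  by (simp add: psi_def)

lemma le_sinh:
  fixes t :: real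
  assumes "0 \<le> t"
  shows "t \<le> sinh t"
proof -
  have "(\<lambda>x. x - sinh x) t \<le> (\<lambda>x. x - sinh x) 0"
  proof (rule DERIV_nonpos_imp_nonincreasing[where f = "\<lambda>x. x - sinh x"])
    fix y :: real
    have "((\<lambda>x. x - sinh x) has_real_derivative 1 - cosh y) (at y)"
      by (auto intro!: derivative_eq_intros)
    then show "\<exists>z. ((\<lambda>x. x - sinh x) has_real_derivative z) (at y) \<and> z \<le> 0"
      using cosh_real_ge_1[of y] by (intro exI[of _ "1 - cosh y"]) auto
  qed (rule assms)
  then show ?thesis by simp
qed

lemma psi_mono_pos:
  assumes "0 < a" "a \<le> b"
  shows "psi a \<le> psi b"
proof -
  have "a * (cosh a / sinh a) \<le> b * (cosh b / sinh b)"
  proof (rule DERIV_nonneg_imp_nondecreasing[OF assms(2)])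
    fix x assume "a \<le> x" "x \<le> b"
    then have x: "x > 0" using assms by simp
    have s: "sinh x > 0" using x by simp
    have "2 * x \<le> sinh (2 * x)" using x by (intro le_sinh) simp
    then have "x \<le> sinh x * cosh x" by (simp add: sinh_double)
    moreover have "((\<lambda>x. x * (cosh x / sinh x)) has_real_derivative
        cosh x / sinh x + x * ((sinh x * sinh x - cosh x * cosh x) / (sinh x * sinh x))) (at x)"
      using s by (auto intro!: derivative_eq_intros simp: field_simps)
    moreover have "cosh x / sinh x + x * ((sinh x * sinh x - cosh x * cosh x) / (sinh x * sinh x))
        = (sinh x * cosh x - x) / (sinh x)\<^sup>2"
      using s cosh_square_eq[of x] by (simp add: field_simps power2_eq_square)
    ultimately show "\<exists>y. ((\<lambda>x. x * (cosh x / sinh x)) has_real_derivative y) (at x) \<and> 0 \<le> y"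
      using s by (metis diff_ge_0_iff_ge zero_le_divide_iff zero_le_power2)
  qed
  then show ?thesis using assms by (simp add: psi_def)
qed

lemma psi_ge_1: "1 \<le> psi s"
proof -
  have pos: "1 \<le> psi t" if "t > 0" for t
  proof -
    have "(\<lambda>x. sinh x - x * cosh x) t \<le> (\<lambda>x. sinh x - x * cosh x) 0"
    proof (rule DERIV_nonpos_imp_nonincreasing[where f = "\<lambda>x. sinh x - x * cosh x"])
      show "0 \<le> t" using that by simp
      fix x assume x: "0 \<le> x" "x \<le> t"
      have "((\<lambda>x. sinh x - x * cosh x) has_real_derivative - (x * sinh x)) (at x)"
        by (auto intro!: derivative_eq_intros)
      moreover have "x * sinh x \<ge> 0" using x by simp
      ultimately show "\<exists>y. ((\<lambda>x. sinh x - x * cosh x) has_real_derivative y) (at x) \<and> y \<le> 0"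
        by (intro exI[of _ "- (x * sinh x)"]) auto
    qed
    then show ?thesis using that by (simp add: psi_def field_simps)
  qed
  show ?thesis
    using pos[of s] pos[of "- s"] by (cases "s = 0") (auto simp: psi_even psi_def[of 0] linorder_neq_iff)
qed

lemma psi_mono:
  assumes "\<bar>a\<bar> \<le> b"
  shows "psi a \<le> psi b"
proof (cases "a = 0")
  case True
  then show ?thesis using psi_ge_1[of b] by (simp add: psi_def[of 0])
next
  case False
  then have "psi \<bar>a\<bar> \<le> psi b" using psi_mono_pos[of "\<bar>a\<bar>" b] assms by simp
  then show ?thesis by (simp add: abs_if psi_even split: if_splits)
qed

text \<open>Since \<open>coth\<close> decreases, \<open>\<psi>\<close> grows at most linearly under scaling. This is why a Hessian bound with
  \<open>\<psi>(D)\<close> in place of the sharp \<open>\<psi>(D/\<surd>2)\<close> still leaves the step \<open>1/\<psi>(D/\<surd>2)\<close> below the stability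
  limit \<open>2/\<psi>(D)\<close>.\<close>

lemma psi_scale:
  assumes "0 \<le> s" "1 \<le> k"
  shows "psi (k * s) \<le> k * psi s"
proof (cases "s = 0")
  case True
  then show ?thesis using assms by (simp add: psi_def)
next
  case False
  then have s: "s > 0" "k * s > 0" using assms by auto
  have "0 \<le> sinh (k * s - s)" using assms mult_right_mono[of 1 k s] by simp
  then have "cosh (k * s) * sinh s \<le> cosh s * sinh (k * s)"
    by (simp add: sinh_diff mult.commute)
  then have "cosh (k * s) / sinh (k * s) \<le> cosh s / sinh s"
    using s by (simp add: divide_simps)
  then have "k * s * (cosh (k * s) / sinh (k * s)) \<le> k * s * (cosh s / sinh s)"
    using s by (intro mult_left_mono) auto
  then show ?thesis using s assms by (simp add: psi_def)
qed

section \<open>An exact monotonicity formula\<close>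

text \<open>The entries of a function of the symmetric matrix with eigenbasis \<open>V\<close>, taken between the
  eigenvectors of two others.\<close>

definition mixed :: "real mat \<Rightarrow> real mat \<Rightarrow> real mat \<Rightarrow> (nat \<Rightarrow> real) \<Rightarrow> real mat" where
  "mixed U V W f = U\<^sup>T * spec V f * W"

lemma mixed_dims [simp]: "dim_row (mixed U V W f) = dim_col U" "dim_col (mixed U V W f) = dim_col W"
  by (auto simp: mixed_def)

lemma mixed_add:
  assumes "orth d U" "orth d V" "orth d W" "i < d" "a < d"
  shows "mixed U V W (\<lambda>k. f k + g k) $$ (i, a) = mixed U V W f $$ (i, a) + mixed U V W g $$ (i, a)"
    and "mixed U V W (\<lambda>k. f k - g k) $$ (i, a) = mixed U V W f $$ (i, a) - mixed U V W g $$ (i, a)"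
proof -
  note [simp] = orthD(2,3)[OF assms(1)] orthD(2,3)[OF assms(2)] orthD(2,3)[OF assms(3)]
  have *: "mixed U V W h $$ (i, a) =
      (\<Sum>k<d. (\<Sum>j<d. U $$ (j, i) * spec V h $$ (j, k)) * W $$ (k, a))" for h
    unfolding mixed_def using assms(4,5)
    by (subst mat_index_mult) (auto simp: mat_index_mult simp del: index_mult_mat(1))
  show "mixed U V W (\<lambda>k. f k + g k) $$ (i, a) = mixed U V W f $$ (i, a) + mixed U V W g $$ (i, a)"
    unfolding * spec_add[symmetric] by (simp add: algebra_simps sum.distrib)
  show "mixed U V W (\<lambda>k. f k - g k) $$ (i, a) = mixed U V W f $$ (i, a) - mixed U V W g $$ (i, a)"
    unfolding * spec_minus[symmetric] by (simp add: algebra_simps sum_subtractf)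
qed

text \<open>Write \<open>Z\<close> for the logarithm of \<open>exp(-V) exp(Y) exp(-V)\<close>. Since \<open>exp(V) exp(Z) = exp(Y) exp(-V)\<close>, the
  entries of \<open>sinh V\<close> and \<open>cosh V\<close> between an eigenvector of \<open>Y\<close> and one of \<open>Z\<close> have ratio
  \<open>tanh((l - m)/2)\<close>, where \<open>l\<close> and \<open>m\<close> are the two eigenvalues.\<close>

lemma sinh_cosh_entries:
  assumes U: "orth d U" and V: "orth d V" and W: "orth d W" and ia: "i < d" "a < d"
    and Z: "spec W (\<lambda>i. exp (m i)) =
      spec V (\<lambda>i. exp (- v i)) * spec U (\<lambda>i. exp (l i)) * spec V (\<lambda>i. exp (- v i))"
  shows "mixed U V W (\<lambda>k. sinh (v k)) $$ (i, a) * cosh ((l i - m a) / 2) =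
    mixed U V W (\<lambda>k. cosh (v k)) $$ (i, a) * sinh ((l i - m a) / 2)"
proof -
  note [simp] = orthD(2,3)[OF U] orthD(2,3)[OF V] orthD(2,3)[OF W]
  have "spec V (\<lambda>i. exp (v i)) * spec V (\<lambda>i. exp (- v i)) = 1\<^sub>m d"
    by (simp add: spec_mult[OF V] spec_const[OF V] flip: exp_add)
  note canc = mm_cancel[OF this]
  have "spec V (\<lambda>i. exp (v i)) * spec W (\<lambda>i. exp (m i)) =
      spec U (\<lambda>i. exp (l i)) * spec V (\<lambda>i. exp (- v i))"
    unfolding Z by (simp add: mm_assoc canc)
  then have "U\<^sup>T * (spec V (\<lambda>i. exp (v i)) * spec W (\<lambda>i. exp (m i))) * W =
      U\<^sup>T * (spec U (\<lambda>i. exp (l i)) * spec V (\<lambda>i. exp (- v i))) * W" by simp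
  then have eq: "mixed U V W (\<lambda>i. exp (v i)) * mat_diag d (\<lambda>i. exp (m i)) =
      mat_diag d (\<lambda>i. exp (l i)) * mixed U V W (\<lambda>i. exp (- v i))"
    by (simp add: mixed_def spec_def[of W] spec_def[of U] mm_assoc orth_cancel[OF U] orth_cancel[OF W]
        orthD(4)[OF W] mm_one_right)
  have c: "mixed U V W f \<in> carrier_mat d d" for f by (intro carrier_matI) auto
  have "mixed U V W (\<lambda>i. exp (v i)) $$ (i, a) * exp (m a) =
      exp (l i) * mixed U V W (\<lambda>i. exp (- v i)) $$ (i, a)"
    using arg_cong[OF eq, of "\<lambda>M. M $$ (i, a)"] ia
    unfolding mat_diag_mult_left[OF c] mat_diag_mult_right[OF c] by simp
  moreover have "mixed U V W (\<lambda>i. exp (v i)) $$ (i, a) =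
      mixed U V W (\<lambda>i. cosh (v i)) $$ (i, a) + mixed U V W (\<lambda>i. sinh (v i)) $$ (i, a)"
    unfolding mixed_add(1)[OF U V W ia, symmetric] by (simp add: cosh_plus_sinh)
  moreover have "mixed U V W (\<lambda>i. exp (- v i)) $$ (i, a) =
      mixed U V W (\<lambda>i. cosh (v i)) $$ (i, a) - mixed U V W (\<lambda>i. sinh (v i)) $$ (i, a)"
    unfolding mixed_add(2)[OF U V W ia, symmetric] by (simp add: cosh_minus_sinh)
  ultimately have e: "mixed U V W (\<lambda>k. sinh (v k)) $$ (i, a) * (exp (l i) + exp (m a)) =
      mixed U V W (\<lambda>k. cosh (v k)) $$ (i, a) * (exp (l i) - exp (m a))"
    by (simp add: algebra_simps)
  have l: "exp (l i) = exp ((l i + m a) / 2) * exp ((l i - m a) / 2)"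
    and m: "exp (m a) = exp ((l i + m a) / 2) * exp (- ((l i - m a) / 2))"
    by (simp_all add: field_simps flip: exp_add)
  have "exp (l i) + exp (m a) = 2 * exp ((l i + m a) / 2) * cosh ((l i - m a) / 2)"
    unfolding l m by (simp add: cosh_field_def algebra_simps)
  moreover have "exp (l i) - exp (m a) = 2 * exp ((l i + m a) / 2) * sinh ((l i - m a) / 2)"
    unfolding l m by (simp add: sinh_field_def algebra_simps)
  ultimately show ?thesis using e by simp
qed

lemma mixed_ip:
  assumes U: "orth d U" and V: "orth d V" and W: "orth d W"
  shows "(\<Sum>i<d. \<Sum>a<d. (mixed U V W f $$ (i, a))\<^sup>2) = (\<Sum>k<d. (f k)\<^sup>2)"
    and "(\<Sum>i<d. \<Sum>a<d. (l i - m a) * mixed U V W f $$ (i, a) * mixed U V W g $$ (i, a)) =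
      ip (spec U l - spec W m) (spec V (\<lambda>k. f k * g k))"
proof -
  note [simp] = orthD(2,3)[OF U] orthD(2,3)[OF V] orthD(2,3)[OF W]
  have c: "A \<in> carrier_mat d d" if "dim_row A = d" "dim_col A = d" for A :: "real mat"
    using that by (rule carrier_matI)
  have "(\<Sum>i<d. \<Sum>a<d. (mixed U V W f $$ (i, a))\<^sup>2) = ip (mixed U V W f) (mixed U V W f)"
    by (simp add: ip_def power2_eq_square)
  also have "\<dots> = ip (spec V f) (spec V f)"
    unfolding mixed_def by (rule ip_orth[OF U W]) (auto intro: c)
  finally show "(\<Sum>i<d. \<Sum>a<d. (mixed U V W f $$ (i, a))\<^sup>2) = (\<Sum>k<d. (f k)\<^sup>2)"
    by (simp add: spec_ip[OF V] power2_eq_square)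
  have mc: "mixed U V W f \<in> carrier_mat d d" by (rule c) auto
  have "(\<Sum>i<d. \<Sum>a<d. l i * mixed U V W f $$ (i, a) * mixed U V W g $$ (i, a)) =
      ip (mat_diag d l * mixed U V W f) (mixed U V W g)"
    unfolding mat_diag_mult_left[OF mc] by (simp add: ip_def)
  also have "mat_diag d l * mixed U V W f = U\<^sup>T * (spec U l * spec V f) * W"
    by (simp add: mixed_def spec_def[of U] mm_assoc orth_cancel[OF U])
  also have "ip \<dots> (mixed U V W g) = ip (spec U l * spec V f) (spec V g)"
    unfolding mixed_def by (rule ip_orth[OF U W]) (auto intro: c)
  also have "\<dots> = mat_tr ((spec U l * spec V f) * (spec V g)\<^sup>T)" by (subst mat_tr_mult) auto
  also have "\<dots> = mat_tr (spec U l * (spec V (\<lambda>k. f k * g k))\<^sup>T)"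
    by (simp add: mm_assoc spec_mult[OF V])
  also have "\<dots> = ip (spec U l) (spec V (\<lambda>k. f k * g k))" by (subst mat_tr_mult) auto
  finally have 1: "(\<Sum>i<d. \<Sum>a<d. l i * mixed U V W f $$ (i, a) * mixed U V W g $$ (i, a)) =
      ip (spec U l) (spec V (\<lambda>k. f k * g k))" .
  have "(\<Sum>i<d. \<Sum>a<d. m a * mixed U V W f $$ (i, a) * mixed U V W g $$ (i, a)) =
      ip (mixed U V W f * mat_diag d m) (mixed U V W g)"
    unfolding mat_diag_mult_right[OF mc] by (simp add: ip_def mult_ac)
  also have "mixed U V W f * mat_diag d m = U\<^sup>T * (spec V f * spec W m) * W"
    by (simp add: mixed_def spec_def[of W] mm_assoc orth_cancel[OF W] orthD(4)[OF W] mm_one_right)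
  also have "ip \<dots> (mixed U V W g) = ip (spec V f * spec W m) (spec V g)"
    unfolding mixed_def by (rule ip_orth[OF U W]) (auto intro: c)
  also have "\<dots> = mat_tr ((spec V f * spec W m) * (spec V g)\<^sup>T)" by (subst mat_tr_mult) auto
  also have "\<dots> = mat_tr (spec V f * (spec W m * spec V g))" by (simp add: mm_assoc)
  also have "\<dots> = mat_tr ((spec W m * spec V g) * spec V f)" by (rule mat_tr_comm) auto
  also have "\<dots> = mat_tr (spec W m * (spec V (\<lambda>k. f k * g k))\<^sup>T)"
    by (simp add: mm_assoc spec_mult[OF V] mult.commute)
  also have "\<dots> = ip (spec W m) (spec V (\<lambda>k. f k * g k))" by (subst mat_tr_mult) auto
  finally have 2: "(\<Sum>i<d. \<Sum>a<d. m a * mixed U V W f $$ (i, a) * mixed U V W g $$ (i, a)) =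
      ip (spec W m) (spec V (\<lambda>k. f k * g k))" .
  show "(\<Sum>i<d. \<Sum>a<d. (l i - m a) * mixed U V W f $$ (i, a) * mixed U V W g $$ (i, a)) =
      ip (spec U l - spec W m) (spec V (\<lambda>k. f k * g k))"
    by (simp add: left_diff_distrib sum_subtractf 1 2 ip_minus_left)
qed

text \<open>With \<open>\<delta> = (l - m)/2\<close> the tanh relation turns \<open>\<delta> cosh V sinh V\<close> into \<open>\<psi>(\<delta>) (sinh V)\<^sup>2\<close> entrywise, and
  \<open>\<psi>\<close> lies between \<open>1\<close> and its value at a bound for \<open>\<delta>\<close>. This is the only place where curvature
  enters: the lower bound is non-positive curvature and the upper bound is the Hessian comparison.\<close>

lemma log_difference_bounds:
  assumes U: "orth d U" and V: "orth d V" and W: "orth d W"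
    and Z: "spec W (\<lambda>i. exp (m i)) =
      spec V (\<lambda>i. exp (- v i)) * spec U (\<lambda>i. exp (l i)) * spec V (\<lambda>i. exp (- v i))"
    and D: "\<And>i. i < d \<Longrightarrow> \<bar>l i\<bar> \<le> D" "\<And>i. i < d \<Longrightarrow> \<bar>m i\<bar> \<le> D"
  shows "4 * (\<Sum>k<d. (sinh (v k))\<^sup>2) \<le> ip (spec U l - spec W m) (spec V (\<lambda>k. sinh (2 * v k)))"
    and "ip (spec U l - spec W m) (spec V (\<lambda>k. sinh (2 * v k))) \<le> psi D * (4 * (\<Sum>k<d. (sinh (v k))\<^sup>2))"
proof -
  let ?S = "\<lambda>i a. mixed U V W (\<lambda>k. sinh (v k)) $$ (i, a)"
  let ?C = "\<lambda>i a. mixed U V W (\<lambda>k. cosh (v k)) $$ (i, a)"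
  have pt: "2 * (?S i a)\<^sup>2 \<le> (l i - m a) * ?S i a * ?C i a"
      "(l i - m a) * ?S i a * ?C i a \<le> psi D * (2 * (?S i a)\<^sup>2)" if ia: "i < d" "a < d" for i a
  proof -
    define \<delta> where "\<delta> = (l i - m a) / 2"
    have r: "?S i a * cosh \<delta> = ?C i a * sinh \<delta>"
      unfolding \<delta>_def by (rule sinh_cosh_entries[OF U V W ia Z])
    have "\<delta> * ?S i a * ?C i a = psi \<delta> * (?S i a)\<^sup>2"
    proof (cases "\<delta> = 0")
      case True
      then show ?thesis using r by simp
    next
      case False
      then have "?C i a = ?S i a * (cosh \<delta> / sinh \<delta>)" using r by (simp add: field_simps)
      then show ?thesis using False by (simp add: psi_def power2_eq_square)
    qed
    moreover have "l i - m a = 2 * \<delta>" by (simp add: \<delta>_def)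
    moreover have "\<bar>\<delta>\<bar> \<le> D" using D(1)[OF ia(1)] D(2)[OF ia(2)] by (simp add: \<delta>_def)
    moreover have "1 * (?S i a)\<^sup>2 \<le> psi \<delta> * (?S i a)\<^sup>2" by (intro mult_right_mono psi_ge_1) simp
    moreover have "psi \<delta> * (?S i a)\<^sup>2 \<le> psi D * (?S i a)\<^sup>2"
      using psi_mono[OF \<open>\<bar>\<delta>\<bar> \<le> D\<close>] by (intro mult_right_mono) auto
    ultimately show "2 * (?S i a)\<^sup>2 \<le> (l i - m a) * ?S i a * ?C i a"
      "(l i - m a) * ?S i a * ?C i a \<le> psi D * (2 * (?S i a)\<^sup>2)" by (simp_all add: algebra_simps)
  qed
  have I: "ip (spec U l - spec W m) (spec V (\<lambda>k. sinh (2 * v k))) =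
      2 * (\<Sum>i<d. \<Sum>a<d. (l i - m a) * ?S i a * ?C i a)"
    unfolding mixed_ip(2)[OF U V W]
    using orthD(2)[OF U] orthD(2)[OF V] orthD(2)[OF W]
    by (simp add: sinh_double mult.assoc ip_smult_right flip: spec_smult)
  have S: "(\<Sum>k<d. (sinh (v k))\<^sup>2) = (\<Sum>i<d. \<Sum>a<d. (?S i a)\<^sup>2)"
    by (rule mixed_ip(1)[OF U V W, symmetric])
  have "(\<Sum>i<d. \<Sum>a<d. 2 * (?S i a)\<^sup>2) \<le> (\<Sum>i<d. \<Sum>a<d. (l i - m a) * ?S i a * ?C i a)"
    by (intro sum_mono pt) auto
  then show "4 * (\<Sum>k<d. (sinh (v k))\<^sup>2) \<le> ip (spec U l - spec W m) (spec V (\<lambda>k. sinh (2 * v k)))"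
    unfolding I S by (simp flip: sum_distrib_left)
  have "(\<Sum>i<d. \<Sum>a<d. (l i - m a) * ?S i a * ?C i a) \<le> (\<Sum>i<d. \<Sum>a<d. psi D * (2 * (?S i a)\<^sup>2))"
    by (intro sum_mono pt) auto
  then show "ip (spec U l - spec W m) (spec V (\<lambda>k. sinh (2 * v k))) \<le> psi D * (4 * (\<Sum>k<d. (sinh (v k))\<^sup>2))"
    unfolding I S by (simp flip: sum_distrib_left)
qed

section \<open>Distance from a point to a geodesic\<close>

text \<open>\<open>rel_log Y X t\<close> is the logarithm of \<open>exp Y\<close> as seen from the point \<open>exp(tX)\<close> of the geodesic through
  the identity in direction \<open>X\<close>; its norm is the distance of the two points.\<close>

definition rel_log :: "real mat \<Rightarrow> real mat \<Rightarrow> real \<Rightarrow> real mat" where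
  "rel_log Y X t = mat_log (mat_exp ((- t / 2) \<cdot>\<^sub>m X) * mat_exp Y * mat_exp ((- t / 2) \<cdot>\<^sub>m X))"

lemma exp_conj_SPD:
  assumes "P \<in> SPD d" "X \<in> Sym d"
  shows "mat_exp X * P * mat_exp X \<in> SPD d"
proof -
  have E: "mat_exp X \<in> SPD d" using assms(2) by (rule mat_exp_SPD)
  show ?thesis
    using SPD_congruence_square(1)[OF assms(1) SPD_carrier[OF E]] SPD_det_pos[OF E] SPDD(3)[OF E] by simp
qed

lemma rel_log_Sym: "Y \<in> Sym d \<Longrightarrow> X \<in> Sym d \<Longrightarrow> rel_log Y X t \<in> Sym d"
  unfolding rel_log_def by (intro mat_log_Sym exp_conj_SPD mat_exp_SPD Sym_smult)

lemma exp_rel_log: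
  "Y \<in> Sym d \<Longrightarrow> X \<in> Sym d \<Longrightarrow>
     mat_exp (rel_log Y X t) = mat_exp ((- t / 2) \<cdot>\<^sub>m X) * mat_exp Y * mat_exp ((- t / 2) \<cdot>\<^sub>m X)"
  unfolding rel_log_def by (intro mat_exp_log[of _ d] exp_conj_SPD mat_exp_SPD Sym_smult)

lemma rel_log_0: assumes "Y \<in> Sym d" "X \<in> Sym d" shows "rel_log Y X 0 = Y"
  using assms SPDD[OF mat_exp_SPD[OF assms(1)]]
  by (simp add: rel_log_def mat_exp_zero mm_one_left mm_one_right mat_log_exp)

lemma rel_log_add:
  assumes Y: "Y \<in> Sym d" and X: "X \<in> Sym d"
  shows "rel_log (rel_log Y X s) X t = rel_log Y X (s + t)"
proof -
  have d: "dim_row (mat_exp (k \<cdot>\<^sub>m X)) = d" "dim_col (mat_exp (k \<cdot>\<^sub>m X)) = d" for k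
    using SPDD[OF mat_exp_SPD[OF Sym_smult[OF X]]] by auto
  note [simp] = d SPDD[OF mat_exp_SPD[OF Y]]
  have ts: "- t / 2 + - s / 2 = - (s + t) / 2" "- s / 2 + - t / 2 = - (s + t) / 2"
    by (simp_all add: field_simps)
  have a: "mat_exp ((- t / 2) \<cdot>\<^sub>m X) * (mat_exp ((- s / 2) \<cdot>\<^sub>m X) * B) = mat_exp ((- (s + t) / 2) \<cdot>\<^sub>m X) * B"
    if "dim_row B = d" for B
    using that by (simp only: mm_assoc[symmetric] mat_exp_add[OF X] d ts)
  have b: "mat_exp ((- s / 2) \<cdot>\<^sub>m X) * mat_exp ((- t / 2) \<cdot>\<^sub>m X) = mat_exp ((- (s + t) / 2) \<cdot>\<^sub>m X)"
    by (simp only: mat_exp_add[OF X] ts)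
  show ?thesis
    unfolding rel_log_def[of "rel_log Y X s"] exp_rel_log[OF Y X]
    by (simp only: mm_assoc a b rel_log_def d mm_dims SPDD[OF mat_exp_SPD[OF Y]])
qed

lemma d_AI_exp:
  assumes "Y \<in> Sym d" "X \<in> Sym d"
  shows "d_AI (mat_exp (t \<cdot>\<^sub>m X)) (mat_exp Y) = frob_norm (rel_log Y X t)"
  using assms
  by (simp add: d_AI_def rel_log_def mat_exp_half[OF Sym_smult] smult_smult_mat mat_exp_minus[OF Sym_smult])

text \<open>By congruence, the geodesic may start at any \<open>P\<close> instead of the identity.\<close>

lemma d_AI_frame:
  assumes P: "P \<in> SPD d" and Y: "Y \<in> Sym d" and X: "X \<in> Sym d"
  defines "S \<equiv> mat_sqrt P"
  shows "d_AI (S * mat_exp Y * S) (S * mat_exp (t \<cdot>\<^sub>m X) * S) = frob_norm (rel_log Y X t)"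
proof -
  note S = half_power(1,6)[OF P, folded S_def]
  have E: "mat_exp Y \<in> SPD d" "mat_exp (t \<cdot>\<^sub>m X) \<in> SPD d" by (intro mat_exp_SPD Y Sym_smult X)+
  have "d_AI (S * mat_exp Y * S\<^sup>T) (S * mat_exp (t \<cdot>\<^sub>m X) * S\<^sup>T) = d_AI (mat_exp Y) (mat_exp (t \<cdot>\<^sub>m X))"
    by (rule d_AI_congruence[OF E SPD_carrier[OF S(1)] S(2)])
  also have "\<dots> = d_AI (mat_exp (t \<cdot>\<^sub>m X)) (mat_exp Y)" by (rule d_AI_commute[OF E(2,1)])
  finally show ?thesis by (simp add: SPDD(3)[OF S(1)] d_AI_exp[OF Y X])
qed

lemma eigenvalue_le_frob_norm:
  assumes "orth d U" "i < d"
  shows "\<bar>f i\<bar> \<le> frob_norm (spec U f)"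
proof -
  have "(f i)\<^sup>2 \<le> (\<Sum>i<d. (f i)\<^sup>2)" using assms(2) by (intro member_le_sum) auto
  then have "\<bar>f i\<bar>\<^sup>2 \<le> (frob_norm (spec U f))\<^sup>2" using spec_frob_norm[OF assms(1)] by simp
  then show ?thesis using frob_norm_nonneg by (rule power2_le_imp_le)
qed

lemma ip_spec:
  assumes V: "orth d V" and A: "A \<in> carrier_mat d d"
  shows "ip A (spec V g) = (\<Sum>k<d. g k * (V\<^sup>T * A * V) $$ (k, k))"
proof -
  note [simp] = orthD(2,3)[OF V] carrier_matD[OF A]
  have "ip A (spec V g) = ip (V\<^sup>T * A * V) (V\<^sup>T * spec V g * V)"
    by (rule ip_orth[OF V V A spec_carrier[OF V], symmetric])
  also have "V\<^sup>T * spec V g * V = mat_diag d g"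
    by (simp add: spec_def mm_assoc orth_cancel[OF V] orthD(4)[OF V] mm_one_right)
  also have "ip (V\<^sup>T * A * V) (mat_diag d g) =
      (\<Sum>k<d. \<Sum>j<d. if k = j then g k * (V\<^sup>T * A * V) $$ (k, k) else 0)"
    unfolding ip_def by (intro sum.cong) (auto simp: mat_diag_index simp del: index_mult_mat(1))
  finally show ?thesis by simp
qed

lemma rel_log_step_bounds:
  assumes Y: "Y \<in> Sym d" and V: "orth d V"
    and D: "frob_norm Y \<le> D" "frob_norm (rel_log Y (spec V x) h) \<le> D"
  shows "4 * (\<Sum>k<d. (sinh (h * x k / 2))\<^sup>2) \<le>
      ip (Y - rel_log Y (spec V x) h) (spec V (\<lambda>k. sinh (h * x k)))"
    and "ip (Y - rel_log Y (spec V x) h) (spec V (\<lambda>k. sinh (h * x k))) \<le>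
      psi D * (4 * (\<Sum>k<d. (sinh (h * x k / 2))\<^sup>2))"
proof -
  obtain U l where U: "orth d U" "Y = spec U l" using Sym_spec_obtain[OF Y] .
  obtain W m where W: "orth d W" "rel_log Y (spec V x) h = spec W m"
    using Sym_spec_obtain[OF rel_log_Sym[OF Y Sym_spec[OF V]]] .
  have E: "spec W (\<lambda>i. exp (m i)) = spec V (\<lambda>i. exp (- (h * x i / 2))) * spec U (\<lambda>i. exp (l i)) *
      spec V (\<lambda>i. exp (- (h * x i / 2)))"
    using exp_rel_log[OF Y Sym_spec[OF V], of x h] unfolding W(2) unfolding U(2)
    by (simp add: mat_exp_spec[OF W(1)] mat_exp_spec[OF U(1)] mat_exp_spec[OF V] spec_smult)
  have "\<bar>l i\<bar> \<le> D" "\<bar>m i\<bar> \<le> D" if "i < d" for i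
    using D eigenvalue_le_frob_norm[OF U(1) that, of l] eigenvalue_le_frob_norm[OF W(1) that, of m]
    unfolding W(2) unfolding U(2) by linarith+
  from log_difference_bounds[OF U(1) V W(1) E this]
  show "4 * (\<Sum>k<d. (sinh (h * x k / 2))\<^sup>2) \<le>
      ip (Y - rel_log Y (spec V x) h) (spec V (\<lambda>k. sinh (h * x k)))"
    "ip (Y - rel_log Y (spec V x) h) (spec V (\<lambda>k. sinh (h * x k))) \<le>
      psi D * (4 * (\<Sum>k<d. (sinh (h * x k / 2))\<^sup>2))"
    unfolding W(2) unfolding U(2) by simp_all
qed

lemma sinh_scaled_limit: "(\<lambda>N. real (Suc N) * sinh (y / real (Suc N))) \<longlonglongrightarrow> y"
proof (cases "y = 0")
  case False
  have "((\<lambda>h. (sinh (0 + h) - sinh 0) / h) \<longlongrightarrow> cosh (0::real)) (at 0)"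
    unfolding DERIV_def[symmetric] by (auto intro!: derivative_eq_intros)
  then have lim: "((\<lambda>h. sinh h / h) \<longlongrightarrow> (1::real)) (at 0)" by simp
  have "(\<lambda>N. y * inverse (real (Suc N))) \<longlonglongrightarrow> y * 0"
    by (intro tendsto_intros LIMSEQ_inverse_real_of_nat)
  then have "(\<lambda>N. y / real (Suc N)) \<longlonglongrightarrow> 0" by (simp add: divide_inverse)
  then have "filterlim (\<lambda>N. y / real (Suc N)) (at 0) sequentially"
    using False by (auto simp: filterlim_at)
  from filterlim_compose[OF lim this]
  have "(\<lambda>N. y * (sinh (y / real (Suc N)) / (y / real (Suc N)))) \<longlonglongrightarrow> y * 1"
    by (intro tendsto_mult tendsto_const)
  then show ?thesis using False by (simp add: field_simps del: of_nat_Suc)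
qed simp

text \<open>On a subdivision of \<open>[s, s + h]\<close> into equal steps the left argument of the inner product telescopes,
  since the right one is the same for all steps. Refining the subdivision replaces \<open>sinh\<close> by the
  identity.\<close>

lemma rel_log_inner_bounds:
  assumes Y: "Y \<in> Sym d" and X: "X \<in> Sym d" and h: "h > 0"
  shows "h * ip X X \<le> ip (rel_log Y X s - rel_log Y X (s + h)) X"
    and "(\<And>u. s \<le> u \<Longrightarrow> u \<le> s + h \<Longrightarrow> frob_norm (rel_log Y X u) \<le> D) \<Longrightarrow>
      ip (rel_log Y X s - rel_log Y X (s + h)) X \<le> psi D * (h * ip X X)"
proof -
  obtain V x where V: "orth d V" "X = spec V x" using Sym_spec_obtain[OF X] .
  define R where "R u = rel_log Y X u" for u
  have R: "R u \<in> Sym d" for u unfolding R_def by (rule rel_log_Sym[OF Y X])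
  note dims = SymD(3,4)[OF R] SymD(3,4)[OF X] orthD(2,3)[OF V(1)]
  define \<sigma> where "\<sigma> N = spec V (\<lambda>k. sinh (h / real (Suc N) * x k))" for N
  define q where "q N = 4 * (\<Sum>k<d. (sinh (h / real (Suc N) * x k / 2))\<^sup>2)" for N
  let ?pt = "\<lambda>N i. s + real i * (h / real (Suc N))"
  have tele: "ip (R s - R (s + h)) (\<sigma> N) = (\<Sum>i<Suc N. ip (R (?pt N i) - R (?pt N (Suc i))) (\<sigma> N))" for N
  proof -
    have "ip (R (?pt N 0) - R (?pt N n)) (\<sigma> N) = (\<Sum>i<n. ip (R (?pt N i) - R (?pt N (Suc i))) (\<sigma> N))" for n
      by (induction n) (simp_all add: ip_minus_left dims del: of_nat_Suc)
    from this[of "Suc N"] show ?thesis by (simp del: of_nat_Suc)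
  qed
  have step: "R (?pt N (Suc i)) = rel_log (R (?pt N i)) (spec V x) (h / real (Suc N))" for N i
    unfolding R_def V(2)[symmetric] rel_log_add[OF Y X] by (simp add: algebra_simps add_divide_distrib)
  define qe where "qe k = (V\<^sup>T * (R s - R (s + h)) * V) $$ (k, k)" for k
  have Rc: "R s - R (s + h) \<in> carrier_mat d d" by (intro carrier_matI) (auto simp: dims)
  have ipq: "ip (R s - R (s + h)) (spec V g) = (\<Sum>k<d. g k * qe k)" for g
    unfolding qe_def by (rule ip_spec[OF V(1) Rc])
  have "(\<lambda>N. \<Sum>k<d. real (Suc N) * sinh (h * x k / real (Suc N)) * qe k) \<longlonglongrightarrow> (\<Sum>k<d. h * x k * qe k)"
    by (intro tendsto_sum tendsto_mult tendsto_const sinh_scaled_limit)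
  also have "(\<Sum>k<d. h * x k * qe k) = h * ip (R s - R (s + h)) X"
    unfolding V(2) ipq by (simp add: sum_distrib_left mult.assoc)
  also have "(\<lambda>N. \<Sum>k<d. real (Suc N) * sinh (h * x k / real (Suc N)) * qe k) =
      (\<lambda>N. real (Suc N) * ip (R s - R (s + h)) (\<sigma> N))"
    unfolding \<sigma>_def ipq by (simp add: sum_distrib_left mult.assoc del: of_nat_Suc)
  finally have lim1: "(\<lambda>N. real (Suc N) * ip (R s - R (s + h)) (\<sigma> N)) \<longlonglongrightarrow> h * ip (R s - R (s + h)) X" .
  have "(\<lambda>N. \<Sum>k<d. 4 * (real (Suc N) * sinh (h * x k / 2 / real (Suc N)))\<^sup>2) \<longlonglongrightarrow> (\<Sum>k<d. 4 * (h * x k / 2)\<^sup>2)"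
    by (intro tendsto_sum tendsto_mult tendsto_power tendsto_const sinh_scaled_limit)
  also have "(\<Sum>k<d. 4 * (h * x k / 2)\<^sup>2) = h * (h * ip X X)"
    unfolding V(2) spec_ip[OF V(1)] by (simp add: sum_distrib_left power2_eq_square mult_ac)
  also have "(\<lambda>N. \<Sum>k<d. 4 * (real (Suc N) * sinh (h * x k / 2 / real (Suc N)))\<^sup>2) =
      (\<lambda>N. real (Suc N) * (real (Suc N) * q N))"
    unfolding q_def by (simp add: sum_distrib_left power2_eq_square mult_ac del: of_nat_Suc)
  finally have lim2: "(\<lambda>N. real (Suc N) * (real (Suc N) * q N)) \<longlonglongrightarrow> h * (h * ip X X)" .
  \<comment> \<open>The lower bound holds with any \<open>D\<close>, so each step may take the larger of its two norms.\<close>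
  have low: "real (Suc N) * q N \<le> ip (R s - R (s + h)) (\<sigma> N)" for N
  proof -
    have "q N \<le> ip (R (?pt N i) - R (?pt N (Suc i))) (\<sigma> N)" for i
      unfolding q_def \<sigma>_def step
      by (rule rel_log_step_bounds(1)[OF R V(1) max.cobounded1 max.cobounded2])
    then have "(\<Sum>i<Suc N. q N) \<le> (\<Sum>i<Suc N. ip (R (?pt N i) - R (?pt N (Suc i))) (\<sigma> N))"
      by (intro sum_mono)
    then show ?thesis unfolding tele by simp
  qed
  have "h * (h * ip X X) \<le> h * ip (R s - R (s + h)) X"
    by (rule LIMSEQ_le[OF lim2 lim1]) (intro exI allI impI mult_left_mono low, simp)
  then show "h * ip X X \<le> ip (rel_log Y X s - rel_log Y X (s + h)) X"
    using h by (simp add: R_def)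
  assume D: "\<And>u. s \<le> u \<Longrightarrow> u \<le> s + h \<Longrightarrow> frob_norm (rel_log Y X u) \<le> D"
  have up: "ip (R s - R (s + h)) (\<sigma> N) \<le> psi D * (real (Suc N) * q N)" for N
  proof -
    have pt: "frob_norm (R (?pt N i)) \<le> D" if "i \<le> Suc N" for i
    proof -
      have "real i * (h / real (Suc N)) \<le> real (Suc N) * (h / real (Suc N))"
        using that h by (intro mult_right_mono) (auto simp del: of_nat_Suc)
      then show ?thesis unfolding R_def using h by (intro D) (auto simp del: of_nat_Suc)
    qed
    have "ip (R (?pt N i) - R (?pt N (Suc i))) (\<sigma> N) \<le> psi D * q N" if "i < Suc N" for i
      using pt[of i] pt[of "Suc i"] that unfolding q_def \<sigma>_def step
      by (intro rel_log_step_bounds(2)[OF R V(1)]) auto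
    then have "(\<Sum>i<Suc N. ip (R (?pt N i) - R (?pt N (Suc i))) (\<sigma> N)) \<le> (\<Sum>i<Suc N. psi D * q N)"
      by (intro sum_mono) auto
    then show ?thesis unfolding tele by (simp add: mult_ac)
  qed
  have "h * ip (R s - R (s + h)) X \<le> psi D * (h * (h * ip X X))"
    by (rule LIMSEQ_le[OF lim1 tendsto_mult[OF tendsto_const lim2]])
      (intro exI allI impI, subst mult.left_commute, intro mult_left_mono up, simp)
  then have "h * ip (R s - R (s + h)) X \<le> h * (psi D * (h * ip X X))" by (simp add: mult_ac)
  then show "ip (rel_log Y X s - rel_log Y X (s + h)) X \<le> psi D * (h * ip X X)"
    using h by (simp add: R_def)
qed

lemma ip_spec_spec:
  assumes U: "orth d U" and W: "orth d W"
  shows "ip (spec U f) (spec W g) = (\<Sum>i<d. \<Sum>a<d. ((U\<^sup>T * W) $$ (i, a))\<^sup>2 * (f i * g a))"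
proof -
  note [simp] = orthD(2,3)[OF U] orthD(2,3)[OF W]
  have G: "U\<^sup>T * W \<in> carrier_mat d d" by (intro carrier_matI) auto
  have "ip (spec U f) (spec W g) = ip (U\<^sup>T * spec U f * W) (U\<^sup>T * spec W g * W)"
    by (rule ip_orth[OF U W spec_carrier[OF U] spec_carrier[OF W], symmetric])
  also have "U\<^sup>T * spec U f * W = mat_diag d f * (U\<^sup>T * W)"
    by (simp add: spec_def mm_assoc orth_cancel[OF U])
  also have "U\<^sup>T * spec W g * W = (U\<^sup>T * W) * mat_diag d g"
    by (simp add: spec_def mm_assoc orth_cancel[OF W] orthD(4)[OF W] mm_one_right)
  also have "ip (mat_diag d f * (U\<^sup>T * W)) ((U\<^sup>T * W) * mat_diag d g) =
      (\<Sum>i<d. \<Sum>a<d. ((U\<^sup>T * W) $$ (i, a))\<^sup>2 * (f i * g a))"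
    unfolding mat_diag_mult_left[OF G] mat_diag_mult_right[OF G]
    by (simp add: ip_def power2_eq_square mult_ac del: index_mult_mat(1))
  finally show ?thesis .
qed

lemma ip_exp_conj_has_derivative:
  assumes V: "orth d V" and A: "A \<in> Sym d" and B: "B \<in> Sym d"
  shows "((\<lambda>h. ip A (spec V (\<lambda>k. exp (- h / 2 * x k)) * B * spec V (\<lambda>k. exp (- h / 2 * x k))))
    has_real_derivative - ip (A * B) (spec V x)) (at 0)"
proof -
  note [simp] = orthD(2,3)[OF V] SymD(2-4)[OF A] SymD(2-4)[OF B]
  define a where "a = V\<^sup>T * A * V"
  define b where "b = V\<^sup>T * B * V"
  have ac: "a \<in> carrier_mat d d" "b \<in> carrier_mat d d" unfolding a_def b_def by (intro carrier_matI; simp)+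
  have "a \<in> Sym d" "b \<in> Sym d"
    using ac by (simp_all add: Sym_def a_def b_def mm_transpose mm_assoc)
  then have sym: "a $$ (k, l) = a $$ (l, k)" "b $$ (k, l) = b $$ (l, k)" if "k < d" "l < d" for k l
    using that Sym_index by blast+
  have e: "ip A (spec V f * B * spec V f) = (\<Sum>k<d. \<Sum>l<d. a $$ (k, l) * (f k * b $$ (k, l) * f l))" for f
  proof -
    have "ip A (spec V f * B * spec V f) = ip a (V\<^sup>T * (spec V f * B * spec V f) * V)"
      unfolding a_def by (rule ip_orth[OF V V, symmetric]) (auto intro!: carrier_matI)
    also have "V\<^sup>T * (spec V f * B * spec V f) * V = mat_diag d f * (b * mat_diag d f)"
      by (simp add: spec_def b_def mm_assoc orth_cancel[OF V] orthD(4)[OF V] mm_one_right)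
    also have "ip a (mat_diag d f * (b * mat_diag d f)) =
        (\<Sum>k<d. \<Sum>l<d. a $$ (k, l) * (f k * b $$ (k, l) * f l))"
      unfolding mat_diag_mult_right[OF ac(2)] using ac
      by (subst mat_diag_mult_left[of _ d d]) (auto simp: ip_def mult_ac)
    finally show ?thesis .
  qed
  have D: "((\<lambda>h. \<Sum>k<d. \<Sum>l<d. a $$ (k, l) * (exp (- h / 2 * x k) * b $$ (k, l) * exp (- h / 2 * x l)))
      has_real_derivative (\<Sum>k<d. \<Sum>l<d. a $$ (k, l) * b $$ (k, l) * (- x k / 2 + - x l / 2))) (at 0)"
    by (auto intro!: derivative_eq_intros DERIV_sum sum.cong simp: algebra_simps)
  have sw: "(\<Sum>k<d. \<Sum>l<d. a $$ (k, l) * b $$ (k, l) * x l) = (\<Sum>k<d. \<Sum>l<d. a $$ (k, l) * b $$ (k, l) * x k)"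
    by (subst sum.swap) (intro sum.cong refl, simp add: sym)
  have "(\<Sum>k<d. \<Sum>l<d. a $$ (k, l) * b $$ (k, l) * (- x k / 2 + - x l / 2)) =
      - ((\<Sum>k<d. \<Sum>l<d. a $$ (k, l) * b $$ (k, l) * x k) + (\<Sum>k<d. \<Sum>l<d. a $$ (k, l) * b $$ (k, l) * x l)) / 2"
    by (simp add: algebra_simps sum.distrib sum_negf sum_subtractf add_divide_distrib flip: sum_divide_distrib)
  also have "\<dots> = - (\<Sum>k<d. \<Sum>l<d. a $$ (k, l) * b $$ (k, l) * x k)" unfolding sw by simp
  also have "(\<Sum>k<d. \<Sum>l<d. a $$ (k, l) * b $$ (k, l) * x k) = (\<Sum>k<d. x k * (a * b) $$ (k, k))"
    using ac by (intro sum.cong refl, subst mat_index_mult)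
      (auto simp: sum_distrib_left sym mult_ac intro!: sum.cong)
  also have "a * b = V\<^sup>T * (A * B) * V"
    by (simp add: a_def b_def mm_assoc orth_cancel[OF V])
  also have "(\<Sum>k<d. x k * (V\<^sup>T * (A * B) * V) $$ (k, k)) = ip (A * B) (spec V x)"
    by (rule ip_spec[OF V, symmetric]) (intro carrier_matI; simp)
  finally have s: "(\<Sum>k<d. \<Sum>l<d. a $$ (k, l) * b $$ (k, l) * (- x k / 2 + - x l / 2)) = - ip (A * B) (spec V x)" .
  show ?thesis unfolding e using D unfolding s .
qed

lemma has_derivative_by_comparison:
  fixes f g e :: "real \<Rightarrow> real"
  assumes le: "\<And>h. \<bar>f h - f 0 - (g h - g 0)\<bar> \<le> e h"
    and e: "e 0 = 0" "(e has_real_derivative 0) (at 0)" and g: "(g has_real_derivative G) (at 0)"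
  shows "(f has_real_derivative G) (at 0)"
proof -
  have "((\<lambda>h. (e (0 + h) - e 0) / h) \<longlongrightarrow> 0) (at 0)" using e(2) unfolding DERIV_def .
  then have "((\<lambda>h. e h / h) \<longlongrightarrow> 0) (at 0)" using e(1) by simp
  then have "((\<lambda>h. ((f h - g h) - (f 0 - g 0)) / h) \<longlongrightarrow> 0) (at 0)"
  proof (rule tendsto_0_le[where K = 1], intro always_eventually allI)
    fix h
    have "\<bar>(f h - g h) - (f 0 - g 0)\<bar> \<le> \<bar>e h\<bar>" using le[of h] by (simp add: algebra_simps)
    then show "norm (((f h - g h) - (f 0 - g 0)) / h) \<le> norm (e h / h) * 1"
      by (simp add: abs_divide divide_right_mono)
  qed
  then have "((\<lambda>h. f h - g h) has_real_derivative 0) (at 0)" unfolding DERIV_def by simp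
  from DERIV_add[OF this g] show ?thesis by simp
qed

text \<open>First variation of the squared distance. With \<open>\<delta> = m - l\<close> for an eigenvalue \<open>m\<close> of the moving
  logarithm and \<open>l\<close> of the fixed one, \<open>(m\<^sup>2 - l\<^sup>2)/2\<close> differs from \<open>l (exp \<delta> - 1)\<close> by at most a multiple
  of \<open>exp \<delta> + exp(-\<delta>) - 2\<close>. Averaged over the overlaps of the eigenvectors, both expressions become
  traces of products of exponentials, which are differentiable in plain sight.\<close>

lemma half_square_has_derivative_0:
  assumes Y: "Y \<in> Sym d" and X: "X \<in> Sym d"
  shows "((\<lambda>h. (frob_norm (rel_log Y X h))\<^sup>2 / 2) has_real_derivative - ip Y X) (at 0)"
proof -
  obtain U l where U: "orth d U" "Y = spec U l" using Sym_spec_obtain[OF Y] .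
  obtain V x where V: "orth d V" "X = spec V x" using Sym_spec_obtain[OF X] .
  note [simp] = orthD(2,3)[OF U(1)] orthD(2,3)[OF V(1)]
  define E where "E h = spec V (\<lambda>k. exp (- h / 2 * x k))" for h
  define E' where "E' h = spec V (\<lambda>k. exp (- h / 2 * (- x k)))" for h
  have EE: "E' h * E h = 1\<^sub>m d" for h
    by (simp add: E_def E'_def spec_mult[OF V(1)] spec_const[OF V(1)] flip: exp_add)
  define eY where "eY = spec U (\<lambda>i. exp (l i))"
  define eY' where "eY' = spec U (\<lambda>i. exp (- l i))"
  have eYS: "eY \<in> Sym d" "eY' \<in> Sym d" by (auto simp: eY_def eY'_def intro: Sym_spec[OF U(1)])
  \<comment> \<open>In terms of \<open>\<delta>\<close>, these are the averages of \<open>exp \<delta>\<close>, of \<open>exp(-\<delta>)\<close> and of \<open>l exp \<delta>\<close>.\<close>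
  define T1 where "T1 h = ip eY' (E h * eY * E h)" for h
  define T2 where "T2 h = ip eY (E' h * eY' * E' h)" for h
  define T3 where "T3 h = ip (spec U (\<lambda>i. l i * exp (- l i))) (E h * eY * E h)" for h
  define c where "c = frob_norm Y"
  have c: "c \<ge> 0" "\<bar>l i\<bar> \<le> c" if "i < d" for i
    using eigenvalue_le_frob_norm[OF U(1) that] frob_norm_nonneg by (auto simp: c_def U(2))
  have c0: "c \<ge> 0" by (simp add: c_def frob_norm_nonneg)
  have E0: "E 0 = 1\<^sub>m d" "E' 0 = 1\<^sub>m d" by (simp_all add: E_def E'_def spec_const[OF V(1)])
  have tr: "ip (1\<^sub>m d) B = mat_tr B" if "dim_row B = d" "dim_col B = d" for B
    using that by (subst mat_tr_mult[symmetric]) (auto simp: mm_one_left mat_tr_def)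
  have d1: "(T1 has_real_derivative - mat_tr X) (at 0)"
    using ip_exp_conj_has_derivative[OF V(1) eYS(2,1), of x]
    unfolding T1_def[abs_def] E_def eY_def eY'_def
    by (simp add: spec_mult[OF U(1)] spec_const[OF U(1)] tr V(2) flip: exp_add)
  have d2: "(T2 has_real_derivative mat_tr X) (at 0)"
    using ip_exp_conj_has_derivative[OF V(1) eYS(1,2), of "\<lambda>k. - x k"]
    unfolding T2_def[abs_def] E'_def eY_def eY'_def
    by (simp add: spec_mult[OF U(1)] spec_const[OF U(1)] tr V(2) spec_tr[OF V(1)] sum_negf flip: exp_add)
  have lS: "spec U (\<lambda>i. l i * exp (- l i)) * eY = Y"
    by (simp add: eY_def spec_mult[OF U(1)] U(2) mult.assoc flip: exp_add)
  have d3: "(T3 has_real_derivative - ip Y X) (at 0)"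
    using ip_exp_conj_has_derivative[OF V(1) Sym_spec[OF U(1)] eYS(1), of "\<lambda>i. l i * exp (- l i)" x]
    unfolding T3_def[abs_def] E_def by (simp add: lS V(2))
  have eps: "((\<lambda>h. (c + 1) * (T1 h + T2 h - 2 * real d)) has_real_derivative 0) (at 0)"
    using d1 d2 by (auto intro!: derivative_eq_intros)
  have T10: "T1 0 = d" "T2 0 = d" "T3 0 = mat_tr Y"
  proof -
    have "ip eY' eY = d" "ip eY eY' = d"
      by (simp_all add: eY_def eY'_def spec_ip[OF U(1)] flip: exp_add)
    moreover have "eY' * 1\<^sub>m d = eY'" "eY * 1\<^sub>m d = eY" "1\<^sub>m d * eY = eY" "1\<^sub>m d * eY' = eY'"
      by (simp_all add: eY_def eY'_def mm_one_left mm_one_right)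
    moreover have "ip (spec U (\<lambda>i. l i * exp (- l i))) eY = mat_tr Y"
      by (simp add: eY_def spec_ip[OF U(1)] U(2) spec_tr[OF U(1)] mult.assoc flip: exp_add)
    ultimately show "T1 0 = d" "T2 0 = d" "T3 0 = mat_tr Y" by (simp_all add: T1_def T2_def T3_def E0)
  qed
  have main: "\<bar>(frob_norm (rel_log Y X h))\<^sup>2 / 2 - (frob_norm (rel_log Y X 0))\<^sup>2 / 2 - (T3 h - T3 0)\<bar>
      \<le> (c + 1) * (T1 h + T2 h - 2 * real d)" for h
  proof -
    obtain W m where W: "orth d W" "rel_log Y X h = spec W m"
      using Sym_spec_obtain[OF rel_log_Sym[OF Y X]] .
    have eZ: "spec W (\<lambda>i. exp (m i)) = E h * eY * E h"
      using exp_rel_log[OF Y X, of h] unfolding W(2) unfolding U(2) V(2)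
      by (simp add: mat_exp_spec[OF W(1)] mat_exp_spec[OF U(1)] mat_exp_spec[OF V(1)] spec_smult E_def eY_def)
    have [simp]: "dim_row (E h) = d" "dim_col (E h) = d" "dim_row (E' h) = d" "dim_col (E' h) = d"
      "dim_row eY = d" "dim_col eY = d" "dim_row eY' = d" "dim_col eY' = d" for h
      by (auto simp: E_def E'_def eY_def eY'_def)
    have "eY' * eY = 1\<^sub>m d"
      by (simp add: eY_def eY'_def spec_mult[OF U(1)] spec_const[OF U(1)] flip: exp_add)
    note can = mm_cancel[OF EE] mm_cancel[OF this]
    have "minv (spec W (\<lambda>i. exp (m i))) = E' h * eY' * E' h"
      unfolding eZ
      by (rule minv_unique[of _ d]) (auto simp: mm_assoc can EE intro!: carrier_matI)
    then have eZ': "spec W (\<lambda>i. exp (- m i)) = E' h * eY' * E' h"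
      by (simp add: minv_spec[OF W(1)])
    \<comment> \<open>The overlaps of the two eigenbases form a doubly stochastic matrix.\<close>
    define p where "p i a = ((U\<^sup>T * W) $$ (i, a))\<^sup>2" for i a
    have p0: "p i a \<ge> 0" for i a by (simp add: p_def)
    have P: "ip (spec U f) (spec W g) = (\<Sum>i<d. \<Sum>a<d. p i a * (f i * g a))" for f g
      unfolding p_def by (rule ip_spec_spec[OF U(1) W(1)])
    have S1: "spec U (\<lambda>_. 1) = 1\<^sub>m d" "spec W (\<lambda>_. 1) = 1\<^sub>m d"
      by (rule spec_const[OF U(1)], rule spec_const[OF W(1)])
    have PW: "(\<Sum>i<d. \<Sum>a<d. p i a * g a) = (\<Sum>a<d. g a)" for g
      using P[of "\<lambda>_. 1" g] orthD(2)[OF W(1)] by (simp add: S1 tr spec_tr[OF W(1)])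
    have PU: "(\<Sum>i<d. \<Sum>a<d. p i a * f i) = (\<Sum>i<d. f i)" for f
      using P[of f "\<lambda>_. 1"] ip_comm[of "spec U f" "1\<^sub>m d"] by (simp add: S1 tr spec_tr[OF U(1)])
    have t1: "T1 h = (\<Sum>i<d. \<Sum>a<d. p i a * exp (m a - l i))"
      unfolding T1_def eZ[symmetric] eY'_def P by (simp add: exp_diff exp_minus field_simps)
    have t2: "T2 h = (\<Sum>i<d. \<Sum>a<d. p i a * exp (l i - m a))"
      unfolding T2_def eZ'[symmetric] eY_def P by (simp add: exp_diff exp_minus field_simps)
    have t3: "T3 h = (\<Sum>i<d. \<Sum>a<d. p i a * (l i * exp (m a - l i)))"
      unfolding T3_def eZ[symmetric] P by (simp add: exp_diff exp_minus field_simps)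
    have t0: "T3 0 = (\<Sum>i<d. \<Sum>a<d. p i a * l i)" unfolding T10 PU by (simp add: U(2) spec_tr[OF U(1)])
    have n: "real d = (\<Sum>i<d. \<Sum>a<d. p i a)" using PU[of "\<lambda>_. 1"] by simp
    have z1: "(frob_norm (rel_log Y X h))\<^sup>2 / 2 = (\<Sum>i<d. \<Sum>a<d. p i a * ((m a)\<^sup>2 / 2))"
      unfolding W(2) spec_frob_norm[OF W(1)] PW by (simp add: sum_divide_distrib)
    have z0: "(frob_norm (rel_log Y X 0))\<^sup>2 / 2 = (\<Sum>i<d. \<Sum>a<d. p i a * ((l i)\<^sup>2 / 2))"
      unfolding rel_log_0[OF Y X] unfolding U(2) spec_frob_norm[OF U(1)] PU by (simp add: sum_divide_distrib)
    have L: "(frob_norm (rel_log Y X h))\<^sup>2 / 2 - (frob_norm (rel_log Y X 0))\<^sup>2 / 2 - (T3 h - T3 0) =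
        (\<Sum>i<d. \<Sum>a<d. p i a * ((m a)\<^sup>2 / 2 - (l i)\<^sup>2 / 2 - (l i * exp (m a - l i) - l i)))"
      unfolding z1 z0 t3 t0 by (simp add: right_diff_distrib sum_subtractf)
    have Rr: "(c + 1) * (T1 h + T2 h - 2 * real d) =
        (\<Sum>i<d. \<Sum>a<d. p i a * ((c + 1) * (exp (m a - l i) + exp (l i - m a) - 2)))"
      unfolding t1 t2 n by (simp add: algebra_simps sum_distrib_left sum.distrib sum_subtractf)
    have pt: "\<bar>(m a)\<^sup>2 / 2 - (l i)\<^sup>2 / 2 - (l i * exp (m a - l i) - l i)\<bar>
        \<le> (c + 1) * (exp (m a - l i) + exp (l i - m a) - 2)" if "i < d" for i a
    proof -
      define \<delta> where "\<delta> = m a - l i"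
      define q where "q = exp \<delta> + exp (- \<delta>) - 2"
      have q1: "0 \<le> exp \<delta> - 1 - \<delta>" using exp_ge_add_one_self[of \<delta>] by linarith
      have q2: "exp \<delta> - 1 - \<delta> \<le> q" using exp_ge_add_one_self[of "- \<delta>"] unfolding q_def by linarith
      have q3: "\<delta>\<^sup>2 \<le> q"
      proof -
        have s: "\<bar>u\<bar> \<le> \<bar>sinh u\<bar>" for u :: real
          using le_sinh[of u] le_sinh[of "- u"] by (cases "u \<ge> 0") auto
        have "q = 4 * (sinh (\<delta> / 2))\<^sup>2"
          by (simp add: q_def sinh_field_def power2_eq_square algebra_simps flip: exp_add)
        moreover have "(\<delta> / 2)\<^sup>2 \<le> (sinh (\<delta> / 2))\<^sup>2" using s[of "\<delta> / 2"] by (rule abs_le_square_iff[THEN iffD1])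
        ultimately show ?thesis by (simp add: power_divide)
      qed
      have "(m a)\<^sup>2 / 2 - (l i)\<^sup>2 / 2 - (l i * exp (m a - l i) - l i) = \<delta>\<^sup>2 / 2 - l i * (exp \<delta> - 1 - \<delta>)"
        by (simp add: \<delta>_def power2_eq_square algebra_simps add_divide_distrib diff_divide_distrib)
      also have "\<bar>\<dots>\<bar> \<le> \<bar>\<delta>\<^sup>2 / 2\<bar> + \<bar>l i * (exp \<delta> - 1 - \<delta>)\<bar>" by (rule abs_triangle_ineq4)
      also have "\<bar>l i * (exp \<delta> - 1 - \<delta>)\<bar> \<le> c * q"
        unfolding abs_mult using c[OF that] q1 q2 by (intro mult_mono) auto
      also have "\<bar>\<delta>\<^sup>2 / 2\<bar> + c * q \<le> (c + 1) * q"
        using q3 order_trans[OF zero_le_power2 q3] by (simp add: algebra_simps)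
      finally show ?thesis by (simp add: q_def \<delta>_def)
    qed
    show ?thesis unfolding L Rr
      by (intro order_trans[OF sum_abs] sum_mono) (auto simp: abs_mult p0 intro!: mult_left_mono pt)
  qed
  show ?thesis
    by (rule has_derivative_by_comparison[OF main _ eps d3]) (simp add: T10)
qed

lemma half_square_has_derivative:
  assumes Y: "Y \<in> Sym d" and X: "X \<in> Sym d"
  shows "((\<lambda>t. (frob_norm (rel_log Y X t))\<^sup>2 / 2) has_real_derivative - ip (rel_log Y X t) X) (at t)"
proof -
  have "((\<lambda>h. (frob_norm (rel_log Y X (t + h)))\<^sup>2 / 2) has_real_derivative - ip (rel_log Y X t) X) (at 0)"
    using half_square_has_derivative_0[OF rel_log_Sym[OF Y X] X, of t] by (simp add: rel_log_add[OF Y X])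
  then show ?thesis
    using DERIV_shift[of "\<lambda>t. (frob_norm (rel_log Y X t))\<^sup>2 / 2" _ 0 t] by (simp add: add.commute)
qed

section \<open>Comparison inequalities along a geodesic\<close>

text \<open>Integrating the first variation against the two bounds on the inner product. For \<open>t = 1\<close> the lower
  bound reads \<open>\<parallel>Y - X\<parallel> \<le> \<parallel>Y\<^sub>1\<parallel>\<close>: the exponential map does not decrease distances.\<close>

lemma half_square_lower_bound:
  assumes Y: "Y \<in> Sym d" and X: "X \<in> Sym d" and t: "0 \<le> t"
  shows "(frob_norm Y)\<^sup>2 / 2 - t * ip Y X + t\<^sup>2 / 2 * ip X X \<le> (frob_norm (rel_log Y X t))\<^sup>2 / 2"
proof -
  define \<phi> where "\<phi> t = (frob_norm (rel_log Y X t))\<^sup>2 / 2" for t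
  define k where "k u = \<phi> u + u * ip Y X - u\<^sup>2 / 2 * ip X X" for u
  have "k 0 \<le> k t"
  proof (rule DERIV_nonneg_imp_nondecreasing[OF t])
    fix u assume u: "0 \<le> u" "u \<le> t"
    have "(\<phi> has_real_derivative - ip (rel_log Y X u) X) (at u)"
      unfolding \<phi>_def[abs_def] by (rule half_square_has_derivative[OF Y X])
    then have "(k has_real_derivative - ip (rel_log Y X u) X + ip Y X - u * ip X X) (at u)"
      unfolding k_def[abs_def] by (auto intro!: derivative_eq_intros)
    moreover have "u * ip X X \<le> ip (rel_log Y X 0 - rel_log Y X (0 + u)) X" if "u > 0"
      using rel_log_inner_bounds(1)[OF Y X that, of 0] .
    then have "u * ip X X \<le> ip Y X - ip (rel_log Y X u) X"
      using u(1) SymD(3,4)[OF Y] SymD(3,4)[OF rel_log_Sym[OF Y X]]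
      by (cases "u = 0") (auto simp: rel_log_0[OF Y X] ip_minus_left)
    ultimately show "\<exists>y. (k has_real_derivative y) (at u) \<and> 0 \<le> y"
      by (intro exI[of _ "- ip (rel_log Y X u) X + ip Y X - u * ip X X"]) auto
  qed
  then show ?thesis by (simp add: k_def \<phi>_def rel_log_0[OF Y X])
qed

lemma half_square_upper_bound:
  assumes Y: "Y \<in> Sym d" and X: "X \<in> Sym d" and t: "0 \<le> t"
    and D: "\<And>u. 0 \<le> u \<Longrightarrow> u \<le> t \<Longrightarrow> frob_norm (rel_log Y X u) \<le> D"
  shows "(frob_norm (rel_log Y X t))\<^sup>2 / 2 \<le> (frob_norm Y)\<^sup>2 / 2 - t * ip Y X + psi D * (t\<^sup>2 / 2 * ip X X)"
proof -
  define \<phi> where "\<phi> t = (frob_norm (rel_log Y X t))\<^sup>2 / 2" for t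
  define k where "k u = \<phi> u + u * ip Y X - psi D * (u\<^sup>2 / 2 * ip X X)" for u
  have "k t \<le> k 0"
  proof (rule DERIV_nonpos_imp_nonincreasing[OF t])
    fix u assume u: "0 \<le> u" "u \<le> t"
    have "(\<phi> has_real_derivative - ip (rel_log Y X u) X) (at u)"
      unfolding \<phi>_def[abs_def] by (rule half_square_has_derivative[OF Y X])
    then have "(k has_real_derivative - ip (rel_log Y X u) X + ip Y X - psi D * (u * ip X X)) (at u)"
      unfolding k_def[abs_def] by (auto intro!: derivative_eq_intros)
    moreover have "ip (rel_log Y X 0 - rel_log Y X (0 + u)) X \<le> psi D * (u * ip X X)" if "u > 0"
      using rel_log_inner_bounds(2)[OF Y X that, of 0 D] D u by auto
    then have "ip Y X - ip (rel_log Y X u) X \<le> psi D * (u * ip X X)"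
      using u(1) SymD(3,4)[OF Y] SymD(3,4)[OF rel_log_Sym[OF Y X]]
      by (cases "u = 0") (auto simp: rel_log_0[OF Y X] ip_minus_left)
    ultimately show "\<exists>y. (k has_real_derivative y) (at u) \<and> y \<le> 0"
      by (intro exI[of _ "- ip (rel_log Y X u) X + ip Y X - psi D * (u * ip X X)"]) auto
  qed
  then show ?thesis by (simp add: k_def \<phi>_def rel_log_0[OF Y X])
qed

text \<open>The premise \<open>ip Y X = ip X X\<close> says that \<open>X\<close> is the negative gradient, projected to some subspace of
  directions. A step along it with step size \<open>1/\<psi>(D/\<surd>2)\<close> might leave the
  sublevel set on which the upper bound is available. If it did, convexity and the initial descent
  give a return to the initial level, up to which the upper bound holds and contradicts it.\<close>

lemma gradient_step_descent:
  assumes Y: "Y \<in> Sym d" and X: "X \<in> Sym d" and grad: "ip Y X = ip X X" and D: "frob_norm Y \<le> D"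
  defines "\<tau> \<equiv> inverse (psi (D / sqrt 2))"
  shows "(frob_norm (rel_log Y X \<tau>))\<^sup>2 / 2 \<le> (frob_norm Y)\<^sup>2 / 2 - (1 - 1 / sqrt 2) * \<tau> * ip X X"
    and "frob_norm (rel_log Y X \<tau>) \<le> frob_norm Y"
proof -
  define \<phi> where "\<phi> t = (frob_norm (rel_log Y X t))\<^sup>2 / 2" for t
  define \<gamma> where "\<gamma> t = ip (rel_log Y X t) X" for t
  define w where "w = ip X X"
  have w0: "w \<ge> 0" by (simp add: w_def ip_nonneg)
  have D0: "D \<ge> 0" using D frob_norm_nonneg[of Y] by linarith
  have \<tau>0: "\<tau> > 0" using psi_ge_1[of "D / sqrt 2"] by (simp add: \<tau>_def)
  have \<phi>0: "\<phi> 0 = (frob_norm Y)\<^sup>2 / 2" by (simp add: \<phi>_def rel_log_0[OF Y X])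
  have der: "(\<phi> has_real_derivative - \<gamma> t) (at t)" for t
    unfolding \<phi>_def[abs_def] \<gamma>_def by (rule half_square_has_derivative[OF Y X])
  have mono: "\<gamma> t \<le> \<gamma> s" if "s < t" for s t
  proof -
    have "(t - s) * w \<le> ip (rel_log Y X s - rel_log Y X (s + (t - s))) X"
      using rel_log_inner_bounds(1)[OF Y X, of "t - s" s] that by (simp add: w_def)
    then have "(t - s) * w \<le> \<gamma> s - \<gamma> t"
      using SymD(3,4)[OF rel_log_Sym[OF Y X]] by (simp add: \<gamma>_def ip_minus_left)
    moreover have "0 \<le> (t - s) * w" using that w0 by simp
    ultimately show ?thesis by linarith
  qed
  have conv: "\<phi> s \<le> \<phi> 0" if st: "0 \<le> s" "s \<le> t" and t: "\<phi> t \<le> \<phi> 0" for s t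
  proof (rule ccontr)
    assume n: "\<not> ?thesis"
    with st t have s: "0 < s" "s < t" by (auto simp: le_less)
    obtain u where u: "0 < u" "u < s" "\<phi> s - \<phi> 0 = (s - 0) * - \<gamma> u"
      using MVT2[OF s(1), of \<phi> "\<lambda>t. - \<gamma> t"] der by blast
    obtain v where v: "s < v" "v < t" "\<phi> t - \<phi> s = (t - s) * - \<gamma> v"
      using MVT2[OF s(2), of \<phi> "\<lambda>t. - \<gamma> t"] der by blast
    have "\<gamma> u < 0"
    proof (rule ccontr)
      assume "\<not> \<gamma> u < 0"
      then have "0 \<le> s * \<gamma> u" using s by simp
      then show False using n u(3) by simp
    qed
    then have "(t - s) * \<gamma> v < 0" using mono[of u v] u v s by (intro mult_pos_neg) auto
    then show False using v(3) n t by simp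
  qed
  have psiD: "psi D \<le> sqrt 2 * inverse \<tau>"
    using psi_scale[of "D / sqrt 2" "sqrt 2"] D0 by (simp add: \<tau>_def)
  have bound: "\<phi> t \<le> \<phi> 0 - t * w + t\<^sup>2 / (sqrt 2 * \<tau>) * w" if t: "0 \<le> t" "\<phi> t \<le> \<phi> 0" for t
  proof -
    have "frob_norm (rel_log Y X u) \<le> D" if u: "0 \<le> u" "u \<le> t" for u
    proof -
      have "(frob_norm (rel_log Y X u))\<^sup>2 \<le> (frob_norm Y)\<^sup>2"
        using conv[OF u t(2)] unfolding \<phi>0 by (simp add: \<phi>_def)
      then have "frob_norm (rel_log Y X u) \<le> frob_norm Y"
        using frob_norm_nonneg by (rule power2_le_imp_le)
      then show ?thesis using D by simp
    qed
    from half_square_upper_bound[OF Y X t(1) this]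
    have "\<phi> t \<le> \<phi> 0 - t * w + psi D * (t\<^sup>2 / 2 * w)"
      unfolding \<phi>0 by (simp add: \<phi>_def grad w_def)
    also have "psi D * (t\<^sup>2 / 2 * w) \<le> sqrt 2 * inverse \<tau> * (t\<^sup>2 / 2 * w)"
      using psiD w0 by (intro mult_right_mono) auto
    also have "\<dots> = t\<^sup>2 / (sqrt 2 * \<tau>) * w"
      using \<tau>0 by (simp add: field_simps)
    finally show ?thesis by simp
  qed
  have level: "\<phi> \<tau> \<le> \<phi> 0"
  proof (rule ccontr)
    assume n: "\<not> ?thesis"
    have "w \<noteq> 0"
    proof
      assume "w = 0"
      then have "frob_norm X = 0" by (simp add: w_def frob_norm_eq_sqrt)
      from frob_norm_eq_0[OF this] have X0: "k \<cdot>\<^sub>m X = 0 \<cdot>\<^sub>m X" for k by (intro eq_matI) auto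
      have "rel_log Y X \<tau> = rel_log Y X 0"
        by (simp only: rel_log_def X0[of "- \<tau> / 2"] X0[of "- 0 / 2"])
      then have "rel_log Y X \<tau> = Y" by (simp add: rel_log_0[OF Y X])
      then show False using n by (simp add: \<phi>_def rel_log_0[OF Y X])
    qed
    then have w: "w > 0" using w0 by simp
    have "\<gamma> 0 = w" by (simp add: \<gamma>_def rel_log_0[OF Y X] grad w_def)
    then have "\<exists>e>0. \<forall>h>0. h < e \<longrightarrow> \<phi> (0 + h) < \<phi> 0"
      using DERIV_neg_dec_right[OF der[of 0]] w by auto
    then obtain e where e: "e > 0" "\<And>h. 0 < h \<Longrightarrow> h < e \<Longrightarrow> \<phi> h < \<phi> 0" by auto
    \<comment> \<open>At \<open>a\<close> the function is still below its initial level, so it has to cross it before \<open>\<tau>\<close>.\<close>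
    define a where "a = min (e / 2) (\<tau> / 2)"
    have a: "0 < a" "a < e" "a < \<tau>" using e(1) \<tau>0 by (auto simp: a_def min_def)
    have "continuous_on {a..\<tau>} \<phi>"
      using der by (intro continuous_at_imp_continuous_on ballI) (blast intro: DERIV_isCont)
    then obtain t where t: "a \<le> t" "t \<le> \<tau>" "\<phi> t = \<phi> 0"
      using IVT'[of \<phi> a "\<phi> 0" \<tau>] e(2)[OF a(1,2)] n a(3) by force
    have t\<tau>: "t < \<tau>" using t n by (cases "t = \<tau>") auto
    have tp: "t > 0" using a t by simp
    have "\<phi> 0 \<le> \<phi> 0 - t * w + t\<^sup>2 / (sqrt 2 * \<tau>) * w" using bound[of t] t tp by simp
    then have "t * w * sqrt 2 * \<tau> \<le> t * w * t"
      using \<tau>0 by (simp add: field_simps power2_eq_square)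
    then have "sqrt 2 * \<tau> \<le> t"
      using tp w by (metis mult.assoc mult_le_cancel_left_pos mult_pos_pos)
    moreover have "1 * \<tau> < sqrt 2 * \<tau>" using \<tau>0 by (intro mult_strict_right_mono) auto
    ultimately show False using t\<tau> by simp
  qed
  from bound[OF less_imp_le[OF \<tau>0] level]
  show "(frob_norm (rel_log Y X \<tau>))\<^sup>2 / 2 \<le> (frob_norm Y)\<^sup>2 / 2 - (1 - 1 / sqrt 2) * \<tau> * ip X X"
    using \<tau>0 unfolding \<phi>0 by (simp add: \<phi>_def w_def power2_eq_square field_simps)
  have "(frob_norm (rel_log Y X \<tau>))\<^sup>2 \<le> (frob_norm Y)\<^sup>2" using level unfolding \<phi>0 by (simp add: \<phi>_def)
  then show "frob_norm (rel_log Y X \<tau>) \<le> frob_norm Y" using frob_norm_nonneg by (rule power2_le_imp_le)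
qed

section \<open>Projection onto a secant constraint\<close>

lemma SPD1D: "P \<in> SPD1 d \<Longrightarrow> P \<in> SPD d" "P \<in> SPD1 d \<Longrightarrow> det P = 1"
  by (auto simp: SPD1_def)

lemma feasibleD: "P \<in> feasible d A B \<Longrightarrow> P \<in> SPD1 d" "P \<in> feasible d A B \<Longrightarrow> P \<in> SPD d"
  "P \<in> feasible d A B \<Longrightarrow> det P = 1" "P \<in> feasible d A B \<Longrightarrow> P * A = B"
  by (auto simp: feasible_def SPD1_def)

lemma spec_fixes_iff:
  assumes V: "orth d V" and F: "F \<in> carrier_mat d m"
  shows "spec V f * F = F \<longleftrightarrow> (\<forall>k<d. \<forall>j<m. f k * (V\<^sup>T * F) $$ (k, j) = (V\<^sup>T * F) $$ (k, j))"
proof -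
  note [simp] = orthD(2,3)[OF V] carrier_matD[OF F]
  have c: "V\<^sup>T * F \<in> carrier_mat d m" by (intro carrier_matI) auto
  have "spec V f * F = F \<longleftrightarrow> mat_diag d f * (V\<^sup>T * F) = V\<^sup>T * F"
  proof
    assume "spec V f * F = F"
    then have "V\<^sup>T * (spec V f * F) = V\<^sup>T * F" by simp
    then show "mat_diag d f * (V\<^sup>T * F) = V\<^sup>T * F"
      by (simp add: spec_def mm_assoc orth_cancel[OF V])
  next
    assume "mat_diag d f * (V\<^sup>T * F) = V\<^sup>T * F"
    then have "V * (mat_diag d f * (V\<^sup>T * F)) = V * (V\<^sup>T * F)" by simp
    then show "spec V f * F = F" by (simp add: spec_def mm_assoc orth_cancel[OF V])
  qed
  also have "\<dots> \<longleftrightarrow> (\<forall>k<d. \<forall>j<m. f k * (V\<^sup>T * F) $$ (k, j) = (V\<^sup>T * F) $$ (k, j))"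
    unfolding mat_diag_mult_left[OF c] by (auto simp: mat_eq_iff simp del: index_mult_mat(1))
  finally show ?thesis .
qed

text \<open>Feasible sets are totally geodesic: seen from a feasible \<open>P\<close>, feasibility of \<open>P\<^sup>1\<^sup>/\<^sup>2 exp(X) P\<^sup>1\<^sup>/\<^sup>2\<close>
  says that \<open>exp X\<close> fixes the columns of \<open>P\<^sup>1\<^sup>/\<^sup>2 A\<close> and has determinant one, and both conditions are
  stable under real powers.\<close>

lemma feasible_geodesic:
  assumes P: "P \<in> feasible d A B" and A: "A \<in> carrier_mat d m" and X: "X \<in> Sym d"
    and Q: "mat_sqrt P * mat_exp X * mat_sqrt P \<in> feasible d A B"
  shows "mat_sqrt P * mat_exp (t \<cdot>\<^sub>m X) * mat_sqrt P \<in> feasible d A B"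
proof -
  define S H where "S = mat_sqrt P" and "H = minv (mat_sqrt P)"
  note half = half_power[OF feasibleD(2)[OF P], folded S_def H_def]
  note S = half(1,2) and H = half(3,4)
  obtain V x where V: "orth d V" "X = spec V x" using Sym_spec_obtain[OF X] .
  note [simp] = SPDD[OF S(1)] SPDD[OF H(1)] orthD(2,3)[OF V(1)] carrier_matD[OF A]
  note canc = mm_cancel[OF H(2)]
  have ex: "mat_exp (u \<cdot>\<^sub>m X) = spec V (\<lambda>k. exp (u * x k))" for u
    by (simp add: V(2) spec_smult mat_exp_spec[OF V(1)])
  have ex1: "mat_exp X = spec V (\<lambda>k. exp (x k))" by (simp add: V(2) mat_exp_spec[OF V(1)])
  have SA: "S * A \<in> carrier_mat d m" by (intro carrier_matI) auto
  have feas: "S * E * S * A = B \<longleftrightarrow> E * (S * A) = S * A" if E: "dim_row E = d" "dim_col E = d" for E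
  proof -
    have B: "B = S * (S * A)" using feasibleD(4)[OF P] by (simp add: mm_assoc flip: S(2))
    show ?thesis
    proof
      assume "S * E * S * A = B"
      then have "H * (S * E * S * A) = H * (S * (S * A))" using B by simp
      then show "E * (S * A) = S * A" using E by (simp add: mm_assoc canc)
    next
      assume "E * (S * A) = S * A"
      then show "S * E * S * A = B" using E B by (simp add: mm_assoc)
    qed
  qed
  have det: "det (S * mat_exp (u \<cdot>\<^sub>m X) * S) = exp (u * mat_tr X)" for u
    using SPD_carrier[OF mat_exp_SPD[OF Sym_smult[OF X, of u]]]
    by (simp add: det_sandwich(1)[OF SPD_carrier[OF S(1)]] half(7) feasibleD(3)[OF P]
        mat_exp_det[OF Sym_smult[OF X]])
      (simp add: V(2) spec_smult spec_tr[OF V(1)] sum_distrib_left)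
  have one: "1 \<cdot>\<^sub>m X = X" by (rule eq_matI) auto
  have "exp (mat_tr X) = 1" using det[of 1] feasibleD(3)[OF Q] one by (simp add: S_def)
  then have d1: "det (S * mat_exp (t \<cdot>\<^sub>m X) * S) = 1" by (simp add: det)
  have "spec V (\<lambda>k. exp (x k)) * (S * A) = S * A"
    using feasibleD(4)[OF Q] feas[of "mat_exp X"] unfolding S_def[symmetric] ex1 by simp
  then have "exp (x k) * (V\<^sup>T * (S * A)) $$ (k, j) = (V\<^sup>T * (S * A)) $$ (k, j)" if "k < d" "j < m" for k j
    using that unfolding spec_fixes_iff[OF V(1) SA] by blast
  then have "x k = 0 \<or> (V\<^sup>T * (S * A)) $$ (k, j) = 0" if "k < d" "j < m" for k j
    using that by (metis exp_eq_one_iff mult_cancel_right1)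
  then have "spec V (\<lambda>k. exp (t * x k)) * (S * A) = S * A"
    unfolding spec_fixes_iff[OF V(1) SA] by fastforce
  then have "S * mat_exp (t \<cdot>\<^sub>m X) * S * A = B" unfolding ex by (subst feas) auto
  moreover have "S * mat_exp (t \<cdot>\<^sub>m X) * S \<in> SPD d"
    using d_AI_exp_coordinates(1)[OF feasibleD(2)[OF P] Sym_smult[OF X]] by (simp add: S_def)
  ultimately show ?thesis using d1 by (simp add: feasible_def SPD1_def S_def)
qed

text \<open>Move the minimizer to the identity by a congruence. Along the geodesic to another feasible point
  the squared distance to the reference is stationary at the minimizer, so the quadratic lower bound
  has no linear term.\<close>

theorem projection_Pythagoras:
  assumes R: "R \<in> SPD d" and A: "A \<in> carrier_mat d m" and P: "P \<in> feasible d A B"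
    and min: "\<And>X. X \<in> feasible d A B \<Longrightarrow> d_AI R P \<le> d_AI R X" and Q: "Q \<in> feasible d A B"
  shows "(d_AI R P)\<^sup>2 + (d_AI P Q)\<^sup>2 \<le> (d_AI R Q)\<^sup>2"
proof -
  define S where "S = mat_sqrt P"
  have PS: "P \<in> SPD d" using feasibleD(2)[OF P] .
  note S = half_power(1,2)[OF PS, folded S_def]
  obtain X where X: "X \<in> Sym d" "Q = S * mat_exp X * S"
    using exp_coordinates_obtain[OF PS feasibleD(2)[OF Q]] unfolding S_def by metis
  obtain Y where Y: "Y \<in> Sym d" "R = S * mat_exp Y * S"
    using exp_coordinates_obtain[OF PS R] unfolding S_def by metis
  note [simp] = SPDD[OF S(1)]
  have dist: "d_AI R (S * mat_exp (t \<cdot>\<^sub>m X) * S) = frob_norm (rel_log Y X t)" for t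
    unfolding Y(2) S_def by (rule d_AI_frame[OF PS Y(1) X(1)])
  have one: "1 \<cdot>\<^sub>m X = X" by (rule eq_matI) auto
  have dQ: "d_AI R Q = frob_norm (rel_log Y X 1)" using dist[of 1] by (simp add: X(2) one)
  have P0: "S * mat_exp (0 \<cdot>\<^sub>m X) * S = P" by (simp add: mat_exp_zero[OF X(1)] mm_one_right S(2))
  have dP: "d_AI R P = frob_norm (rel_log Y X 0)" using dist[of 0] P0 by simp
  have dPQ: "d_AI P Q = frob_norm X"
    using d_AI_exp_coordinates(2)[OF PS X(1)] by (simp add: X(2) S_def)
  have "ip Y X = 0"
  proof -
    have "(frob_norm (rel_log Y X 0))\<^sup>2 / 2 \<le> (frob_norm (rel_log Y X t))\<^sup>2 / 2" for t
    proof -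
      have "S * mat_exp (t \<cdot>\<^sub>m X) * S \<in> feasible d A B"
        using feasible_geodesic[OF P A X(1)] Q unfolding X(2) S_def by blast
      from min[OF this] have "frob_norm (rel_log Y X 0) \<le> frob_norm (rel_log Y X t)" by (simp add: dP dist)
      then show ?thesis using frob_norm_nonneg by (simp add: power_mono)
    qed
    then have "- ip (rel_log Y X 0) X = 0"
      using DERIV_local_min[OF half_square_has_derivative[OF Y(1) X(1), of 0], of 1] by simp
    then show ?thesis by (simp add: rel_log_0[OF Y(1) X(1)])
  qed
  then show ?thesis
    using half_square_lower_bound[OF Y(1) X(1), of 1]
    unfolding dQ dP dPQ rel_log_0[OF Y(1) X(1)] by (simp add: frob_norm_ip[of X])
qed

corollary projection_unique:
  assumes R: "R \<in> SPD d" and A: "A \<in> carrier_mat d m"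
    and P: "P \<in> feasible d A B" "\<And>X. X \<in> feasible d A B \<Longrightarrow> d_AI R P \<le> d_AI R X"
    and Q: "Q \<in> feasible d A B" "\<And>X. X \<in> feasible d A B \<Longrightarrow> d_AI R Q \<le> d_AI R X"
  shows "Q = P"
proof -
  have "(d_AI R Q)\<^sup>2 \<le> (d_AI R P)\<^sup>2" using Q(2)[OF P(1)] d_AI_nonneg by (simp add: power_mono)
  then have "(d_AI P Q)\<^sup>2 \<le> 0" using projection_Pythagoras[OF R A P Q(1)] by linarith
  then have "d_AI P Q = 0" by simp
  then show ?thesis using d_AI_eq_0 feasibleD(2) P(1) Q(1) by blast
qed

lemma bounded_family_convergent_subsequence:
  fixes x :: "nat \<Rightarrow> 'i \<Rightarrow> real"
  assumes "finite I" "\<And>n i. i \<in> I \<Longrightarrow> \<bar>x n i\<bar> \<le> M"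
  shows "\<exists>r :: nat \<Rightarrow> nat. strict_mono r \<and> (\<forall>i\<in>I. convergent (\<lambda>n. x (r n) i))"
  using assms
proof (induction I rule: finite_induct)
  case empty
  then show ?case by (intro exI[of _ id]) (auto simp: strict_mono_def)
next
  case (insert j I)
  then obtain r :: "nat \<Rightarrow> nat" where r: "strict_mono r" "\<forall>i\<in>I. convergent (\<lambda>n. x (r n) i)" by auto
  obtain r' :: "nat \<Rightarrow> nat" where r': "strict_mono r'" "monoseq (\<lambda>n. x (r (r' n)) j)"
    using seq_monosub[of "\<lambda>n. x (r n) j"] by auto
  have "Bseq (\<lambda>n. x (r (r' n)) j)" by (rule BseqI'[of _ M]) (simp add: insert.prems)
  then have "convergent (\<lambda>n. x (r (r' n)) j)" using r'(2) by (rule Bseq_monoseq_convergent)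
  moreover have "convergent (\<lambda>n. x (r (r' n)) i)" if "i \<in> I" for i
    using convergent_subseq_convergent[OF _ r'(1), of "\<lambda>n. x (r n) i"] r(2) that by (simp add: o_def)
  moreover have "strict_mono (r \<circ> r')" using r(1) r'(1) by (rule strict_mono_o)
  ultimately show ?case by (intro exI[of _ "r \<circ> r'"]) (auto simp del: o_apply simp add: o_def[of r r'])
qed

text \<open>A minimizing sequence is \<open>R\<^sup>1\<^sup>/\<^sup>2 U\<^sub>n exp(f\<^sub>n) U\<^sub>n\<^sup>T R\<^sup>1\<^sup>/\<^sup>2\<close> with \<open>U\<^sub>n\<close> orthogonal and the eigenvalue vectors
  \<open>f\<^sub>n\<close> bounded by the distance, so a subsequence of both converges and the limit is feasible.\<close>

theorem projection_exists:
  assumes R: "R \<in> SPD d" and A: "A \<in> carrier_mat d m" and ne: "feasible d A B \<noteq> {}"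
  shows "\<exists>P. P \<in> feasible d A B \<and> (\<forall>X\<in>feasible d A B. d_AI R P \<le> d_AI R X)"
proof -
  define S H where "S = mat_sqrt R" and "H = minv (mat_sqrt R)"
  note half = half_power[OF R, folded S_def H_def]
  note S = half(1,2) and H = half(3-5)
  note [simp] = SPDD[OF S(1)] SPDD[OF H(1)] carrier_matD[OF A]
  note canc = mm_cancel[OF H(2)] mm_cancel[OF H(3)]
  define I where "I = Inf (d_AI R ` feasible d A B)"
  have bdd: "bdd_below (d_AI R ` feasible d A B)" by (intro bdd_belowI[of _ 0]) (auto simp: d_AI_nonneg)
  have I: "I \<le> d_AI R X" if "X \<in> feasible d A B" for X
    unfolding I_def using bdd that by (intro cInf_lower) auto
  have "\<exists>X\<in>feasible d A B. d_AI R X < I + 1 / real (Suc n)" for n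
    using cInf_lessD[of "d_AI R ` feasible d A B" "I + 1 / real (Suc n)"] ne by (auto simp: I_def)
  then obtain X where X: "X n \<in> feasible d A B" "d_AI R (X n) < I + 1 / real (Suc n)" for n by metis
  have "\<exists>U f. orth d U \<and> X n = S * spec U (\<lambda>k. exp (f k)) * S \<and> (d_AI R (X n))\<^sup>2 = (\<Sum>k<d. (f k)\<^sup>2)" for n
  proof -
    obtain Y where Y: "Y \<in> Sym d" "X n = S * mat_exp Y * S"
      using exp_coordinates_obtain[OF R feasibleD(2)[OF X(1)]] unfolding S_def by metis
    obtain U f where U: "orth d U" "Y = spec U f" using Sym_spec_obtain[OF Y(1)] .
    have "d_AI R (X n) = frob_norm Y" using d_AI_exp_coordinates(2)[OF R Y(1)] Y(2) S_def by simp
    then show ?thesis using U Y(2) by (auto simp: mat_exp_spec[OF U(1)] spec_frob_norm[OF U(1)])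
  qed
  then obtain U f where U: "orth d (U n)" and Xn: "X n = S * spec (U n) (\<lambda>k. exp (f n k)) * S"
      and dn: "(d_AI R (X n))\<^sup>2 = (\<Sum>k<d. (f n k)\<^sup>2)" for n by metis
  note [simp] = orthD(2,3)[OF U]
  have f_bd: "\<bar>f n k\<bar> \<le> I + 1" if "k \<in> {..<d}" for n k
  proof -
    have "(f n k)\<^sup>2 \<le> (\<Sum>k<d. (f n k)\<^sup>2)" using that by (intro member_le_sum) auto
    then have "\<bar>f n k\<bar>\<^sup>2 \<le> (d_AI R (X n))\<^sup>2" by (simp add: dn)
    then have "\<bar>f n k\<bar> \<le> d_AI R (X n)" using d_AI_nonneg by (rule power2_le_imp_le)
    moreover have "1 / real (Suc n) \<le> 1" by simp
    ultimately show ?thesis using X(2)[of n] by linarith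
  qed
  have U_bd: "\<bar>U n $$ p\<bar> \<le> 1" if pI: "p \<in> {..<d} \<times> {..<d}" for n p
  proof -
    obtain i j where p: "p = (i, j)" "i < d" "j < d" using pI by (cases p) auto
    have "(U n $$ (i, j))\<^sup>2 \<le> (\<Sum>i<d. (U n $$ (i, j))\<^sup>2)" using p by (intro member_le_sum) auto
    also have "\<dots> = ((U n)\<^sup>T * U n) $$ (j, j)"
      using p by (subst mat_index_mult) (auto simp: power2_eq_square)
    also have "\<dots> = 1" using p by (simp add: orthD(4)[OF U])
    finally have "\<bar>U n $$ p\<bar>\<^sup>2 \<le> 1\<^sup>2" using p by simp
    then show ?thesis by (rule power2_le_imp_le) simp
  qed
  obtain r :: "nat \<Rightarrow> nat" where r: "strict_mono r" "\<forall>k\<in>{..<d}. convergent (\<lambda>n. f (r n) k)"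
    using bounded_family_convergent_subsequence[of "{..<d}" f "I + 1"] f_bd by auto
  obtain r' :: "nat \<Rightarrow> nat" where r': "strict_mono r'"
      "\<forall>p\<in>{..<d} \<times> {..<d}. convergent (\<lambda>n. U (r (r' n)) $$ p)"
    using bounded_family_convergent_subsequence[of "{..<d} \<times> {..<d}" "\<lambda>n p. U (r n) $$ p" 1] U_bd by auto
  define q where "q n = r (r' n)" for n
  have q: "strict_mono q" using strict_mono_o[OF r(1) r'(1)] by (simp add: q_def[abs_def] o_def)
  define g where "g k = lim (\<lambda>n. f (q n) k)" for k
  define W where "W = mat d d (\<lambda>p. lim (\<lambda>n. U (q n) $$ p))"
  have glim: "(\<lambda>n. f (q n) k) \<longlonglongrightarrow> g k" if "k < d" for k
    using convergent_subseq_convergent[OF _ r'(1), of "\<lambda>n. f (r n) k"] r(2) that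
    by (auto simp: g_def q_def o_def convergent_LIMSEQ_iff)
  have Wlim: "(\<lambda>n. U (q n) $$ (i, j)) \<longlonglongrightarrow> W $$ (i, j)" if "i < d" "j < d" for i j
    using r'(2) that by (auto simp: W_def q_def convergent_LIMSEQ_iff)
  have Wc: "W \<in> carrier_mat d d" by (simp add: W_def)
  have W: "orth d W"
    unfolding orth_def
  proof (intro conjI Wc eq_matI)
    fix i j assume "i < dim_row (1\<^sub>m d :: real mat)" "j < dim_col (1\<^sub>m d :: real mat)"
    then have ij: "i < d" "j < d" by auto
    have e: "(V\<^sup>T * V) $$ (i, j) = (\<Sum>k<d. V $$ (k, i) * V $$ (k, j))" if "V \<in> carrier_mat d d" for V :: "real mat"
      using that ij by (subst mat_index_mult) auto
    have "(\<lambda>n. ((U (q n))\<^sup>T * U (q n)) $$ (i, j)) \<longlonglongrightarrow> (W\<^sup>T * W) $$ (i, j)"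
      unfolding e[OF Wc] e[OF orthD(1)[OF U]] using ij by (intro tendsto_sum tendsto_mult Wlim) auto
    then have "(\<lambda>n. 1\<^sub>m d $$ (i, j)) \<longlonglongrightarrow> (W\<^sup>T * W) $$ (i, j)" by (simp add: orthD(4)[OF U])
    then show "(W\<^sup>T * W) $$ (i, j) = 1\<^sub>m d $$ (i, j)" by (rule LIMSEQ_unique) simp
  qed (use Wc in auto)
  note [simp] = orthD(2,3)[OF W]
  define E where "E n = spec (U (q n)) (\<lambda>k. exp (f (q n) k))" for n
  define F where "F = spec W (\<lambda>k. exp (g k))"
  have Elim: "(\<lambda>n. E n $$ (i, j)) \<longlonglongrightarrow> F $$ (i, j)" if "i < d" "j < d" for i j
    unfolding E_def F_def using that
    by (simp add: spec_index) (intro tendsto_sum tendsto_mult tendsto_exp Wlim glim; simp)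
  define P where "P = S * F * S"
  have FS: "F \<in> SPD d" unfolding F_def by (rule SPD_spec_exp[OF W])
  have Pcoord: "P = mat_sqrt R * mat_exp (spec W g) * mat_sqrt R"
    by (simp add: P_def F_def mat_exp_spec[OF W] S_def)
  have PS: "P \<in> SPD d" unfolding Pcoord by (rule d_AI_exp_coordinates(1)[OF R Sym_spec[OF W]])
  have "P * A = B"
  proof -
    have EA: "E n * (S * A) = H * B" for n
    proof -
      have "S * (E n * (S * A)) = B"
        using feasibleD(4)[OF X(1)[of "q n"]] unfolding Xn E_def by (simp add: mm_assoc)
      then have "H * (S * (E n * (S * A))) = H * B" by simp
      then show ?thesis by (simp add: E_def canc)
    qed
    have dB: "dim_row B = d" "dim_col B = m" using feasibleD(4)[OF X(1)[of 0]] SPDD[OF feasibleD(2)[OF X(1)[of 0]]] by auto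
    have "F * (S * A) = H * B"
    proof (rule eq_matI)
      fix i j assume "i < dim_row (H * B)" "j < dim_col (H * B)"
      then have ij: "i < d" "j < m" using dB by auto
      have "(\<lambda>n. (E n * (S * A)) $$ (i, j)) \<longlonglongrightarrow> (F * (S * A)) $$ (i, j)"
      proof -
        have dE: "dim_row (E n) = d" "dim_col (E n) = d" for n by (simp_all add: E_def)
        have "(G * (S * A)) $$ (i, j) = (\<Sum>k<d. G $$ (i, k) * (S * A) $$ (k, j))"
          if "dim_row G = d" "dim_col G = d" for G
          using ij that by (subst mat_index_mult) auto
        note this[OF dE] this[OF SPDD(1)[OF FS] SPDD(2)[OF FS]]
        then show ?thesis
          using ij by (simp only:) (intro tendsto_sum tendsto_mult tendsto_const Elim; simp)
      qed
      then have "(\<lambda>n. (H * B) $$ (i, j)) \<longlonglongrightarrow> (F * (S * A)) $$ (i, j)" by (simp only: EA)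
      then show "(F * (S * A)) $$ (i, j) = (H * B) $$ (i, j)" by (rule LIMSEQ_unique) simp
    qed (use dB SPDD[OF FS] in auto)
    then have "S * (F * (S * A)) = B" using dB by (simp add: canc)
    then show ?thesis using SPDD[OF FS] by (simp add: P_def mm_assoc)
  qed
  moreover have "det P = 1"
  proof -
    have dt: "det (S * spec V h * S) = det S * det S * (\<Prod>k<d. h k)" if "orth d V" for V h
      by (simp add: det_sandwich(1)[OF SPD_carrier[OF S(1)] spec_carrier[OF that]] spec_det[OF that])
    have "(\<lambda>n. det (X (q n))) \<longlonglongrightarrow> det P"
      unfolding Xn P_def F_def dt[OF U] dt[OF W]
      by (intro tendsto_mult tendsto_const tendsto_prod tendsto_exp glim) auto
    then have "(\<lambda>n. 1) \<longlonglongrightarrow> det P" by (simp add: feasibleD(3)[OF X(1)])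
    then show ?thesis using LIMSEQ_unique tendsto_const by blast
  qed
  ultimately have Pf: "P \<in> feasible d A B" using PS by (simp add: feasible_def SPD1_def)
  have "(d_AI R P)\<^sup>2 = (\<Sum>k<d. (g k)\<^sup>2)"
    unfolding Pcoord d_AI_exp_coordinates(2)[OF R Sym_spec[OF W]] by (rule spec_frob_norm[OF W])
  moreover have "(\<lambda>n. \<Sum>k<d. (f (q n) k)\<^sup>2) \<longlonglongrightarrow> (\<Sum>k<d. (g k)\<^sup>2)"
    by (intro tendsto_sum tendsto_power glim) auto
  ultimately have l1: "(\<lambda>n. (d_AI R (X (q n)))\<^sup>2) \<longlonglongrightarrow> (d_AI R P)\<^sup>2" by (simp add: dn)
  have "(\<lambda>n. I + 1 * inverse (real (Suc n))) \<longlonglongrightarrow> I + 1 * 0"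
    by (intro tendsto_intros LIMSEQ_inverse_real_of_nat)
  then have up: "(\<lambda>n. I + 1 / real (Suc n)) \<longlonglongrightarrow> I" by (simp add: divide_inverse del: of_nat_Suc)
  have "\<forall>\<^sub>F n in sequentially. I \<le> d_AI R (X n)"
    by (rule always_eventually) (rule allI, rule I, rule X(1))
  moreover have "\<forall>\<^sub>F n in sequentially. d_AI R (X n) \<le> I + 1 / real (Suc n)"
    by (rule always_eventually) (rule allI, rule less_imp_le, rule X(2))
  ultimately have "(\<lambda>n. d_AI R (X n)) \<longlonglongrightarrow> I"
    by (rule tendsto_sandwich[OF _ _ tendsto_const up])
  then have "(\<lambda>n. (d_AI R (X (q n)))\<^sup>2) \<longlonglongrightarrow> I\<^sup>2"
    using LIMSEQ_subseq_LIMSEQ[OF _ q, of "\<lambda>n. d_AI R (X n)" I] by (intro tendsto_power) (simp add: o_def)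
  with l1 have "(d_AI R P)\<^sup>2 = I\<^sup>2" using LIMSEQ_unique by blast
  moreover have "0 \<le> I"
    unfolding I_def using ne by (intro cInf_greatest) (auto simp: d_AI_nonneg)
  ultimately have "d_AI R P = I" using d_AI_nonneg by (simp add: power2_eq_iff_nonneg)
  then show ?thesis using Pf I by auto
qed

section \<open>Block diagonal positive definite matrices\<close>

lemma bdiag_Sym: "X \<in> Sym m \<Longrightarrow> Z \<in> Sym n \<Longrightarrow> bdiag X Z \<in> Sym (m + n)"
  by (simp add: Sym_def bdiag_transpose bdiag_carrier)

lemma bdiag_spec_exp:
  assumes "orth m U" "orth n W"
  shows "bdiag (spec U (\<lambda>i. exp (f i))) (spec W (\<lambda>i. exp (g i))) =
    spec (bdiag U W) (\<lambda>i. exp (if i < m then f i else g (i - m)))"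
  unfolding spec_bdiag[OF assms] by (rule spec_cong) simp

lemma bdiag_SPD:
  assumes "P \<in> SPD m" "R \<in> SPD n"
  shows "bdiag P R \<in> SPD (m + n)"
proof -
  obtain U f where U: "orth m U" "P = spec U (\<lambda>i. exp (f i))" using SPD_spec_obtain[OF assms(1)] .
  obtain W g where W: "orth n W" "R = spec W (\<lambda>i. exp (g i))" using SPD_spec_obtain[OF assms(2)] .
  show ?thesis unfolding U(2) W(2) bdiag_spec_exp[OF U(1) W(1)]
    by (rule SPD_spec_exp[OF orth_bdiag[OF U(1) W(1)]])
qed

lemma bdiag_sqrt:
  assumes "P \<in> SPD m" "R \<in> SPD n"
  shows "mat_sqrt (bdiag P R) = bdiag (mat_sqrt P) (mat_sqrt R)"
proof -
  obtain U f where U: "orth m U" "P = spec U (\<lambda>i. exp (f i))" using SPD_spec_obtain[OF assms(1)] .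
  obtain W g where W: "orth n W" "R = spec W (\<lambda>i. exp (g i))" using SPD_spec_obtain[OF assms(2)] .
  show ?thesis
    unfolding U(2) W(2) bdiag_spec_exp[OF U(1) W(1)] mat_sqrt_spec[OF orth_bdiag[OF U(1) W(1)]]
      mat_sqrt_spec[OF U(1)] mat_sqrt_spec[OF W(1)] by (rule spec_cong) simp
qed

lemma bdiag_exp:
  assumes "X \<in> Sym m" "Z \<in> Sym n"
  shows "mat_exp (bdiag X Z) = bdiag (mat_exp X) (mat_exp Z)"
proof -
  obtain U f where U: "orth m U" "X = spec U f" using Sym_spec_obtain[OF assms(1)] .
  obtain W g where W: "orth n W" "Z = spec W g" using Sym_spec_obtain[OF assms(2)] .
  show ?thesis
    unfolding U(2) W(2) spec_bdiag[OF U(1) W(1)] mat_exp_spec[OF orth_bdiag[OF U(1) W(1)]]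
      mat_exp_spec[OF U(1)] mat_exp_spec[OF W(1)] bdiag_spec_exp[OF U(1) W(1)]
    by (rule spec_cong) simp
qed

lemma smult_SPD: "P \<in> SPD n \<Longrightarrow> 0 < k \<Longrightarrow> k \<cdot>\<^sub>m P \<in> SPD n"
  by (elim SPD_spec_obtain) (simp add: spec_smult SPD_spec)

lemma smult_sqrt:
  assumes "P \<in> SPD n" "0 < k"
  shows "mat_sqrt (k \<cdot>\<^sub>m P) = sqrt k \<cdot>\<^sub>m mat_sqrt P"
proof -
  obtain U f where U: "orth n U" "P = spec U (\<lambda>i. exp (f i))" using SPD_spec_obtain[OF assms(1)] .
  have "k \<cdot>\<^sub>m P = spec U (\<lambda>i. exp (ln k + f i))"
    unfolding U(2) spec_smult using assms(2) by (simp add: exp_add)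
  moreover have "exp (ln k / 2) = sqrt k"
  proof -
    have "ln k / 2 = ln (sqrt k)" using assms(2) by (simp add: ln_sqrt)
    then show ?thesis using assms(2) by (simp only: exp_ln real_sqrt_gt_zero)
  qed
  then have "exp ((ln k + x) / 2) = sqrt k * exp (x / 2)" for x
    by (simp add: add_divide_distrib exp_add)
  ultimately show ?thesis by (simp add: mat_sqrt_spec[OF U(1)] U(2) spec_smult)
qed

lemma det_bdiag:
  assumes "P \<in> carrier_mat m m" "R \<in> carrier_mat n n"
  shows "det (bdiag P R) = det P * det R"
  unfolding bdiag_def using assms
  by (intro det_four_block_mat_upper_right_zero[of _ m _ n]) auto

lemma mult_mat_zero_vec: "dim_col A = k \<Longrightarrow> A *\<^sub>v 0\<^sub>v k = (0\<^sub>v (dim_row A) :: real vec)"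
  by (rule eq_vecI) (auto simp: scalar_prod_def)

section \<open>Parametrization of a secant constraint by hidden blocks\<close>

definition vcat :: "real mat \<Rightarrow> real mat \<Rightarrow> real mat" where
  "vcat X Z = four_block_mat X (0\<^sub>m (dim_row X) 0) Z (0\<^sub>m (dim_row Z) 0)"

lemma vcat_dims [simp]: "dim_row (vcat X Z) = dim_row X + dim_row Z" "dim_col (vcat X Z) = dim_col X"
  by (auto simp: vcat_def)

lemma vcat_index:
  "i < dim_row X + dim_row Z \<Longrightarrow> j < dim_col X \<Longrightarrow>
     vcat X Z $$ (i, j) = (if i < dim_row X then X $$ (i, j) else Z $$ (i - dim_row X, j))"
  by (auto simp: vcat_def)

lemma four_block_mult_vcat:
  assumes "dim_row Q = dim_row P" "dim_col R = dim_col P" "dim_row S = dim_row R"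
    and "dim_col S = dim_col Q" "dim_row X = dim_col P" "dim_row Z = dim_col Q" "dim_col Z = dim_col X"
  shows "four_block_mat P Q R S * vcat X Z = vcat (P * X + Q * Z) (R * X + S * Z)"
proof -
  let ?a = "dim_row P" and ?b = "dim_col P" and ?c = "dim_col Q" and ?e = "dim_row R"
  have c: "P \<in> carrier_mat ?a ?b" "Q \<in> carrier_mat ?a ?c" "R \<in> carrier_mat ?e ?b" "S \<in> carrier_mat ?e ?c"
    "X \<in> carrier_mat ?b (dim_col X)" "0\<^sub>m ?b 0 \<in> carrier_mat ?b 0"
    "Z \<in> carrier_mat ?c (dim_col X)" "0\<^sub>m ?c 0 \<in> carrier_mat ?c 0"
    by (rule carrier_matI; simp only: assms index_zero_mat)+
  have "four_block_mat P Q R S * vcat X Z = four_block_mat (P * X + Q * Z) (P * 0\<^sub>m ?b 0 + Q * 0\<^sub>m ?c 0)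
      (R * X + S * Z) (R * 0\<^sub>m ?b 0 + S * 0\<^sub>m ?c 0)"
    unfolding vcat_def assms(6) assms(5) using mult_four_block_mat[OF c] by (simp only: assms(5,6))
  moreover have "P * 0\<^sub>m ?b 0 + Q * 0\<^sub>m ?c 0 = 0\<^sub>m (dim_row (P * X + Q * Z)) 0"
    by (rule eq_matI) (simp_all add: assms)
  moreover have "R * 0\<^sub>m ?b 0 + S * 0\<^sub>m ?c 0 = 0\<^sub>m (dim_row (R * X + S * Z)) 0"
    by (rule eq_matI) (simp_all add: assms)
  ultimately show ?thesis by (simp only: vcat_def)
qed

lemma vcat_mult:
  assumes "dim_col X = dim_row Y" "dim_col Z = dim_row Y"
  shows "vcat X Z * Y = vcat (X * Y) (Z * Y)"
proof (rule eq_matI)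
  fix i j assume ij: "i < dim_row (vcat (X * Y) (Z * Y))" "j < dim_col (vcat (X * Y) (Z * Y))"
  then show "(vcat X Z * Y) $$ (i, j) = vcat (X * Y) (Z * Y) $$ (i, j)"
    using assms by (subst mat_index_mult) (auto simp: vcat_index mat_index_mult simp del: index_mult_mat(1))
qed (use assms in auto)

text \<open>Block coordinates: \<open>A = U C\<close> with \<open>[U, V]\<close> orthogonal. In them \<open>P A = B\<close> prescribes the first block column \<open>(M, N)\<close> of \<open>[U, V]\<^sup>T P [U, V]\<close>, and what is left free is the Schur
  complement of \<open>M\<close>, of prescribed determinant.\<close>

locale secant =
  fixes m n :: nat and A B U V C :: "real mat"
  assumes n: "0 < n"
    and A: "A \<in> carrier_mat (m + n) m" and B: "B \<in> carrier_mat (m + n) m"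
    and AB: "A\<^sup>T * B \<in> SPD m"
    and fact: "orth_factorization A U V C"
begin

abbreviation "d \<equiv> m + n"
abbreviation "Q \<equiv> hcat U V"
abbreviation "M \<equiv> res_M A B C"
abbreviation "T \<equiv> res_T A B V C"
abbreviation "L \<equiv> res_L A B V C"
abbreviation "QS \<equiv> res_Q A B V C"
abbreviation "\<Phi> \<equiv> controller A B U V C"
abbreviation "R0 \<equiv> res_R0 A B V C"

text \<open>The factor \<open>\<rho>\<close> gives \<open>QS \<Sigma>\<close> the determinant of \<open>\<Sigma>\<close>. Multiplication by \<open>J\<close> selects the first
  block column, which is where the constraint lives.\<close>

definition Ci where "Ci = minv C"
definition N where "N = V\<^sup>T * B * Ci"
definition \<rho> where "\<rho> = det M powr (- (1 / real n))"
definition J where "J = vcat (1\<^sub>m m) (0\<^sub>m n m)"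

lemma dims:
  "U \<in> carrier_mat d m" "V \<in> carrier_mat d n" "C \<in> carrier_mat m m" "A = U * C" "U\<^sup>T * U = 1\<^sub>m m"
  "Q\<^sup>T * Q = 1\<^sub>m d" "invertible_mat C"
  using fact A by (auto simp: orth_factorization_def Let_def)

lemma dims' [simp]: "dim_row U = d" "dim_col U = m" "dim_row V = d" "dim_col V = n"
  "dim_row C = m" "dim_col C = m" "dim_row A = d" "dim_col A = m" "dim_row B = d" "dim_col B = m"
  using dims A B by auto

lemma Q_orth: "orth d Q"
proof -
  have "Q \<in> carrier_mat (d + 0) (m + n)"
    unfolding hcat_def using dims(1,2) by (intro four_block_carrier_mat) auto
  then show ?thesis using dims(6) by (simp add: orth_def)
qed

lemma Q_dims [simp]: "dim_row Q = d" "dim_col Q = d"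
  using orthD[OF Q_orth] by auto

lemma Ci: "Ci \<in> carrier_mat m m" "Ci * C = 1\<^sub>m m" "C * Ci = 1\<^sub>m m"
proof -
  obtain D where D: "C * D = 1\<^sub>m m" "D * C = 1\<^sub>m (dim_row D)"
    using dims(3,7) by (auto simp: invertible_mat_def inverts_mat_def)
  have "dim_col D = m" using arg_cong[OF D(1), of dim_col] by simp
  moreover have "dim_row D = m" using arg_cong[OF D(2), of dim_col] by simp
  ultimately have Dc: "D \<in> carrier_mat m m" by (intro carrier_matI)
  have "Ci = D" unfolding Ci_def using D(2) \<open>dim_row D = m\<close> by (intro minv_unique[OF dims(3) Dc]) simp
  then show "Ci \<in> carrier_mat m m" "Ci * C = 1\<^sub>m m" "C * Ci = 1\<^sub>m m"
    using Dc D \<open>dim_row D = m\<close> by auto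
qed

lemma Ci_dims [simp]: "dim_row Ci = m" "dim_col Ci = m"
  using Ci(1) by auto

lemma M_SPD: "M \<in> SPD m"
proof -
  have "v = 0\<^sub>v m" if v: "v \<in> carrier_vec m" "Ci *\<^sub>v v = 0\<^sub>v m" for v
  proof -
    have "C *\<^sub>v (Ci *\<^sub>v v) = (C * Ci) *\<^sub>v v" using v by (intro mm_vec[symmetric]) auto
    then show ?thesis using v Ci(3) by (simp add: mult_mat_zero_vec)
  qed
  then have "Ci\<^sup>T * (A\<^sup>T * B) * Ci \<in> SPD m" by (rule SPD_congruence[OF AB Ci(1)])
  then show ?thesis by (simp add: res_M_def Ci_def[symmetric] mm_assoc)
qed

lemma M_dims [simp]: "dim_row M = m" "dim_col M = m"
  using SPDD[OF M_SPD] by auto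

lemma M_eq: "M = U\<^sup>T * (B * Ci)"
proof -
  have "Ci\<^sup>T * (C\<^sup>T * Y) = Y" if "dim_row Y = m" for Y
    using arg_cong[OF Ci(3), of transpose_mat] that
    by (simp add: mm_transpose mm_assoc[symmetric] mm_one_left)
  then show ?thesis
    unfolding res_M_def Ci_def[symmetric] by (subst dims(4)) (simp add: mm_transpose mm_assoc)
qed

lemma N_dims [simp]: "dim_row N = n" "dim_col N = m"
  by (auto simp: N_def)

lemma T_eq: "T = N * minv M"
  by (simp add: res_T_def N_def Ci_def)

lemma T_dims [simp]: "dim_row T = n" "dim_col T = m"
  using SPDD[OF minv_SPD[OF M_SPD]] by (auto simp: T_eq)

lemma TM: "T * M = N"
  using SPDD[OF minv_SPD[OF M_SPD]] minv_SPD_mult(1)[OF M_SPD]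
  by (simp add: T_eq mm_assoc mm_one_right)

lemma \<rho>: "0 < \<rho>" "\<rho> ^ n * det M = 1"
proof -
  have dM: "det M > 0" by (rule SPD_det_pos[OF M_SPD])
  then show "0 < \<rho>" by (simp add: \<rho>_def)
  have "\<rho> ^ n = det M powr (- (1 / real n) * real n)"
    using dM by (simp add: \<rho>_def powr_powr flip: powr_realpow)
  also have "- (1 / real n) * real n = - 1" using n by simp
  finally show "\<rho> ^ n * det M = 1" using dM by (simp add: powr_minus)
qed

lemma QS_eq: "\<Sigma> \<in> SPD n \<Longrightarrow> QS \<Sigma> = bdiag M (\<rho> \<cdot>\<^sub>m \<Sigma>)"
  by (frule SPDD(1), frule SPDD(2)) (simp add: res_Q_def Let_def bdiag_def \<rho>_def)

lemma QS_SPD: "\<Sigma> \<in> SPD n \<Longrightarrow> QS \<Sigma> \<in> SPD d"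
  unfolding QS_eq using bdiag_SPD[OF M_SPD smult_SPD[OF _ \<rho>(1)]] .

lemma L_carrier: "L \<in> carrier_mat d d"
  unfolding res_L_def by (intro four_block_carrier_mat) auto

lemma L_dims [simp]: "dim_row L = d" "dim_col L = d"
  using L_carrier by auto

lemma L_det: "det L = 1"
proof -
  have "T \<in> carrier_mat n m" by (intro carrier_matI) auto
  then have "det L = det (1\<^sub>m m) * det (1\<^sub>m n :: real mat)"
    unfolding res_L_def dims' by (intro det_four_block_mat_upper_right_zero[of _ m _ n]) auto
  then show ?thesis by simp
qed

definition F where "F = Q * L"

lemma F_carrier: "F \<in> carrier_mat d d"
  unfolding F_def by (intro carrier_matI) auto

lemma F_dims [simp]: "dim_row F = d" "dim_col F = d"
  using F_carrier by auto

lemma F_det: "det F * det F = 1" "det F \<noteq> 0"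
proof -
  have "det F = det Q" unfolding F_def using det_mult[OF orthD(1)[OF Q_orth] L_carrier] by (simp add: L_det)
  then show "det F * det F = 1" using orth_det[OF Q_orth] by simp
  then show "det F \<noteq> 0" by auto
qed

lemma \<Phi>_eq: assumes "\<Sigma> \<in> SPD n" shows "\<Phi> \<Sigma> = F * QS \<Sigma> * F\<^sup>T"
  using SPDD(1,2)[OF QS_SPD[OF assms]] by (simp add: controller_def F_def mm_transpose mm_assoc)

lemma Q_transpose: "Q\<^sup>T = vcat U\<^sup>T V\<^sup>T"
proof -
  have "Q\<^sup>T = four_block_mat U\<^sup>T (0\<^sub>m 0 m)\<^sup>T V\<^sup>T (0\<^sub>m 0 n)\<^sup>T"
    unfolding hcat_def dims'
    by (rule transpose_four_block_mat[OF dims(1,2)]) (rule zero_carrier_mat)+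
  then show ?thesis by (simp add: vcat_def)
qed

lemma J_dims [simp]: "dim_row J = d" "dim_col J = m"
  by (auto simp: J_def)

lemma QJ: "Q * J = U"
proof -
  have a: "0\<^sub>m 0 n * 0\<^sub>m n m = (0\<^sub>m 0 m :: real mat)" "0\<^sub>m 0 m * 1\<^sub>m m = (0\<^sub>m 0 m :: real mat)"
    by (auto intro!: eq_matI)
  have "Q * J = vcat (U * 1\<^sub>m m + V * 0\<^sub>m n m) (0\<^sub>m 0 m * 1\<^sub>m m + 0\<^sub>m 0 n * 0\<^sub>m n m)"
    unfolding hcat_def J_def dims' by (rule four_block_mult_vcat) simp_all
  also have "U * 1\<^sub>m m + V * 0\<^sub>m n m = U"
    using dims(1,2) by (simp add: mm_one_right right_mult_zero_mat[of V d n] right_add_zero_mat[of U d m])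
  also have "vcat U (0\<^sub>m 0 m * 1\<^sub>m m + 0\<^sub>m 0 n * 0\<^sub>m n m) = U"
    by (rule eq_matI) (auto simp: vcat_index a)
  finally show ?thesis .
qed

lemma L_block_column:
  assumes "Z \<in> carrier_mat m m"
  shows "L * vcat Z (0\<^sub>m n m) = vcat Z (T * Z)"
proof -
  have "L * vcat Z (0\<^sub>m n m) = vcat (1\<^sub>m m * Z + 0\<^sub>m m n * 0\<^sub>m n m) (T * Z + 1\<^sub>m n * 0\<^sub>m n m)"
    unfolding res_L_def dims' by (rule four_block_mult_vcat) (use assms in simp_all)
  also have "1\<^sub>m m * Z + 0\<^sub>m m n * 0\<^sub>m n m = Z" using assms by (simp add: mm_one_left)
  also have "T * Z + 1\<^sub>m n * 0\<^sub>m n m = T * Z"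
    using assms by (intro eq_matI) auto
  finally show ?thesis .
qed

lemma LTJ: "L\<^sup>T * J = J"
proof -
  have Tc: "T \<in> carrier_mat n m" by (intro carrier_matI) auto
  have "L\<^sup>T = four_block_mat (1\<^sub>m m)\<^sup>T T\<^sup>T (0\<^sub>m m n)\<^sup>T (1\<^sub>m n)\<^sup>T"
    unfolding res_L_def dims'
    by (rule transpose_four_block_mat[OF one_carrier_mat zero_carrier_mat Tc one_carrier_mat])
  then have "L\<^sup>T * J = vcat (1\<^sub>m m * 1\<^sub>m m + T\<^sup>T * 0\<^sub>m n m) (0\<^sub>m n m * 1\<^sub>m m + 1\<^sub>m n * 0\<^sub>m n m)"
    unfolding J_def by (simp add: four_block_mult_vcat)
  also have "\<dots> = J"
    unfolding J_def using Tc by (intro arg_cong2[of _ _ _ _ vcat] eq_matI) auto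
  finally show ?thesis .
qed

lemma bdiag_J: assumes "X \<in> carrier_mat m m" "dim_row Z = n" "dim_col Z = n"
  shows "bdiag X Z * J = vcat X (0\<^sub>m n m)"
proof -
  have "bdiag X Z * J = vcat (X * 1\<^sub>m m + 0\<^sub>m m n * 0\<^sub>m n m) (0\<^sub>m n m * 1\<^sub>m m + Z * 0\<^sub>m n m)"
    unfolding bdiag_def J_def using assms by (simp add: four_block_mult_vcat)
  also have "\<dots> = vcat X (0\<^sub>m n m)"
    using assms by (intro arg_cong2[of _ _ _ _ vcat] eq_matI) (auto simp: mm_one_right right_mult_zero_mat[of _ n n])
  finally show ?thesis .
qed

text \<open>The right-hand side \<open>B\<close> in block coordinates.\<close>

lemma F_MJ: "F * vcat M (0\<^sub>m n m) = B * Ci"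
proof -
  have "Q\<^sup>T * (B * Ci) = vcat M N"
    unfolding Q_transpose by (subst vcat_mult) (auto simp: M_eq N_def mm_assoc)
  then have "Q * vcat M N = B * Ci"
    using orth_cancel(2)[OF Q_orth, of "B * Ci"] by simp
  then show ?thesis
    using L_block_column[OF SPD_carrier[OF M_SPD]] by (simp add: F_def mm_assoc TM)
qed

lemma F_transpose_U: "F\<^sup>T * U = J"
  using orth_cancel(1)[OF Q_orth, of J] by (simp add: F_def mm_transpose mm_assoc QJ LTJ)

lemma secant_iff:
  assumes "dim_row P = d" "dim_col P = d"
  shows "P * A = B \<longleftrightarrow> P * U = B * Ci"
proof
  assume "P * A = B"
  then have "P * A * Ci = B * Ci" by simp
  then show "P * U = B * Ci"
    unfolding dims(4) using assms Ci(3) by (simp add: mm_assoc mm_one_right)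
next
  assume "P * U = B * Ci"
  then have "P * U * C = B * Ci * C" by simp
  then show "P * A = B"
    unfolding dims(4) using assms Ci(2) by (simp add: mm_assoc mm_one_right)
qed

lemma \<Phi>_SPD: "\<Sigma> \<in> SPD n \<Longrightarrow> \<Phi> \<Sigma> \<in> SPD d"
  unfolding \<Phi>_eq by (rule SPD_congruence_square(1)[OF QS_SPD F_carrier F_det(2)])

lemma \<Phi>_feasible:
  assumes "\<Sigma> \<in> SPD1 n"
  shows "\<Phi> \<Sigma> \<in> feasible d A B"
proof -
  have S: "\<Sigma> \<in> SPD n" "det \<Sigma> = 1" using SPD1D[OF assms] by auto
  note [simp] = SPDD(1,2)[OF S(1)] SPDD[OF QS_SPD[OF S(1)]]
  have "QS \<Sigma> * J = vcat M (0\<^sub>m n m)"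
    unfolding QS_eq[OF S(1)] using SPD_carrier[OF M_SPD] by (intro bdiag_J) auto
  then have "\<Phi> \<Sigma> * U = B * Ci"
    by (simp add: \<Phi>_eq[OF S(1)] mm_assoc F_transpose_U F_MJ)
  then have "\<Phi> \<Sigma> * A = B" using SPDD[OF \<Phi>_SPD[OF S(1)]] by (subst secant_iff) auto
  moreover have "det (\<Phi> \<Sigma>) = 1"
  proof -
    have "det (QS \<Sigma>) = 1"
      unfolding QS_eq[OF S(1)] using SPD_carrier[OF M_SPD] SPD_carrier[OF S(1)] S(2) \<rho>(2)
      by (simp add: det_bdiag[of _ m _ n] mult.commute)
    then show ?thesis
      by (simp add: \<Phi>_eq[OF S(1)] det_sandwich(2)[OF F_carrier SPD_carrier[OF QS_SPD[OF S(1)]]] F_det(1))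
  qed
  ultimately show ?thesis using \<Phi>_SPD[OF S(1)] by (simp add: feasible_def SPD1_def)
qed

text \<open>Undoing the congruence, the matrix \<open>K = F\<inverse> P F\<^sup>-\<^sup>T\<close> of a feasible \<open>P\<close> has first block column
  \<open>(M, 0)\<close>. By symmetry it is block diagonal, and its free block is the compression of \<open>K\<close> to the last
  \<open>n\<close> coordinates.\<close>

lemma \<Phi>_surj:
  assumes P: "P \<in> feasible d A B"
  shows "\<exists>\<Sigma>\<in>SPD1 n. P = \<Phi> \<Sigma>"
proof -
  note PS = feasibleD(2)[OF P]
  define G where "G = minv F"
  have G: "G \<in> carrier_mat d d" "G * F = 1\<^sub>m d" "F * G = 1\<^sub>m d"
    unfolding G_def using minv_det[OF F_carrier F_det(2)] by auto
  have GT: "F\<^sup>T * G\<^sup>T = 1\<^sub>m d" "G\<^sup>T * F\<^sup>T = 1\<^sub>m d"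
    using arg_cong[OF G(2), of transpose_mat] arg_cong[OF G(3), of transpose_mat] G(1)
    by (auto simp: mm_transpose)
  note [simp] = SPDD[OF PS] carrier_matD[OF G(1)]
  have dG: "det G \<noteq> 0" using det_mult[OF G(1) F_carrier] G(2) by auto
  define K where "K = G * P * G\<^sup>T"
  have K: "K \<in> SPD d" unfolding K_def by (rule SPD_congruence_square(1)[OF PS G(1) dG])
  note [simp] = SPDD(1,2)[OF K]
  have FKF: "F * K * F\<^sup>T = P" by (simp add: K_def mm_assoc mm_cancel[OF G(3)] GT(2) mm_one_right)
  have "G\<^sup>T * J = U"
    using arg_cong[OF F_transpose_U, of "\<lambda>M. G\<^sup>T * M"] GT(2)
    by (simp add: mm_assoc[symmetric] mm_one_left)
  moreover have "P * U = F * vcat M (0\<^sub>m n m)"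
    using feasibleD(4)[OF P] unfolding F_MJ by (subst secant_iff[symmetric]) auto
  ultimately have KJ: "K * J = vcat M (0\<^sub>m n m)" by (simp add: K_def mm_assoc mm_cancel[OF G(2)])
  have col: "K $$ (i, j) = vcat M (0\<^sub>m n m) $$ (i, j)" if ij: "i < d" "j < m" for i j
  proof -
    have "(K * J) $$ (i, j) = (\<Sum>k<d. K $$ (i, k) * J $$ (k, j))" using ij by (subst mat_index_mult) auto
    also have "\<dots> = (\<Sum>k<d. if k = j then K $$ (i, j) else 0)"
      using ij by (intro sum.cong refl) (auto simp: J_def vcat_index)
    also have "\<dots> = K $$ (i, j)" using ij by simp
    finally show ?thesis by (simp add: KJ)
  qed
  define Z where "Z = mat n n (\<lambda>(i, j). K $$ (m + i, m + j))"
  have Zc: "Z \<in> carrier_mat n n" by (simp add: Z_def)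
  have KZ: "K = bdiag M Z"
  proof (rule eq_matI)
    fix i j assume "i < dim_row (bdiag M Z)" "j < dim_col (bdiag M Z)"
    then have ij: "i < d" "j < d" using Zc by auto
    have "K $$ (i, j) = K $$ (j, i)" using Sym_index[OF SPD_Sym[OF K]] ij by blast
    then show "K $$ (i, j) = bdiag M Z $$ (i, j)"
      using ij col[of i j] col[of j i] Zc
      by (cases "i < m"; cases "j < m") (auto simp: bdiag_def vcat_index Z_def)
  qed (use Zc in auto)
  define J2 where "J2 = vcat (0\<^sub>m m n) (1\<^sub>m n :: real mat)"
  have J2c: "J2 \<in> carrier_mat d n" unfolding J2_def by (intro carrier_matI) auto
  have J2v: "J2\<^sup>T * J2 = 1\<^sub>m n"
  proof (rule eq_matI)
    fix i j assume "i < dim_row (1\<^sub>m n :: real mat)" "j < dim_col (1\<^sub>m n :: real mat)"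
    then have ij: "i < n" "j < n" by auto
    have "(J2\<^sup>T * J2) $$ (i, j) = (\<Sum>k<d. J2 $$ (k, i) * J2 $$ (k, j))"
      using ij J2c by (subst mat_index_mult) auto
    also have "\<dots> = (\<Sum>k<d. if k = m + i then (if i = j then 1 else 0) else 0)"
      using ij by (intro sum.cong refl) (auto simp: J2_def vcat_index)
    finally show "(J2\<^sup>T * J2) $$ (i, j) = 1\<^sub>m n $$ (i, j)" using ij by simp
  qed (use J2c in auto)
  have "J2\<^sup>T * K * J2 \<in> SPD n"
  proof (rule SPD_congruence[OF K J2c])
    fix v :: "real vec" assume v: "v \<in> carrier_vec n" "J2 *\<^sub>v v = 0\<^sub>v d"
    have "J2\<^sup>T *\<^sub>v (J2 *\<^sub>v v) = v"
      using v(1) J2c J2v by (subst mm_vec[symmetric]) auto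
    then show "v = 0\<^sub>v n" using v(2) J2c by (simp add: mult_mat_zero_vec)
  qed
  moreover have "J2\<^sup>T * K * J2 = Z"
  proof -
    have "K * J2 = vcat (M * 0\<^sub>m m n + 0\<^sub>m m n * 1\<^sub>m n) (0\<^sub>m n m * 0\<^sub>m m n + Z * 1\<^sub>m n)"
      unfolding KZ bdiag_def J2_def using SPD_carrier[OF M_SPD] Zc
      by (simp add: four_block_mult_vcat)
    also have "\<dots> = vcat (0\<^sub>m m n) (1\<^sub>m n * Z)"
      using SPD_carrier[OF M_SPD] Zc by (intro arg_cong2[of _ _ _ _ vcat] eq_matI) auto
    also have "\<dots> = J2 * Z"
      unfolding J2_def using Zc by (subst vcat_mult) auto
    finally have "J2\<^sup>T * K * J2 = J2\<^sup>T * (J2 * Z)" using J2c by (simp add: mm_assoc)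
    also have "\<dots> = Z" using J2c Zc J2v by (simp add: mm_assoc[symmetric] mm_one_left)
    finally show ?thesis .
  qed
  ultimately have ZS: "Z \<in> SPD n" by simp
  define \<Sigma> where "\<Sigma> = (1 / \<rho>) \<cdot>\<^sub>m Z"
  have \<Sigma>S: "\<Sigma> \<in> SPD n" unfolding \<Sigma>_def using \<rho>(1) by (intro smult_SPD[OF ZS]) simp
  have \<rho>\<Sigma>: "\<rho> \<cdot>\<^sub>m \<Sigma> = Z" unfolding \<Sigma>_def smult_smult_mat using \<rho>(1) by (intro eq_matI) auto
  have PF: "P = \<Phi> \<Sigma>" by (simp add: \<Phi>_eq[OF \<Sigma>S] QS_eq[OF \<Sigma>S] \<rho>\<Sigma> FKF flip: KZ)
  have "det P = det (QS \<Sigma>)"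
    unfolding PF \<Phi>_eq[OF \<Sigma>S]
    by (simp add: det_sandwich(2)[OF F_carrier SPD_carrier[OF QS_SPD[OF \<Sigma>S]]] F_det(1))
  also have "\<dots> = det M * (\<rho> ^ n * det \<Sigma>)"
    unfolding QS_eq[OF \<Sigma>S] using SPD_carrier[OF M_SPD] SPD_carrier[OF \<Sigma>S]
    by (simp add: det_bdiag[of _ m _ n])
  also have "\<dots> = det \<Sigma>" using \<rho>(2) by (simp add: mult.commute mult.left_commute)
  finally have "det \<Sigma> = 1" using feasibleD(3)[OF P] by simp
  then show ?thesis using \<Sigma>S PF by (auto simp: SPD1_def)
qed

lemma \<Phi>_inj: "inj_on \<Phi> (SPD1 n)"
proof (rule inj_onI)
  fix \<Sigma> \<Sigma>' assume "\<Sigma> \<in> SPD1 n" "\<Sigma>' \<in> SPD1 n" and eq: "\<Phi> \<Sigma> = \<Phi> \<Sigma>'"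
  then have S: "\<Sigma> \<in> SPD n" "\<Sigma>' \<in> SPD n" using SPD1D by auto
  define G where "G = minv F"
  have G: "G \<in> carrier_mat d d" "G * F = 1\<^sub>m d"
    unfolding G_def using minv_det[OF F_carrier F_det(2)] by auto
  have GT: "F\<^sup>T * G\<^sup>T = 1\<^sub>m d"
    using arg_cong[OF G(2), of transpose_mat] G(1) by (simp add: mm_transpose)
  note [simp] = SPDD(1,2)[OF QS_SPD[OF S(1)]] SPDD(1,2)[OF QS_SPD[OF S(2)]] carrier_matD[OF G(1)]
    SPDD(1,2)[OF S(1)] SPDD(1,2)[OF S(2)]
  note can = mm_cancel[OF G(2)]
  have "G * \<Phi> \<Sigma> * G\<^sup>T = G * \<Phi> \<Sigma>' * G\<^sup>T" by (simp add: eq)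
  then have "QS \<Sigma> = QS \<Sigma>'"
    by (simp add: \<Phi>_eq[OF S(1)] \<Phi>_eq[OF S(2)] mm_assoc can GT mm_one_right)
  then have q: "bdiag M (\<rho> \<cdot>\<^sub>m \<Sigma>) = bdiag M (\<rho> \<cdot>\<^sub>m \<Sigma>')" by (simp add: QS_eq[OF S(1)] QS_eq[OF S(2)])
  show "\<Sigma> = \<Sigma>'"
  proof (rule eq_matI)
    fix i j assume "i < dim_row \<Sigma>'" "j < dim_col \<Sigma>'"
    then have "i < n" "j < n" by auto
    then show "\<Sigma> $$ (i, j) = \<Sigma>' $$ (i, j)"
      using arg_cong[OF q, of "\<lambda>X. X $$ (m + i, m + j)"] \<rho>(1) by (simp add: bdiag_def)
  qed auto
qed

end

section \<open>The residual iteration\<close>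

text \<open>The controller \<open>\<Phi>\<close> is a congruence of the block diagonal matrix \<open>QS\<close>, so that the identity
  reference becomes \<open>R0\<close> and all distances can be computed between block diagonal matrices. In the
  frame at \<open>QS \<Sigma>\<close>, moving \<open>\<Sigma>\<close> along a geodesic with direction \<open>X\<close> is moving along \<open>hidden X\<close>.\<close>

context secant
begin

definition hidden :: "real mat \<Rightarrow> real mat" where
  "hidden X = bdiag (0\<^sub>m m m) X"

abbreviation "R \<equiv> res_R A B V C"
abbreviation "W \<equiv> res_W A B V C"

lemma zero_Sym: "0\<^sub>m k k \<in> Sym k"
  by (simp add: Sym_def)

lemma exp_zero: "mat_exp (0\<^sub>m k k) = 1\<^sub>m k"
  using mat_exp_zero[OF zero_Sym[of k]] by simp

lemma hidden_Sym: "X \<in> Sym n \<Longrightarrow> hidden X \<in> Sym d"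
  unfolding hidden_def by (rule bdiag_Sym[OF zero_Sym])

lemma hidden_smult: "X \<in> Sym n \<Longrightarrow> t \<cdot>\<^sub>m hidden X = hidden (t \<cdot>\<^sub>m X)"
  by (rule eq_matI) (auto simp: hidden_def bdiag_def)

lemma hidden_ip:
  assumes "dim_row Y = d" "dim_col Y = d" "X \<in> Sym n"
  shows "ip Y (hidden X) = ip (mat n n (\<lambda>(i, j). Y $$ (m + i, m + j))) X"
  using assms(1,2) SymD(3,4)[OF assms(3)]
  by (simp add: hidden_def bdiag_ip) (simp add: ip_def)

lemma hidden_ip_self: "X \<in> Sym n \<Longrightarrow> ip (hidden X) (hidden X) = ip X X"
  by (frule SymD(3), frule SymD(4), subst hidden_ip) (auto simp: hidden_def bdiag_def ip_def)

lemma R0_SPD: "R0 \<in> SPD d" and F_R0: "F * R0 * F\<^sup>T = 1\<^sub>m d"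
proof -
  have L: "minv L \<in> carrier_mat d d" "L * minv L = 1\<^sub>m d"
    using minv_det[OF L_carrier] L_det by auto
  have dL: "det (minv L) \<noteq> 0" using det_mult[OF L_carrier L(1)] L(2) by auto
  note [simp] = carrier_matD[OF L(1)]
  show "R0 \<in> SPD d"
    using SPD_congruence_square(1)[OF SPD_one L(1) dL] by (simp add: res_R0_def mm_one_right)
  have "(minv L)\<^sup>T * L\<^sup>T = 1\<^sub>m d" using arg_cong[OF L(2), of transpose_mat] by (simp add: mm_transpose)
  note can = mm_cancel[OF L(2)] mm_cancel[OF this]
  show "F * R0 * F\<^sup>T = 1\<^sub>m d"
    by (simp add: F_def res_R0_def mm_transpose mm_assoc can orthD(5)[OF Q_orth])
qed

lemma dist_identity_\<Phi>: "\<Sigma> \<in> SPD n \<Longrightarrow> d_AI (1\<^sub>m d) (\<Phi> \<Sigma>) = d_AI R0 (QS \<Sigma>)"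
  using d_AI_congruence[OF R0_SPD QS_SPD F_carrier F_det(2)] by (simp add: F_R0 \<Phi>_eq)

lemma dist_\<Phi>: "\<Sigma> \<in> SPD n \<Longrightarrow> \<Sigma>' \<in> SPD n \<Longrightarrow> d_AI (\<Phi> \<Sigma>) (\<Phi> \<Sigma>') = d_AI (QS \<Sigma>) (QS \<Sigma>')"
  using d_AI_congruence[OF QS_SPD QS_SPD F_carrier F_det(2)] by (simp add: \<Phi>_eq)

lemma QS_geodesic:
  assumes \<Sigma>: "\<Sigma> \<in> SPD n" and X: "X \<in> Sym n"
  shows "QS (mat_sqrt \<Sigma> * mat_exp X * mat_sqrt \<Sigma>) =
    mat_sqrt (QS \<Sigma>) * mat_exp (hidden X) * mat_sqrt (QS \<Sigma>)"
proof -
  note sM = mat_sqrt_SPD[OF M_SPD] and sS = mat_sqrt_SPD[OF \<Sigma>] and E = mat_exp_SPD[OF X]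
  note [simp] = SPDD(1,2)[OF sM] SPDD(1,2)[OF sS] SPDD(1,2)[OF E]
  have h: "mat_exp (hidden X) = bdiag (1\<^sub>m m) (mat_exp X)"
    unfolding hidden_def bdiag_exp[OF zero_Sym X] exp_zero ..
  have s: "mat_sqrt (QS \<Sigma>) = bdiag (mat_sqrt M) (sqrt \<rho> \<cdot>\<^sub>m mat_sqrt \<Sigma>)"
    unfolding QS_eq[OF \<Sigma>] bdiag_sqrt[OF M_SPD smult_SPD[OF \<Sigma> \<rho>(1)]] smult_sqrt[OF \<Sigma> \<rho>(1)] ..
  have "mat_sqrt (QS \<Sigma>) * mat_exp (hidden X) * mat_sqrt (QS \<Sigma>) =
      bdiag M (\<rho> \<cdot>\<^sub>m (mat_sqrt \<Sigma> * mat_exp X * mat_sqrt \<Sigma>))"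
    unfolding h s using \<rho>(1)
    by (simp add: bdiag_mult mm_one_right mat_sqrt_mult[OF M_SPD] mm_smult_left mm_smult_right smult_smult_mat)
  then show ?thesis using QS_eq[OF d_AI_exp_coordinates(1)[OF \<Sigma> X]] by simp
qed

lemma R_Sym: "\<Sigma> \<in> SPD n \<Longrightarrow> R \<Sigma> \<in> Sym d"
  and R0_coordinates: "\<Sigma> \<in> SPD n \<Longrightarrow> R0 = mat_sqrt (QS \<Sigma>) * mat_exp (R \<Sigma>) * mat_sqrt (QS \<Sigma>)"
proof -
  assume "\<Sigma> \<in> SPD n"
  then have Q: "QS \<Sigma> \<in> SPD d" by (rule QS_SPD)
  obtain Y where Y: "Y \<in> Sym d" "R0 = mat_sqrt (QS \<Sigma>) * mat_exp Y * mat_sqrt (QS \<Sigma>)"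
      "mat_exp Y = minv (mat_sqrt (QS \<Sigma>)) * R0 * minv (mat_sqrt (QS \<Sigma>))"
    using exp_coordinates_obtain[OF Q R0_SPD] .
  have "R \<Sigma> = Y" using mat_log_exp[OF Y(1)] by (simp add: res_R_def Let_def Y(3))
  with Y show "R \<Sigma> \<in> Sym d" "R0 = mat_sqrt (QS \<Sigma>) * mat_exp (R \<Sigma>) * mat_sqrt (QS \<Sigma>)" by auto
qed

lemma dist_R0_geodesic:
  assumes \<Sigma>: "\<Sigma> \<in> SPD n" and X: "X \<in> Sym n"
  shows "d_AI R0 (QS (mat_sqrt \<Sigma> * mat_exp (t \<cdot>\<^sub>m X) * mat_sqrt \<Sigma>)) = frob_norm (rel_log (R \<Sigma>) (hidden X) t)"
  unfolding QS_geodesic[OF \<Sigma> Sym_smult[OF X]] hidden_smult[OF X, symmetric]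
  using d_AI_frame[OF QS_SPD[OF \<Sigma>] R_Sym[OF \<Sigma>] hidden_Sym[OF X], of t]
  unfolding R0_coordinates[OF \<Sigma>, symmetric] .

lemma dist_R0: "\<Sigma> \<in> SPD n \<Longrightarrow> d_AI R0 (QS \<Sigma>) = frob_norm (R \<Sigma>)"
proof -
  assume \<Sigma>: "\<Sigma> \<in> SPD n"
  have "QS \<Sigma> = QS (mat_sqrt \<Sigma> * mat_exp (0 \<cdot>\<^sub>m 0\<^sub>m n n) * mat_sqrt \<Sigma>)"
    using SPDD[OF mat_sqrt_SPD[OF \<Sigma>]] by (simp add: exp_zero mm_one_right mat_sqrt_mult[OF \<Sigma>])
  then show ?thesis
    using dist_R0_geodesic[OF \<Sigma> zero_Sym, of 0] rel_log_0[OF R_Sym[OF \<Sigma>] hidden_Sym[OF zero_Sym]] by simp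
qed

lemma W_Sym: "\<Sigma> \<in> SPD n \<Longrightarrow> W \<Sigma> \<in> Sym n" and W_tr: "mat_tr (W \<Sigma>) = 0"
proof -
  show "mat_tr (W \<Sigma>) = 0"
    using n by (simp add: res_W_def Let_def mat_tr_def sum_subtractf)
  assume "\<Sigma> \<in> SPD n"
  then have "R \<Sigma> \<in> Sym d" by (rule R_Sym)
  then have "R \<Sigma> $$ (m + i, m + j) = R \<Sigma> $$ (m + j, m + i)" if "i < n" "j < n" for i j
    using Sym_index that by auto
  then have "(W \<Sigma>)\<^sup>T = W \<Sigma>" by (intro eq_matI) (auto simp: res_W_def Let_def)
  moreover have "W \<Sigma> \<in> carrier_mat n n" by (intro carrier_matI) (auto simp: res_W_def Let_def)
  ultimately show "W \<Sigma> \<in> Sym n" by (simp add: Sym_def)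
qed

text \<open>\<open>- W \<Sigma>\<close> is the gradient of half the squared distance on the trace-free hidden directions.\<close>

lemma ip_R_hidden:
  assumes \<Sigma>: "\<Sigma> \<in> SPD n" and X: "X \<in> Sym n" "mat_tr X = 0"
  shows "ip (R \<Sigma>) (hidden X) = ip (W \<Sigma>) X"
proof -
  define R22 where "R22 = mat n n (\<lambda>(i, j). R \<Sigma> $$ (m + i, m + j))"
  have "ip (1\<^sub>m n) X = (\<Sum>i<n. X $$ (i, i))"
  proof -
    have "(\<Sum>j<n. 1\<^sub>m n $$ (i, j) * X $$ (i, j)) = X $$ (i, i)" if "i < n" for i
    proof -
      have "(\<Sum>j<n. 1\<^sub>m n $$ (i, j) * X $$ (i, j)) = (\<Sum>j<n. if j = i then X $$ (i, i) else 0)"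
        using that by (intro sum.cong) auto
      then show ?thesis using that by simp
    qed
    then show ?thesis by (simp add: ip_def)
  qed
  then have "ip (1\<^sub>m n) X = 0" using X SymD(3)[OF X(1)] by (simp add: mat_tr_def)
  then have "ip (W \<Sigma>) X = ip R22 X"
    by (simp add: res_W_def Let_def R22_def ip_minus_left ip_smult_left)
  then show ?thesis
    using hidden_ip[OF SymD(3)[OF R_Sym[OF \<Sigma>]] SymD(4)[OF R_Sym[OF \<Sigma>]] X(1)] by (simp add: R22_def)
qed

lemma geodesic_SPD1:
  assumes \<Sigma>: "\<Sigma> \<in> SPD1 n" and X: "X \<in> Sym n"
  shows "mat_sqrt \<Sigma> * mat_exp X * mat_sqrt \<Sigma> \<in> SPD1 n \<longleftrightarrow> mat_tr X = 0"
proof -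
  note S = SPD1D[OF \<Sigma>]
  have "det (mat_sqrt \<Sigma> * mat_exp X * mat_sqrt \<Sigma>) = exp (mat_tr X)"
    by (simp add: det_sandwich(1)[OF SPD_carrier[OF half_power(1)[OF S(1)]] SPD_carrier[OF mat_exp_SPD[OF X]]]
        half_power(7)[OF S(1)] S(2) mat_exp_det[OF X])
  then show ?thesis using d_AI_exp_coordinates(1)[OF S(1) X] by (simp add: SPD1_def)
qed

text \<open>The certificate adds two inequalities with opposite roles of \<open>\<Phi> \<Sigma>\<close> and the projection \<open>s\<close>: strong
  convexity at \<open>\<Phi> \<Sigma>\<close>, and the Pythagorean inequality at \<open>s\<close>.\<close>

lemma residual_certificate:
  assumes \<Sigma>: "\<Sigma> \<in> SPD1 n" and s: "s \<in> feasible d A B"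
    and min: "\<And>X. X \<in> feasible d A B \<Longrightarrow> d_AI (1\<^sub>m d) s \<le> d_AI (1\<^sub>m d) X"
  shows "d_AI (\<Phi> \<Sigma>) s \<le> frob_norm (W \<Sigma>)"
proof -
  note S = SPD1D(1)[OF \<Sigma>]
  obtain \<Sigma>' where \<Sigma>': "\<Sigma>' \<in> SPD1 n" "s = \<Phi> \<Sigma>'" using \<Phi>_surj[OF s] by auto
  note S' = SPD1D(1)[OF \<Sigma>'(1)]
  obtain X where X: "X \<in> Sym n" "\<Sigma>' = mat_sqrt \<Sigma> * mat_exp X * mat_sqrt \<Sigma>"
    using exp_coordinates_obtain[OF S S'] .
  have tr: "mat_tr X = 0" using geodesic_SPD1[OF \<Sigma> X(1)] \<Sigma>'(1) X(2) by simp
  have one: "1 \<cdot>\<^sub>m X = X" by (rule eq_matI) auto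
  have "d_AI (\<Phi> \<Sigma>) s = frob_norm (hidden X)"
    using d_AI_exp_coordinates(2)[OF QS_SPD[OF S] hidden_Sym[OF X(1)]] QS_geodesic[OF S X(1)]
    by (simp add: \<Sigma>'(2) dist_\<Phi>[OF S S'] flip: X(2))
  then have ds: "d_AI (\<Phi> \<Sigma>) s = frob_norm X"
    by (simp add: frob_norm_eq_sqrt hidden_ip_self[OF X(1)])
  have "(frob_norm (R \<Sigma>))\<^sup>2 / 2 - 1 * ip (R \<Sigma>) (hidden X) + 1\<^sup>2 / 2 * ip (hidden X) (hidden X)
      \<le> (frob_norm (rel_log (R \<Sigma>) (hidden X) 1))\<^sup>2 / 2"
    by (rule half_square_lower_bound[OF R_Sym[OF S] hidden_Sym[OF X(1)]]) simp
  moreover have "frob_norm (rel_log (R \<Sigma>) (hidden X) 1) = d_AI (1\<^sub>m d) s"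
    using dist_R0_geodesic[OF S X(1), of 1] by (simp add: one X(2)[symmetric] dist_identity_\<Phi>[OF S'] \<Sigma>'(2))
  moreover have "frob_norm (R \<Sigma>) = d_AI (1\<^sub>m d) (\<Phi> \<Sigma>)"
    by (simp add: dist_identity_\<Phi>[OF S] dist_R0[OF S])
  moreover have "(d_AI (1\<^sub>m d) s)\<^sup>2 + (d_AI s (\<Phi> \<Sigma>))\<^sup>2 \<le> (d_AI (1\<^sub>m d) (\<Phi> \<Sigma>))\<^sup>2"
    by (rule projection_Pythagoras[OF SPD_one A s min \<Phi>_feasible[OF \<Sigma>]])
  moreover have "d_AI s (\<Phi> \<Sigma>) = frob_norm X"
    using d_AI_commute[OF \<Phi>_SPD[OF S] feasibleD(2)[OF s]] ds by simp
  ultimately have "(frob_norm X)\<^sup>2 \<le> ip (W \<Sigma>) X"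
    by (simp add: ip_R_hidden[OF S X(1) tr] hidden_ip_self[OF X(1)] frob_norm_ip[of X])
  also have "\<dots> \<le> frob_norm (W \<Sigma>) * frob_norm X"
    using SymD(3,4)[OF X(1)] SymD(3,4)[OF W_Sym[OF S]] by (intro ip_Cauchy_Schwarz) auto
  finally have "frob_norm X * frob_norm X \<le> frob_norm (W \<Sigma>) * frob_norm X" by (simp add: power2_eq_square)
  then show ?thesis
    unfolding ds using frob_norm_nonneg[of X] frob_norm_nonneg[of "W \<Sigma>"]
    by (cases "frob_norm X = 0") auto
qed

text \<open>Every step decreases half the squared distance by a fixed multiple of the squared residual, so the
  residuals are square summable and tend to zero; the certificate turns this into convergence.\<close>

theorem residual_iteration:
  assumes \<Sigma>0: "\<Sigma>0 \<in> SPD1 n" and s: "s \<in> feasible d A B"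
    and min: "\<And>X. X \<in> feasible d A B \<Longrightarrow> d_AI (1\<^sub>m d) s \<le> d_AI (1\<^sub>m d) X"
  defines "it \<equiv> res_iter A B V C \<Sigma>0"
  shows "\<Phi> (it j) \<in> feasible d A B"
    and "(\<lambda>j. d_AI (\<Phi> (it j)) s) \<longlonglongrightarrow> 0"
    and "d_AI (\<Phi> (it j)) s \<le> frob_norm (W (it j))"
proof -
  define D where "D = d_AI R0 (QS \<Sigma>0)"
  define \<tau> where "\<tau> = inverse (psi (D / sqrt 2))"
  have step: "it (Suc j) = mat_sqrt (it j) * mat_exp (\<tau> \<cdot>\<^sub>m W (it j)) * mat_sqrt (it j)" for j
    by (simp add: it_def Let_def step_const_def \<tau>_def D_def)
  have descent: "(frob_norm (R (it (Suc j))))\<^sup>2 / 2 \<le>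
        (frob_norm (R (it j)))\<^sup>2 / 2 - (1 - 1 / sqrt 2) * \<tau> * (frob_norm (W (it j)))\<^sup>2"
      "frob_norm (R (it (Suc j))) \<le> frob_norm (R (it j))"
      "it (Suc j) \<in> SPD1 n"
    if \<Sigma>: "it j \<in> SPD1 n" and b: "frob_norm (R (it j)) \<le> D" for j
  proof -
    note S = SPD1D(1)[OF \<Sigma>]
    note WS = W_Sym[OF S]
    have "mat_tr (\<tau> \<cdot>\<^sub>m W (it j)) = \<tau> * mat_tr (W (it j))"
      using SymD(3,4)[OF WS] by (simp add: mat_tr_def sum_distrib_left)
    then show \<Sigma>': "it (Suc j) \<in> SPD1 n"
      unfolding step geodesic_SPD1[OF \<Sigma> Sym_smult[OF WS]] by (simp add: W_tr)
    have e: "frob_norm (R (it (Suc j))) = frob_norm (rel_log (R (it j)) (hidden (W (it j))) \<tau>)"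
      using dist_R0[OF SPD1D(1)[OF \<Sigma>']] unfolding step dist_R0_geodesic[OF S WS] by simp
    have g: "ip (R (it j)) (hidden (W (it j))) = ip (hidden (W (it j))) (hidden (W (it j)))"
      by (simp add: ip_R_hidden[OF S WS W_tr] hidden_ip_self[OF WS])
    note gd = gradient_step_descent[OF R_Sym[OF S] hidden_Sym[OF WS] g b, folded \<tau>_def]
    show "(frob_norm (R (it (Suc j))))\<^sup>2 / 2 \<le>
        (frob_norm (R (it j)))\<^sup>2 / 2 - (1 - 1 / sqrt 2) * \<tau> * (frob_norm (W (it j)))\<^sup>2"
      using gd(1) unfolding e hidden_ip_self[OF WS] frob_norm_ip[of "W (it j)"] .
    show "frob_norm (R (it (Suc j))) \<le> frob_norm (R (it j))" using gd(2) unfolding e .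
  qed
  have inv: "it j \<in> SPD1 n \<and> frob_norm (R (it j)) \<le> D" for j
  proof (induction j)
    case 0
    then show ?case using \<Sigma>0 dist_R0[OF SPD1D(1)[OF \<Sigma>0]] by (simp add: it_def D_def)
  next
    case (Suc j)
    then show ?case using descent[of j] by auto
  qed
  show "\<Phi> (it j) \<in> feasible d A B" using \<Phi>_feasible inv by blast
  show cert: "d_AI (\<Phi> (it j)) s \<le> frob_norm (W (it j))" for j
    using residual_certificate[OF _ s min] inv by blast
  define k where "k = (1 - 1 / sqrt 2) * \<tau>"
  have k: "k > 0" unfolding k_def \<tau>_def using psi_ge_1[of "D / sqrt 2"] by (intro mult_pos_pos) auto
  have part: "(\<Sum>j<N. k * (frob_norm (W (it j)))\<^sup>2) + (frob_norm (R (it N)))\<^sup>2 / 2 \<le> (frob_norm (R (it 0)))\<^sup>2 / 2" for N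
  proof (induction N)
    case (Suc N)
    then show ?case using descent(1)[of N] inv[of N] by (simp add: k_def)
  qed simp
  have "(\<Sum>j\<le>N. k * (frob_norm (W (it j)))\<^sup>2) \<le> (frob_norm (R (it 0)))\<^sup>2 / 2" for N
    using part[of "Suc N"] zero_le_power2[of "frob_norm (R (it (Suc N)))"]
    unfolding lessThan_Suc_atMost by linarith
  then have "summable (\<lambda>j. k * (frob_norm (W (it j)))\<^sup>2)"
    using k by (intro bounded_imp_summable[where B = "(frob_norm (R (it 0)))\<^sup>2 / 2"]) simp_all
  then have "(\<lambda>j. inverse k * (k * (frob_norm (W (it j)))\<^sup>2)) \<longlonglongrightarrow> inverse k * 0"
    by (intro tendsto_mult tendsto_const summable_LIMSEQ_zero)
  then have "(\<lambda>j. (frob_norm (W (it j)))\<^sup>2) \<longlonglongrightarrow> 0" using k by simp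
  then have "(\<lambda>j. sqrt ((frob_norm (W (it j)))\<^sup>2)) \<longlonglongrightarrow> sqrt 0" by (rule tendsto_real_sqrt)
  then have "(\<lambda>j. frob_norm (W (it j))) \<longlonglongrightarrow> 0" by (simp add: frob_norm_nonneg)
  then show "(\<lambda>j. d_AI (\<Phi> (it j)) s) \<longlonglongrightarrow> 0"
    by (rule tendsto_0_le[where K = 1]) (auto simp: cert d_AI_nonneg frob_norm_nonneg)
qed

end

section \<open>Full column rank, nested column spaces\<close>

definition injective_mat :: "real mat \<Rightarrow> bool" where
  "injective_mat S \<longleftrightarrow> (\<forall>v\<in>carrier_vec (dim_col S). S *\<^sub>v v = 0\<^sub>v (dim_row S) \<longrightarrow> v = 0\<^sub>v (dim_col S))"

lemma injective_matD:
  "injective_mat S \<Longrightarrow> S \<in> carrier_mat d m \<Longrightarrow> v \<in> carrier_vec m \<Longrightarrow> S *\<^sub>v v = 0\<^sub>v d \<Longrightarrow> v = 0\<^sub>v m"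
  by (auto simp: injective_mat_def)

lemma lin_indpt_cols_injective:
  assumes "lin_indpt_cols S"
  shows "injective_mat S" "mat_rank S = dim_col S"
proof -
  have S: "S \<in> carrier_mat (dim_row S) (dim_col S)" by simp
  show "injective_mat S"
    using assms vec_space.lin_depI[OF S] unfolding lin_indpt_cols_def injective_mat_def by blast
  show "mat_rank S = dim_col S"
    using assms vec_space.lin_indpt_full_rank[OF S] unfolding lin_indpt_cols_def by blast
qed

lemma mult_unit_vec_col:
  fixes S :: "real mat"
  assumes "S \<in> carrier_mat d a" "j < a"
  shows "S *\<^sub>v unit_vec a j = col S j"
  using assms by (intro eq_vecI) auto

lemma injective_mat_rank:
  assumes "injective_mat S"
  shows "mat_rank S = dim_col S"
proof -
  have S: "S \<in> carrier_mat (dim_row S) (dim_col S)" by simp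
  have dist: "distinct (cols S)"
  proof (rule ccontr)
    assume "\<not> distinct (cols S)"
    then obtain i j where ij: "i < dim_col S" "j < dim_col S" "i \<noteq> j" "col S i = col S j"
      by (auto simp: distinct_conv_nth)
    define v :: "real vec" where "v = unit_vec (dim_col S) i - unit_vec (dim_col S) j"
    have vc: "v \<in> carrier_vec (dim_col S)" by (simp add: v_def)
    have "S *\<^sub>v v = S *\<^sub>v unit_vec (dim_col S) i - S *\<^sub>v unit_vec (dim_col S) j"
      unfolding v_def by (rule mult_minus_distrib_mat_vec[OF S]) auto
    also have "\<dots> = 0\<^sub>v (dim_row S)"
      using ij by (simp add: mult_unit_vec_col[OF S])
    finally have "v = 0\<^sub>v (dim_col S)" using assms vc by (auto simp: injective_mat_def)
    then have "v $ i = 0" using ij by simp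
    then show False using ij by (simp add: v_def)
  qed
  have "\<not> module.lin_dep class_ring (module_vec TYPE(real) (dim_row S)) (set (cols S))"
    using assms vec_space.lin_depE[OF S _ dist] unfolding injective_mat_def by metis
  then show ?thesis using vec_space.lin_indpt_full_rank[OF S dist] by blast
qed

lemma injective_mat_mult:
  assumes G: "G \<in> carrier_mat d d" "det G \<noteq> 0" and S: "S \<in> carrier_mat d m" "injective_mat S"
  shows "injective_mat (G * S)"
proof -
  note [simp] = carrier_matD[OF G(1)] carrier_matD[OF S(1)]
  have "v = 0\<^sub>v m" if v: "v \<in> carrier_vec m" "(G * S) *\<^sub>v v = 0\<^sub>v d" for v
  proof -
    have "G *\<^sub>v (S *\<^sub>v v) = 0\<^sub>v d" using v by (simp add: mm_vec)
    then have "S *\<^sub>v v = 0\<^sub>v d"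
      using invertible_injective[OF G] mult_mat_vec_carrier[OF S(1) v(1)] by blast
    then show ?thesis using injective_matD[OF S(2,1) v(1)] by blast
  qed
  then show ?thesis by (auto simp: injective_mat_def)
qed

lemma col_span_eq:
  "col_span S = {y \<in> carrier_vec (dim_row S). \<exists>x\<in>carrier_vec (dim_col S). S *\<^sub>v x = y}"
  by (rule vec_space.col_space_eq[of S "dim_row S" "dim_col S"]) simp

lemma col_span_subset_factor:
  assumes "S \<in> carrier_mat d a" "S' \<in> carrier_mat d b" "col_span S \<subseteq> col_span S'"
  shows "\<exists>G\<in>carrier_mat b a. S = S' * G"
proof -
  note [simp] = carrier_matD[OF assms(1)] carrier_matD[OF assms(2)]
  have "\<exists>x\<in>carrier_vec b. S' *\<^sub>v x = col S j" if j: "j < a" for j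
  proof -
    have "S *\<^sub>v unit_vec a j = col S j" using j by (rule mult_unit_vec_col[OF assms(1)])
    moreover have "col S j \<in> carrier_vec d" by (intro carrier_vecI) simp
    ultimately have "col S j \<in> col_span S" using j unfolding col_span_eq by auto
    then show ?thesis using assms(3) unfolding col_span_eq[of S'] by auto
  qed
  then obtain x where x: "\<And>j. j < a \<Longrightarrow> x j \<in> carrier_vec b \<and> S' *\<^sub>v x j = col S j" by metis
  define G where "G = mat b a (\<lambda>(i, j). x j $ i)"
  have "S = S' * G"
  proof (rule eq_matI)
    fix i j assume "i < dim_row (S' * G)" "j < dim_col (S' * G)"
    then have ij: "i < d" "j < a" by (auto simp: G_def)
    have "col G j = x j" using x[OF ij(2)] ij by (intro eq_vecI) (auto simp: G_def)
    then show "S $$ (i, j) = (S' * G) $$ (i, j)"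
      using x[OF ij(2)] ij by (metis (no_types, lifting) G_def assms(1,2) carrier_matD(1,2) col_def
        dim_col_mat(1) index_col index_mult_mat(1) index_mult_mat_vec)
  qed (simp_all add: G_def)
  moreover have "G \<in> carrier_mat b a" by (simp add: G_def)
  ultimately show ?thesis by blast
qed

text \<open>Injectivity of \<open>S = S' G\<close> forces \<open>G\<close> to be injective, hence to have at most as many columns as
  rows (padded with zero rows it would be a singular square matrix); if it is square, it is
  invertible and the spans agree.\<close>

lemma col_span_psubset_rank:
  assumes S: "S \<in> carrier_mat d a" "injective_mat S" and S': "S' \<in> carrier_mat d b"
    and sub: "col_span S \<subset> col_span S'"
  shows "a < b"
proof (rule ccontr)
  assume "\<not> a < b"
  obtain G where G: "G \<in> carrier_mat b a" "S = S' * G"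
    using col_span_subset_factor[OF S(1) S'] sub by auto
  note [simp] = carrier_matD[OF S'] carrier_matD[OF G(1)]
  have Ginj: "v = 0\<^sub>v a" if v: "v \<in> carrier_vec a" "G *\<^sub>v v = 0\<^sub>v b" for v
  proof -
    have "S *\<^sub>v v = S' *\<^sub>v (G *\<^sub>v v)" unfolding G(2) using v(1) by (intro mm_vec) auto
    then have "S *\<^sub>v v = 0\<^sub>v d" using v(2) by (simp add: mult_mat_zero_vec)
    then show ?thesis using injective_matD[OF S(2,1) v(1)] by blast
  qed
  define G' where "G' = mat a a (\<lambda>(i, j). if i < b then G $$ (i, j) else 0)"
  have G'c: "G' \<in> carrier_mat a a" by (simp add: G'_def)
  have G'v: "G *\<^sub>v v = 0\<^sub>v b" if "v \<in> carrier_vec a" "G' *\<^sub>v v = 0\<^sub>v a" for v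
  proof (rule eq_vecI)
    fix i assume "i < dim_vec (0\<^sub>v b :: real vec)"
    then have i: "i < b" "i < a" using \<open>\<not> a < b\<close> by auto
    then have "(G' *\<^sub>v v) $ i = 0" using that(2) by simp
    then show "(G *\<^sub>v v) $ i = 0\<^sub>v b $ i" using i that(1) by (simp add: G'_def scalar_prod_def)
  qed simp
  have det: "det G' \<noteq> 0"
    using det_0_iff_vec_prod_zero_field[OF G'c] Ginj G'v by blast
  have "b = a"
  proof (rule ccontr)
    assume "b \<noteq> a"
    then have ba: "b < a" using \<open>\<not> a < b\<close> by simp
    have "G'\<^sup>T *\<^sub>v unit_vec a b = 0\<^sub>v a"
    proof (rule eq_vecI)
      fix i assume "i < dim_vec (0\<^sub>v a :: real vec)"
      then have i: "i < a" by simp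
      have "(G'\<^sup>T *\<^sub>v unit_vec a b) $ i = col G'\<^sup>T b $ i"
        using ba G'c by (subst mult_unit_vec_col[of _ a a]) auto
      then show "(G'\<^sup>T *\<^sub>v unit_vec a b) $ i = 0\<^sub>v a $ i" using i ba by (simp add: G'_def)
    qed (simp add: G'_def)
    moreover have "unit_vec a b \<noteq> (0\<^sub>v a :: real vec)" using ba by simp
    ultimately have "det G'\<^sup>T = 0"
      using det_0_iff_vec_prod_zero_field[of "G'\<^sup>T" a] G'c unit_vec_carrier[of a b] by fastforce
    then show False using det det_transpose[OF G'c] by simp
  qed
  then have "G' = G" by (intro eq_matI) (auto simp: G'_def)
  then have "S' = S * minv G"
    using minv_det[of G a] det G'c by (simp add: G(2) mm_assoc mm_one_right \<open>b = a\<close>)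
  then have S'v: "S' *\<^sub>v x = S *\<^sub>v (minv G *\<^sub>v x)" if "x \<in> carrier_vec b" for x
    using that minv_det[of G a] det G'c \<open>G' = G\<close> carrier_matD[OF S(1)] \<open>b = a\<close>
    by (metis carrier_matD(1,2) carrier_vecD mm_vec)
  have "col_span S' \<subseteq> col_span S"
  proof
    fix y assume "y \<in> col_span S'"
    then obtain x where x: "x \<in> carrier_vec b" "S' *\<^sub>v x = y" "y \<in> carrier_vec d"
      unfolding col_span_eq by auto
    moreover have "minv G *\<^sub>v x \<in> carrier_vec a"
      using minv_det[of G a] det G'c \<open>G' = G\<close> x(1) \<open>b = a\<close> by auto
    ultimately show "y \<in> col_span S"
      using S'v[OF x(1)] carrier_matD[OF S(1)] unfolding col_span_eq by auto
  qed
  then show False using sub by blast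
qed

section \<open>Orthogonal factorizations and congruence of secant constraints\<close>

text \<open>The polar choice \<open>C = (A\<^sup>T A)\<^sup>1\<^sup>/\<^sup>2\<close> makes the columns of \<open>A C\<inverse>\<close> orthonormal.\<close>

lemma orth_factorization_exists:
  assumes A: "A \<in> carrier_mat d m" "injective_mat A" and md: "m \<le> d"
  shows "\<exists>U V C. orth_factorization A U V C"
proof -
  note [simp] = carrier_matD[OF A(1)]
  have "A\<^sup>T * 1\<^sub>m d * A \<in> SPD m"
    by (rule SPD_congruence[OF SPD_one A(1)]) (rule injective_matD[OF A(2,1)])
  then have AA: "A\<^sup>T * A \<in> SPD m" by (simp add: mm_one_right)
  define C where "C = mat_sqrt (A\<^sup>T * A)"
  have C: "C \<in> SPD m" "C * C = A\<^sup>T * A" unfolding C_def using AA by (auto simp: mat_sqrt_SPD mat_sqrt_mult)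
  define Ci where "Ci = minv C"
  have Ci: "Ci \<in> SPD m" "Ci * C = 1\<^sub>m m" "C * Ci = 1\<^sub>m m"
    unfolding Ci_def using C by (auto simp: minv_SPD minv_SPD_mult)
  note [simp] = SPDD[OF C(1)] SPDD[OF Ci(1)]
  define U where "U = A * Ci"
  have Uc: "U \<in> carrier_mat d m" unfolding U_def by (intro carrier_matI) auto
  have "U\<^sup>T * U = Ci * (A\<^sup>T * A) * Ci" by (simp add: U_def mm_transpose mm_assoc)
  also have "\<dots> = (Ci * C) * (C * Ci)" by (simp add: mm_assoc flip: C(2))
  also have "\<dots> = 1\<^sub>m m" by (simp add: Ci mm_one_left)
  finally have UU: "U\<^sup>T * U = 1\<^sub>m m" .
  obtain Q where Q: "orth d Q" "\<forall>i<d. \<forall>j<m. Q $$ (i, j) = U $$ (i, j)"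
    using orthonormal_completion[OF Uc UU md] by blast
  define V where "V = mat d (d - m) (\<lambda>(i, j). Q $$ (i, m + j))"
  have "hcat U V = Q"
    using Q orthD[OF Q(1)] Uc md by (intro eq_matI) (auto simp: hcat_def V_def)
  moreover have "A = U * C" by (simp add: U_def mm_assoc Ci mm_one_right)
  moreover have "invertible_mat C"
    using Ci by (auto simp: invertible_mat_def inverts_mat_def intro!: exI[of _ Ci])
  ultimately have "orth_factorization A U V C"
    using Uc UU orthD(4)[OF Q(1)] SPD_carrier[OF C(1)]
    by (simp add: orth_factorization_def Let_def V_def)
  then show ?thesis by blast
qed

lemma is_arg_min_iff: "is_arg_min (f :: 'a \<Rightarrow> real) (\<lambda>X. X \<in> S) x \<longleftrightarrow> x \<in> S \<and> (\<forall>X\<in>S. f x \<le> f X)"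
  by (auto simp: is_arg_min_linorder)

theorem projection_ex1:
  assumes R: "R \<in> SPD d" and A: "A \<in> carrier_mat d m" and ne: "feasible d A B \<noteq> {}"
  shows "\<exists>!X. is_arg_min (d_AI R) (\<lambda>X. X \<in> feasible d A B) X"
proof (rule ex_ex1I)
  show "\<exists>X. is_arg_min (d_AI R) (\<lambda>X. X \<in> feasible d A B) X"
    using projection_exists[OF R A ne] unfolding is_arg_min_iff by blast
  fix X Y assume "is_arg_min (d_AI R) (\<lambda>X. X \<in> feasible d A B) X" "is_arg_min (d_AI R) (\<lambda>X. X \<in> feasible d A B) Y"
  then show "X = Y" using projection_unique[OF R A, of Y B X] unfolding is_arg_min_iff by auto
qed

lemma arg_min_eqI:
  assumes "\<exists>!X. is_arg_min f P X" "is_arg_min f P x"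
  shows "arg_min f P = x"
  using assms someI[of "is_arg_min f P" x] unfolding arg_min_def by auto

text \<open>Multiplying by \<open>P\<^sup>1\<^sup>/\<^sup>2\<close> on both sides carries the constraint with reference \<open>I\<close> to the one with
  reference \<open>P\<close>, isometrically.\<close>

lemma feasible_congruence:
  assumes P: "P \<in> SPD1 d" and A: "A \<in> carrier_mat d m" and B: "B \<in> carrier_mat d m"
  defines "S \<equiv> mat_sqrt P" and "H \<equiv> minv (mat_sqrt P)"
  shows "X \<in> feasible d (S * A) (H * B) \<longleftrightarrow> X \<in> SPD d \<and> S * X * S \<in> feasible d A B"
    and "X \<in> SPD d \<Longrightarrow> d_AI P (S * X * S) = d_AI (1\<^sub>m d) X"
    and "Z \<in> feasible d A B \<Longrightarrow> H * Z * H \<in> SPD d \<and> S * (H * Z * H) * S = Z"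
proof -
  note PS = SPD1D(1)[OF P]
  note half = half_power[OF PS, folded S_def H_def]
  note S = half(1,2) and H = half(3-5)
  have dS: "det S * det S = 1" using half(7) SPD1D(2)[OF P] by simp
  note [simp] = SPDD[OF S(1)] SPDD[OF H(1)] carrier_matD[OF A] carrier_matD[OF B]
  note can = mm_cancel[OF H(2)] mm_cancel[OF H(3)]
  have det: "det (S * X * S) = det X" if "X \<in> carrier_mat d d" for X
    by (simp add: det_sandwich(1)[OF SPD_carrier[OF S(1)] that] dS)
  have eq: "X * (S * A) = H * B \<longleftrightarrow> S * X * S * A = B" if X: "dim_row X = d" "dim_col X = d" for X
  proof
    assume "X * (S * A) = H * B"
    then have "S * (X * (S * A)) = S * (H * B)" by simp
    then show "S * X * S * A = B" using X by (simp add: mm_assoc can)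
  next
    assume "S * X * S * A = B"
    then have "H * (S * X * S * A) = H * B" by simp
    then show "X * (S * A) = H * B" using X by (simp add: mm_assoc can)
  qed
  show "X \<in> feasible d (S * A) (H * B) \<longleftrightarrow> X \<in> SPD d \<and> S * X * S \<in> feasible d A B"
  proof (cases "X \<in> SPD d")
    case True
    then have "S * X * S \<in> SPD d"
      using SPD_congruence_square(1)[OF True SPD_carrier[OF S(1)] half(6)] by simp
    then show ?thesis
      using True det[OF SPD_carrier[OF True]] eq[OF SPDD(1,2)[OF True]]
      by (auto simp: feasible_def SPD1_def)
  qed (auto simp: feasible_def SPD1_def)
  show "d_AI P (S * X * S) = d_AI (1\<^sub>m d) X" if "X \<in> SPD d"
    using d_AI_congruence[OF SPD_one that SPD_carrier[OF S(1)] half(6)] by (simp add: mm_one_right S(2))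
  show "H * Z * H \<in> SPD d \<and> S * (H * Z * H) * S = Z" if "Z \<in> feasible d A B"
  proof -
    note Z = feasibleD(2)[OF that]
    note [simp] = SPDD[OF Z]
    have "H * Z * H \<in> SPD d"
      using SPD_congruence_square(1)[OF Z SPD_carrier[OF H(1)] half(8)] by simp
    moreover have "S * (H * Z * H) * S = Z" by (simp add: mm_assoc can H(2) mm_one_right)
    ultimately show ?thesis by blast
  qed
qed

section \<open>The identification threshold\<close>

lemma secantI:
  assumes "A \<in> carrier_mat d m" "B \<in> carrier_mat d m" "A\<^sup>T * B \<in> SPD m" "orth_factorization A U V C" "m < d"
  shows "secant m (d - m) A B U V C"
  using assms by (simp add: secant_def)

text \<open>A one-dimensional hidden block of determinant one is \<open>1\<close>; from dimension two on the diagonal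
  matrices \<open>diag(e\<^sup>x, e\<^sup>-\<^sup>x, 1, \<dots>)\<close> form an infinite family.\<close>

lemma SPD1_dim_1: "\<Sigma> \<in> SPD1 1 \<Longrightarrow> \<Sigma> = 1\<^sub>m 1"
proof -
  assume S: "\<Sigma> \<in> SPD1 1"
  have c: "\<Sigma> \<in> carrier_mat 1 1" using SPD_carrier[OF SPD1D(1)[OF S]] .
  have "\<Sigma> $$ (0, 0) = 1" using det_single[OF c] SPD1D(2)[OF S] by simp
  then show ?thesis using c by (intro eq_matI) auto
qed

lemma infinite_SPD1:
  assumes "2 \<le> n"
  shows "infinite (SPD1 n)"
proof -
  define f where "f k i = (if i = 0 then real k else if i = 1 then - real k else 0)" for k i :: nat
  define g where "g k = spec (1\<^sub>m n) (\<lambda>i. exp (f k i))" for k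
  have s: "(\<Sum>i<n. f k i) = 0" for k
  proof -
    have "(\<Sum>i<n. f k i) = (\<Sum>i\<in>{0, 1}. f k i)"
      using assms by (intro sum.mono_neutral_right) (auto simp: f_def)
    then show ?thesis by (simp add: f_def)
  qed
  have "g k \<in> SPD1 n" for k
    using SPD_spec_exp[OF orth_one[of n], of "f k"] spec_det[OF orth_one[of n], of "\<lambda>i. exp (f k i)"] s[of k]
    by (simp add: g_def SPD1_def flip: exp_sum)
  moreover have "inj g"
  proof (rule injI)
    fix k l assume e: "g k = g l"
    have "g k $$ (0, 0) = exp (real k)" for k
    proof -
      have "g k $$ (0, 0) = (\<Sum>i<n. 1\<^sub>m n $$ (0, i) * exp (f k i) * 1\<^sub>m n $$ (0, i))"
        unfolding g_def using assms by (subst spec_index) auto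
      also have "\<dots> = (\<Sum>i<n. if i = 0 then exp (real k) else 0)"
        using assms by (intro sum.cong) (auto simp: f_def)
      finally have "g k $$ (0, 0) = (\<Sum>i<n. if i = 0 then exp (real k) else 0)" .
      then show ?thesis using assms by simp
    qed
    with e have "exp (real k) = exp (real l)" by metis
    then show "k = l" by simp
  qed
  ultimately show ?thesis
    by (metis finite_subset image_subsetI infinite_UNIV_nat finite_imageD)
qed

lemma infinite_feasible:
  assumes A: "A \<in> carrier_mat d m" "injective_mat A" and B: "B \<in> carrier_mat d m" "A\<^sup>T * B \<in> SPD m"
    and md: "m + 2 \<le> d"
  shows "infinite (feasible d A B)"
proof -
  obtain U V C where "orth_factorization A U V C"
    using orth_factorization_exists[OF A] md by auto
  then interpret secant m "d - m" A B U V C using secantI[OF A(1) B] md by simp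
  have e: "m + (d - m) = d" using md by simp
  have "\<Phi> ` SPD1 (d - m) \<subseteq> feasible d A B" using \<Phi>_feasible unfolding e by auto
  moreover have "infinite (\<Phi> ` SPD1 (d - m))"
    using infinite_SPD1[of "d - m"] finite_imageD[OF _ \<Phi>_inj] md by auto
  ultimately show ?thesis using finite_subset by blast
qed

lemma feasible_unique:
  assumes A: "A \<in> carrier_mat d m" "injective_mat A" and B: "B \<in> carrier_mat d m" "A\<^sup>T * B \<in> SPD m"
    and md: "m + 1 = d" and P: "P \<in> feasible d A B" "P' \<in> feasible d A B"
  shows "P = P'"
proof -
  obtain U V C where "orth_factorization A U V C"
    using orth_factorization_exists[OF A] md by auto
  then interpret secant m "d - m" A B U V C using secantI[OF A(1) B] md by simp
  have e: "d - m = 1" using md by auto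
  note surj = \<Phi>_surj[unfolded e md]
  obtain \<Sigma> where "\<Sigma> \<in> SPD1 1" "P = \<Phi> \<Sigma>" using surj[OF P(1)] by blast
  moreover obtain \<Sigma>' where "\<Sigma>' \<in> SPD1 1" "P' = \<Phi> \<Sigma>'" using surj[OF P(2)] by blast
  ultimately show ?thesis using SPD1_dim_1 by metis
qed

section \<open>The outer projections\<close>

lemma sum_squared_le:
  fixes x :: "nat \<Rightarrow> real"
  shows "(\<Sum>j=1..k. x j)\<^sup>2 \<le> real k * (\<Sum>j=1..k. (x j)\<^sup>2)"
proof (induction k)
  case (Suc k)
  define s q y where "s = (\<Sum>j=1..k. x j)" and "q = (\<Sum>j=1..k. (x j)\<^sup>2)" and "y = x (Suc k)"
  have IH: "s\<^sup>2 \<le> real k * q" using Suc by (simp add: s_def q_def)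
  have "2 * s * y \<le> q + real k * y\<^sup>2"
  proof (cases "k = 0")
    case True
    then show ?thesis by (simp add: s_def q_def)
  next
    case False
    have "0 \<le> (s - real k * y)\<^sup>2" by simp
    then have "real k * (2 * s * y) \<le> real k * (q + real k * y\<^sup>2)"
      using IH by (simp add: power2_eq_square algebra_simps)
    then show ?thesis using False by simp
  qed
  then have "(s + y)\<^sup>2 \<le> real (Suc k) * (q + y\<^sup>2)"
    using IH by (simp add: power2_eq_square algebra_simps)
  then show ?case by (simp add: s_def q_def y_def)
qed simp

theorem theorem8:
  fixes d K :: nat
    and H Pstar :: "real mat"
    and c :: real
    and S A B P :: "nat \<Rightarrow> real mat"
    and r :: "nat \<Rightarrow> nat"
  assumes "0 < d" and "0 < K"
    and H: "H \<in> SPD d"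
    and c: "c = det H powr (1 / real d)"
    and Pstar: "Pstar = c \<cdot>\<^sub>m minv H"
    and S: "\<And>k. k \<in> {1..K} \<Longrightarrow> dim_row (S k) = d \<and> 0 < dim_col (S k) \<and> lin_indpt_cols (S k)"
    and nested: "\<And>k. k \<in> {1..<K} \<Longrightarrow> col_span (S k) \<subset> col_span (S (Suc k))"
    and r0: "r 0 = 0"
    and r: "\<And>k. k \<in> {1..K} \<Longrightarrow> r k = mat_rank (S k)"
    and A: "\<And>k. k \<in> {1..K} \<Longrightarrow> A k = H * S k"
    and B: "\<And>k. k \<in> {1..K} \<Longrightarrow> B k = c \<cdot>\<^sub>m S k"
    and P0: "P 0 \<in> SPD1 d"
    and P: "\<And>k. k \<in> {1..K} \<Longrightarrow>
              P k = arg_min (d_AI (P (k - 1))) (\<lambda>X. X \<in> feasible d (A k) (B k))"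
  shows
    "(\<forall>k\<in>{1..K}.
        (\<exists>!X. is_arg_min (d_AI (P (k - 1))) (\<lambda>X. X \<in> feasible d (A k) (B k)) X) \<and>
        (\<forall>j\<in>{1..k}. P k * A j = B j) \<and>
        (d_AI (P k) Pstar)\<^sup>2 + (d_AI (P (k - 1)) (P k))\<^sup>2 \<le> (d_AI (P (k - 1)) Pstar)\<^sup>2 \<and>
        (\<Sum>j=1..k. (d_AI (P (j - 1)) (P j))\<^sup>2) \<le> (d_AI (P 0) Pstar)\<^sup>2 - (d_AI (P k) Pstar)\<^sup>2 \<and>
        (\<Sum>j=1..k. d_AI (P (j - 1)) (P j)) \<le> sqrt (real k) * d_AI (P 0) Pstar) \<and>
     (r K = d - 1 \<longrightarrow> P K = Pstar) \<and>
     (\<forall>k\<in>{1..K}. r k + 2 \<le> d \<longrightarrow> infinite (feasible d (A k) (B k))) \<and>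
     (\<forall>b\<ge>1. (\<forall>k\<in>{1..<K}. r k = r (k - 1) + b) \<and> r K \<le> r (K - 1) + b \<and> r K = d - 1 \<longrightarrow>
        int K = \<lceil>(real d - 1) / real b\<rceil> \<and> P K = Pstar) \<and>
     (\<forall>k\<in>{1..K}. r k \<le> d - 1 \<longrightarrow>
        (let At = mat_sqrt (P (k - 1)) * A k;
             Bt = minv (mat_sqrt (P (k - 1))) * B k;
             s = id_proj At Bt
         in At \<in> carrier_mat d (r k) \<and> mat_rank At = r k \<and>
            Bt \<in> carrier_mat d (r k) \<and> At\<^sup>T * Bt \<in> SPD (r k) \<and>
            (\<exists>!X. is_arg_min (d_AI (1\<^sub>m d)) (\<lambda>X. X \<in> feasible d At Bt) X) \<and>
            P k = mat_sqrt (P (k - 1)) * s * mat_sqrt (P (k - 1)) \<and>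
            (\<exists>U V C. orth_factorization At U V C) \<and>
            (\<forall>U V C \<Sigma>0. orth_factorization At U V C \<and> \<Sigma>0 \<in> SPD1 (d - r k) \<longrightarrow>
               (let \<Phi> = \<lambda>j. controller At Bt U V C (res_iter At Bt V C \<Sigma>0 j)
                in (\<forall>j. \<Phi> j \<in> feasible d At Bt) \<and>
                   (\<lambda>j. d_AI (\<Phi> j) s) \<longlonglongrightarrow> 0 \<and>
                   (\<forall>j. d_AI (\<Phi> j) s \<le> frob_norm (res_W At Bt V C (res_iter At Bt V C \<Sigma>0 j)))))))"
proof -
  have d: "0 < d" and K: "0 < K" by fact+
  have HS: "det H > 0" by (rule SPD_det_pos[OF H])
  note [simp] = SPDD(1,2)[OF H]
  have c0: "c > 0" and cd: "c ^ d = det H"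
  proof -
    show "c > 0" using HS by (simp add: c)
    have "c ^ d = det H powr (1 / real d * real d)" using HS by (simp add: c powr_powr flip: powr_realpow)
    then show "c ^ d = det H" using d HS by simp
  qed
  have Ps: "Pstar \<in> SPD1 d"
  proof -
    have "det (minv H) * det H = 1"
      using det_mult[OF SPD_carrier[OF minv_SPD[OF H]] SPD_carrier[OF H]] minv_SPD_mult(1)[OF H] by simp
    then have "det Pstar = 1"
      using SPD_carrier[OF minv_SPD[OF H]] cd by (simp add: Pstar mult.commute)
    then show ?thesis using smult_SPD[OF minv_SPD[OF H] c0] by (simp add: SPD1_def Pstar)
  qed
  have Sk: "S k \<in> carrier_mat d (r k)" "injective_mat (S k)" "0 < r k" if k: "k \<in> {1..K}" for k
  proof -
    note lin = lin_indpt_cols_injective[of "S k"]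
    have "r k = dim_col (S k)" using lin(2) S[OF k] r[OF k] by simp
    then show "S k \<in> carrier_mat d (r k)" "injective_mat (S k)" "0 < r k"
      using S[OF k] lin(1) by (auto intro: carrier_matI)
  qed
  have Ak: "A k \<in> carrier_mat d (r k)" "injective_mat (A k)" if k: "k \<in> {1..K}" for k
    using injective_mat_mult[OF SPD_carrier[OF H] _ Sk(1,2)[OF k]] HS carrier_matD[OF Sk(1)[OF k]]
    by (auto simp: A[OF k] intro!: carrier_matI)
  have Bk: "B k \<in> carrier_mat d (r k)" if k: "k \<in> {1..K}" for k
    using Sk(1)[OF k] by (simp add: B[OF k])
  have ABk: "(A k)\<^sup>T * B k \<in> SPD (r k)" if k: "k \<in> {1..K}" for k
  proof -
    have "(S k)\<^sup>T * H * S k \<in> SPD (r k)"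
      using SPD_congruence[OF H Sk(1)[OF k]] injective_matD[OF Sk(2)[OF k] Sk(1)[OF k]] by blast
    moreover have "(A k)\<^sup>T * B k = c \<cdot>\<^sub>m ((S k)\<^sup>T * H * S k)"
      using carrier_matD[OF Sk(1)[OF k]] SPDD(3)[OF H]
      by (simp add: A[OF k] B[OF k] mm_transpose mm_smult_right)
    ultimately show ?thesis using smult_SPD c0 by simp
  qed
  have Psf: "Pstar \<in> feasible d (A k) (B k)" if k: "k \<in> {1..K}" for k
  proof -
    note [simp] = carrier_matD[OF Sk(1)[OF k]] SPDD(1,2)[OF minv_SPD[OF H]]
    have "minv H * (H * S k) = S k"
      by (simp add: mm_assoc[symmetric] minv_SPD_mult(1)[OF H] mm_one_left)
    then have "Pstar * A k = B k" by (simp add: Pstar A[OF k] B[OF k] mm_smult_left)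
    then show ?thesis using Ps by (simp add: feasible_def)
  qed
  \<comment> \<open>A round has a minimizer once its reference is positive definite, so this goes by induction.\<close>
  have ex1: "\<exists>!X. is_arg_min (d_AI (P (k - 1))) (\<lambda>X. X \<in> feasible d (A k) (B k)) X"
    if "k \<in> {1..K}" "P (k - 1) \<in> SPD1 d" for k
    using projection_ex1[OF SPD1D(1)[OF that(2)] Ak(1)[OF that(1)]] Psf[OF that(1)] by blast
  have amin: "is_arg_min (d_AI (P (k - 1))) (\<lambda>X. X \<in> feasible d (A k) (B k)) (P k)"
    if "k \<in> {1..K}" "P (k - 1) \<in> SPD1 d" for k
    unfolding P[OF that(1)] arg_min_def by (rule someI_ex) (use ex1[OF that] in blast)
  have PS: "k \<le> K \<Longrightarrow> P k \<in> SPD1 d" for k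
  proof (induction k)
    case (Suc k)
    then show ?case using amin[of "Suc k"] by (auto simp: is_arg_min_iff dest: feasibleD(1))
  qed (rule P0)
  have PS': "P (k - 1) \<in> SPD1 d" if "k \<in> {1..K}" for k using that by (intro PS) auto
  have Pk: "P k \<in> feasible d (A k) (B k)" and
      Pmin: "\<And>X. X \<in> feasible d (A k) (B k) \<Longrightarrow> d_AI (P (k - 1)) (P k) \<le> d_AI (P (k - 1)) X"
    if "k \<in> {1..K}" for k
    using amin[OF that PS'[OF that]] by (auto simp: is_arg_min_iff)
  have pyth: "(d_AI (P k) Pstar)\<^sup>2 + (d_AI (P (k - 1)) (P k))\<^sup>2 \<le> (d_AI (P (k - 1)) Pstar)\<^sup>2"
    if "k \<in> {1..K}" for k
    using projection_Pythagoras[OF SPD1D(1)[OF PS'[OF that]] Ak(1)[OF that] Pk[OF that] Pmin[OF that] Psf[OF that]]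
    by simp
  have tele: "(\<Sum>j=1..k. (d_AI (P (j - 1)) (P j))\<^sup>2) \<le> (d_AI (P 0) Pstar)\<^sup>2 - (d_AI (P k) Pstar)\<^sup>2"
    if "k \<le> K" for k
    using that
  proof (induction k)
    case (Suc k)
    then show ?case using pyth[of "Suc k"] by simp
  qed simp
  have length: "(\<Sum>j=1..k. d_AI (P (j - 1)) (P j)) \<le> sqrt (real k) * d_AI (P 0) Pstar" if "k \<le> K" for k
  proof (rule power2_le_imp_le)
    have "(\<Sum>j=1..k. d_AI (P (j - 1)) (P j))\<^sup>2 \<le> real k * (\<Sum>j=1..k. (d_AI (P (j - 1)) (P j))\<^sup>2)"
      by (rule sum_squared_le)
    also have "\<dots> \<le> real k * (d_AI (P 0) Pstar)\<^sup>2"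
      using tele[OF that] zero_le_power2[of "d_AI (P k) Pstar"] by (intro mult_left_mono) linarith+
    finally show "(\<Sum>j=1..k. d_AI (P (j - 1)) (P j))\<^sup>2 \<le> (sqrt (real k) * d_AI (P 0) Pstar)\<^sup>2"
      by (simp add: power_mult_distrib)
  qed (simp add: d_AI_nonneg)
  have sub: "j \<le> k \<Longrightarrow> 1 \<le> j \<Longrightarrow> k \<le> K \<Longrightarrow> col_span (S j) \<subseteq> col_span (S k)" for j k
  proof (induction k rule: dec_induct)
    case (step k)
    then show ?case using nested[of k] by auto
  qed simp
  \<comment> \<open>Earlier probe directions are combinations of the current ones.\<close>
  have earlier: "P k * A j = B j" if k: "k \<in> {1..K}" and j: "j \<in> {1..k}" for j k
  proof -
    have jK: "j \<in> {1..K}" using k j by auto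
    obtain G where G: "G \<in> carrier_mat (r k) (r j)" "S j = S k * G"
      using col_span_subset_factor[OF Sk(1)[OF jK] Sk(1)[OF k] sub] k j by auto
    note [simp] = carrier_matD[OF Sk(1)[OF k]] carrier_matD[OF G(1)] SPDD(1,2)[OF SPD1D(1)[OF PS]]
    have [simp]: "dim_col (P k) = d" using SPDD(2)[OF feasibleD(2)[OF Pk[OF k]]] .
    have "P k * (H * S k) = c \<cdot>\<^sub>m S k" using feasibleD(4)[OF Pk[OF k]] by (simp add: A[OF k] B[OF k])
    then have "P k * (H * S k) * G = (c \<cdot>\<^sub>m S k) * G" by simp
    then show ?thesis by (simp add: A[OF jK] B[OF jK] G(2) mm_assoc mm_smult_left)
  qed
  have KK: "K \<in> {1..K}" using K by simp
  have exact: "P K = Pstar" if "r K = d - 1"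
  proof -
    have "r K + 1 = d" using that d by simp
    then show ?thesis
      using feasible_unique[OF Ak[OF KK] Bk[OF KK] ABk[OF KK] _ Pk[OF KK] Psf[OF KK]] by simp
  qed
  have rK: "r (K - 1) < r K"
  proof (cases "K = 1")
    case True
    then show ?thesis using r0 Sk(3)[OF KK] by simp
  next
    case False
    then have k: "K - 1 \<in> {1..<K}" "K - 1 \<in> {1..K}" using K by auto
    show ?thesis
      using col_span_psubset_rank[OF Sk(1,2)[OF k(2)] Sk(1)[OF KK]] nested[OF k(1)] K by simp
  qed
  have rounds: "int K = \<lceil>(real d - 1) / real b\<rceil>"
    if b: "b \<ge> 1" and inc: "\<forall>k\<in>{1..<K}. r k = r (k - 1) + b" and last: "r K \<le> r (K - 1) + b" "r K = d - 1" for b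
  proof -
    \<comment> \<open>Before the final round, ranks are multiples of \<open>b\<close>; strict nesting makes the final gain positive.\<close>
    have rk: "k < K \<Longrightarrow> r k = k * b" for k
    proof (induction k)
      case (Suc k)
      then show ?case using bspec[OF inc, of "Suc k"] by simp
    qed (simp add: r0)
    have q: "(K - 1) * b < d - 1" "d - 1 \<le> (K - 1) * b + b" using rk[of "K - 1"] rK last K by auto
    have "real ((K - 1) * b) < real (d - 1)" "real (d - 1) \<le> real ((K - 1) * b + b)"
      using q by (simp_all only: of_nat_less_iff of_nat_le_iff)
    then have "(real K - 1) * real b < real d - 1" "real d - 1 \<le> real K * real b"
      using d K by (simp_all add: of_nat_diff algebra_simps)
    then have "\<lceil>(real d - 1) / real b\<rceil> = int K"
      using b by (intro ceiling_unique) (simp_all add: field_simps)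
    then show ?thesis by simp
  qed
  have reduction: "let At = mat_sqrt (P (k - 1)) * A k;
             Bt = minv (mat_sqrt (P (k - 1))) * B k;
             s = id_proj At Bt
         in At \<in> carrier_mat d (r k) \<and> mat_rank At = r k \<and>
            Bt \<in> carrier_mat d (r k) \<and> At\<^sup>T * Bt \<in> SPD (r k) \<and>
            (\<exists>!X. is_arg_min (d_AI (1\<^sub>m d)) (\<lambda>X. X \<in> feasible d At Bt) X) \<and>
            P k = mat_sqrt (P (k - 1)) * s * mat_sqrt (P (k - 1)) \<and>
            (\<exists>U V C. orth_factorization At U V C) \<and>
            (\<forall>U V C \<Sigma>0. orth_factorization At U V C \<and> \<Sigma>0 \<in> SPD1 (d - r k) \<longrightarrow>
               (let \<Phi> = \<lambda>j. controller At Bt U V C (res_iter At Bt V C \<Sigma>0 j)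
                in (\<forall>j. \<Phi> j \<in> feasible d At Bt) \<and>
                   (\<lambda>j. d_AI (\<Phi> j) s) \<longlonglongrightarrow> 0 \<and>
                   (\<forall>j. d_AI (\<Phi> j) s \<le> frob_norm (res_W At Bt V C (res_iter At Bt V C \<Sigma>0 j)))))"
    if k: "k \<in> {1..K}" and rk: "r k \<le> d - 1" for k
  proof -
    have md: "r k < d" using rk d by simp
    define T where "T = mat_sqrt (P (k - 1))"
    define At where "At = T * A k"
    define Bt where "Bt = minv T * B k"
    define s where "s = id_proj At Bt"
    have T: "T \<in> SPD d" unfolding T_def by (rule mat_sqrt_SPD[OF SPD1D(1)[OF PS'[OF k]]])
    note [simp] = SPDD[OF T] SPDD[OF minv_SPD[OF T]] carrier_matD[OF Ak(1)[OF k]] carrier_matD[OF Bk[OF k]]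
    have Atc: "At \<in> carrier_mat d (r k)" and Btc: "Bt \<in> carrier_mat d (r k)"
      unfolding At_def Bt_def by (intro carrier_matI; simp)+
    have At_inj: "injective_mat At"
      unfolding At_def using SPD_det_pos[OF T] by (intro injective_mat_mult[OF SPD_carrier[OF T] _ Ak[OF k]]) simp
    have rank: "mat_rank At = r k" using injective_mat_rank[OF At_inj] carrier_matD(2)[OF Atc] by simp
    have "T * (minv T * B k) = B k"
      by (simp add: mm_assoc[symmetric] minv_SPD_mult(2)[OF T] mm_one_left)
    then have AtBt: "At\<^sup>T * Bt \<in> SPD (r k)"
      using ABk[OF k] by (simp add: At_def Bt_def mm_transpose mm_assoc)
    note cong = feasible_congruence[OF PS'[OF k] Ak(1)[OF k] Bk[OF k], folded T_def, folded At_def Bt_def]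
    have "minv T * Pstar * minv T \<in> feasible d At Bt"
      unfolding cong(1) using cong(3)[OF Psf[OF k]] Psf[OF k] by simp
    then have ne: "feasible d At Bt \<noteq> {}" by blast
    have ex: "\<exists>!X. is_arg_min (d_AI (1\<^sub>m d)) (\<lambda>X. X \<in> feasible d At Bt) X"
      by (rule projection_ex1[OF SPD_one Atc ne])
    have "is_arg_min (d_AI (1\<^sub>m d)) (\<lambda>X. X \<in> feasible d At Bt) s"
      unfolding s_def id_proj_def carrier_matD(1)[OF Atc] arg_min_def by (rule someI_ex[OF ex1_implies_ex[OF ex]])
    then have s: "s \<in> feasible d At Bt" "\<And>X. X \<in> feasible d At Bt \<Longrightarrow> d_AI (1\<^sub>m d) s \<le> d_AI (1\<^sub>m d) X"
      by (auto simp: is_arg_min_iff)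
    have "is_arg_min (d_AI (P (k - 1))) (\<lambda>X. X \<in> feasible d (A k) (B k)) (T * s * T)"
      unfolding is_arg_min_iff
    proof (intro conjI ballI)
      have sS: "s \<in> SPD d" and "T * s * T \<in> feasible d (A k) (B k)" using s(1) cong(1) by auto
      then show "T * s * T \<in> feasible d (A k) (B k)" by simp
      fix X assume X: "X \<in> feasible d (A k) (B k)"
      define Z where "Z = minv T * X * minv T"
      have Z: "Z \<in> SPD d" "T * Z * T = X" using cong(3)[OF X] by (auto simp: Z_def)
      then have "Z \<in> feasible d At Bt" using cong(1) X by simp
      from s(2)[OF this] show "d_AI (P (k - 1)) (T * s * T) \<le> d_AI (P (k - 1)) X"
        using cong(2)[OF sS] cong(2)[OF Z(1)] Z(2) by simp
    qed
    then have Pks: "P k = T * s * T"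
      unfolding P[OF k] by (rule arg_min_eqI[OF ex1[OF k PS'[OF k]]])
    have iteration: "(\<forall>j. controller At Bt U V C (res_iter At Bt V C \<Sigma>0 j) \<in> feasible d At Bt) \<and>
        (\<lambda>j. d_AI (controller At Bt U V C (res_iter At Bt V C \<Sigma>0 j)) s) \<longlonglongrightarrow> 0 \<and>
        (\<forall>j. d_AI (controller At Bt U V C (res_iter At Bt V C \<Sigma>0 j)) s
          \<le> frob_norm (res_W At Bt V C (res_iter At Bt V C \<Sigma>0 j)))"
      if f: "orth_factorization At U V C" and \<Sigma>0: "\<Sigma>0 \<in> SPD1 (d - r k)" for U V C \<Sigma>0
    proof -
      interpret secant "r k" "d - r k" At Bt U V C by (rule secantI[OF Atc Btc AtBt f md])
      have e: "r k + (d - r k) = d" using md by simp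
      show ?thesis using residual_iteration[OF \<Sigma>0, of s, unfolded e, OF s] by blast
    qed
    have "\<exists>U V C. orth_factorization At U V C"
      using orth_factorization_exists[OF Atc At_inj] md by simp
    then show ?thesis
      unfolding Let_def T_def[symmetric] At_def[symmetric] Bt_def[symmetric] s_def[symmetric]
      using Atc Btc rank AtBt ex Pks iteration by blast
  qed
  have infin: "infinite (feasible d (A k) (B k))" if "k \<in> {1..K}" "r k + 2 \<le> d" for k
    using infinite_feasible[OF Ak[OF that(1)] Bk[OF that(1)] ABk[OF that(1)] that(2)] .
  show ?thesis
  proof (intro conjI ballI impI allI)
    fix k assume k: "k \<in> {1..K}"
    show "\<exists>!X. is_arg_min (d_AI (P (k - 1))) (\<lambda>X. X \<in> feasible d (A k) (B k)) X"
      by (rule ex1[OF k PS'[OF k]])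
    show "(d_AI (P k) Pstar)\<^sup>2 + (d_AI (P (k - 1)) (P k))\<^sup>2 \<le> (d_AI (P (k - 1)) Pstar)\<^sup>2"
      by (rule pyth[OF k])
    show "(\<Sum>j=1..k. (d_AI (P (j - 1)) (P j))\<^sup>2) \<le> (d_AI (P 0) Pstar)\<^sup>2 - (d_AI (P k) Pstar)\<^sup>2"
      using k by (intro tele) simp
    show "(\<Sum>j=1..k. d_AI (P (j - 1)) (P j)) \<le> sqrt (real k) * d_AI (P 0) Pstar"
      using k by (intro length) simp
    show "P k * A j = B j" if "j \<in> {1..k}" for j by (rule earlier[OF k that])
    show "infinite (feasible d (A k) (B k))" if "r k + 2 \<le> d" by (rule infin[OF k that])
  next
    show "P K = Pstar" if "r K = d - 1" by (rule exact[OF that])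
  next
    fix b :: nat assume "1 \<le> b" "(\<forall>k\<in>{1..<K}. r k = r (k - 1) + b) \<and> r K \<le> r (K - 1) + b \<and> r K = d - 1"
    then show "int K = \<lceil>(real d - 1) / real b\<rceil>" "P K = Pstar" using rounds exact by auto
  qed (rule reduction)
qed

end
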